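(* Let $0<p\leq q<\infty$, $-1<\alpha,\beta<\infty$, and $\lambda=q/p$. Let $\varphi$ and $\psi$ be holomorphic self-maps of $\mathbb{B}$. Then the operator $C_\varphi-C_\psi$ maps $A^p_\alpha$ into $A^q_\beta$ if and only if the joint pull-back measure $\omega_{\beta,q}$ is a $(\lambda,\alpha)$-Bergman Carleson measure. Furthermore, for some (equivalently, for all) $s>0$, $$\|C_\varphi-C_\psi\|_{A^p_\alpha\to A^q_\beta}^q\asymp\sup_{a\in\mathbb{B}}\int_{\mathbb{B}}\left(\frac{(1-|a|^2)^{s}}{|1-\langle a,\varphi(z)\rangle|^{(n+1+\alpha)\lambda+s}}+\frac{(1-|a|^2)^{s}}{|1-\langle a,\psi(z)\rangle|^{(n+1+\alpha)\lambda+s}}\right)\rho(z)^q\,d\nu_\beta(z).$$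
   Context: $\mathbb{B}=\mathbb{B}_n$ is the open unit ball of $\mathbb{C}^n$, with $\langle z,w\rangle=\sum_{j=1}^n z_j\overline{w_j}$ and $|z|=\sqrt{\langle z,z\rangle}$. A holomorphic self-map of $\mathbb{B}$ is a holomorphic map $\mathbb{B}\to\mathbb{B}$; for such $\varphi$, the composition operator is $C_\varphi f=f\circ\varphi$ for $f$ holomorphic on $\mathbb{B}$. Weighted Bergman spaces: $\nu$ is the normalized volume measure on $\mathbb{B}$; for $\alpha>-1$, $d\nu_\alpha(z)=c_\alpha(1-|z|^2)^\alpha d\nu(z)$ with $c_\alpha$ such that $\nu_\alpha(\mathbb{B})=1$. For $0<p<\infty$, $A^p_\alpha$ is the space of holomorphic $f$ on $\mathbb{B}$ with $\|f\|_{A^p_\alpha}^p=\int_{\mathbb{B}}|f|^p\,d\nu_\alpha<\infty$. Operator norm: $\|T\|_{X\to Y}=\sup_{\|f\|_X\le1}\|Tf\|_Y$ (possibly $+\infty$), where $\|\cdot\|$ denotes the norm or quasi-norm. Pseudo-hyperbolic distance: $\rho(z,w)=|\sigma_z(w)|$, where $\sigma_z(w)=\dfrac{z-P_z(w)-\sqrt{1-|z|^2}\,Q_z(w)}{1-\langle w,z\rangle}$, $P_z$ is the orthogonal projection of $\mathbb{C}^n$ onto the span of $z$ ($P_0=0$), and $Q_z=I-P_z$. Equivalently, $1-\rho(z,w)^2=\dfrac{(1-|z|^2)(1-|w|^2)}{|1-\langle w,z\rangle|^2}$. Given $\varphi,\psi$, put $\rho(z)=\rho(\varphi(z),\psi(z))$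 for $z\in\mathbb{B}$. Joint pull-back measure: for Borel sets $E\subset\mathbb{B}$, $$\omega_{\beta,q}(E)=\int_{\varphi^{-1}(E)}\rho(z)^q\,d\nu_\beta(z)+\int_{\psi^{-1}(E)}\rho(z)^q\,d\nu_\beta(z).$$ A positive Borel measure $\mu$ on $\mathbb{B}$ is a $(\lambda,\alpha)$-Bergman Carleson measure (also called $(\lambda,\alpha)$-Carleson measure), for $\lambda>0$, $\alpha>-1$, if for any two positive numbers $p,q$ with $q/p=\lambda$ there is a constant $C>0$ such that $\int_{\mathbb{B}}|f|^q\,d\mu\le C\|f\|_{A^p_\alpha}^q$ for all $f\in A^p_\alpha$. $A\asymp B$ means $C^{-1}B\le A\le CB$ for a positive constant $C$ independent of $\varphi$ and $\psi$ (it may depend on $n,p,q,\alpha,\beta,s$). *)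

theory Defs
  imports "HOL-Analysis.Analysis"
begin

definition herm_inner :: "complex ^ 'n \<Rightarrow> complex ^ 'n \<Rightarrow> complex" where
  "herm_inner z w = (\<Sum>j\<in>UNIV. z $ j * cnj (w $ j))"

text \<open>The library norm on \<^typ>\<open>complex ^ 'n\<close> is the Hermitian one:\<close>

lemma norm_eq_sqrt_herm_inner: "complex_of_real (norm z) = csqrt (herm_inner z z)"
proof -
  have "herm_inner z z = complex_of_real ((norm z)\<^sup>2)"
    by (simp add: herm_inner_def norm_vec_def L2_set_def sum_nonneg flip: complex_norm_square)
  then show ?thesis by simp
qed

abbreviation unit_ball :: "(complex ^ 'n) set" where
  "unit_ball \<equiv> ball 0 1"

text \<open>Holomorphy in several variables: Frechet differentiability at every point, with
  complex-linear derivative (additivity of \<open>D\<close> is part of \<^const>\<open>has_derivative\<close>).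
  It is only used on open sets.\<close>

definition mv_holomorphic_on :: "(complex ^ 'n \<Rightarrow> complex) \<Rightarrow> (complex ^ 'n) set \<Rightarrow> bool" where
  "mv_holomorphic_on f S \<longleftrightarrow>
     (\<forall>z\<in>S. \<exists>D. (f has_derivative D) (at z) \<and> (\<forall>c v. D (c *s v) = c * D v))"

definition holomorphic_self_map :: "(complex ^ 'n \<Rightarrow> complex ^ 'n) \<Rightarrow> bool" where
  "holomorphic_self_map \<phi> \<longleftrightarrow>
     (\<forall>j. mv_holomorphic_on (\<lambda>z. \<phi> z $ j) unit_ball) \<and> \<phi> ` unit_ball \<subseteq> unit_ball"

definition comp_op ::
  "(complex ^ 'n \<Rightarrow> complex ^ 'n) \<Rightarrow> (complex ^ 'n \<Rightarrow> complex) \<Rightarrow> complex ^ 'n \<Rightarrow> complex" where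
  "comp_op \<phi> f = f \<circ> \<phi>"

text \<open>All measures below have \<^const>\<open>unit_ball\<close> as their underlying space, so the values of
  the (total) functions outside the ball play no role in any integral.\<close>

definition ball_borel :: "(complex ^ 'n) measure" where
  "ball_borel = restrict_space borel unit_ball"

definition nu :: "(complex ^ 'n) measure" where
  "nu = uniform_measure (restrict_space lborel unit_ball) unit_ball"

text \<open>The integral is finite and positive exactly for \<open>\<alpha> > -1\<close>; the argument
  \<open>TYPE('n)\<close> carries the dimension.\<close>

definition c_const :: "'n::finite itself \<Rightarrow> real \<Rightarrow> real" where
  "c_const _ \<alpha> = 1 / (\<integral>z. (1 - (norm z)\<^sup>2) powr \<alpha> \<partial>(nu :: (complex ^ 'n) measure))"

definition nu_w :: "real \<Rightarrow> (complex ^ 'n) measure" where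
  "nu_w \<alpha> = density nu (\<lambda>z. ennreal (c_const TYPE('n) \<alpha> * (1 - (norm z)\<^sup>2) powr \<alpha>))"

text \<open>Real powers on \<^typ>\<open>ennreal\<close>, for exponents \<open>a > 0\<close>.\<close>

definition epowr :: "ennreal \<Rightarrow> real \<Rightarrow> ennreal" where
  "epowr x a = (if x = \<infinity> then \<infinity> else ennreal (enn2real x powr a))"

text \<open>The (quasi-)norm takes the value \<open>\<infinity>\<close> when the integral diverges.\<close>

definition bergman_norm :: "real \<Rightarrow> real \<Rightarrow> (complex ^ 'n \<Rightarrow> complex) \<Rightarrow> ennreal" where
  "bergman_norm p \<alpha> f = epowr (\<integral>\<^sup>+z. ennreal (norm (f z) powr p) \<partial>nu_w \<alpha>) (1 / p)"

definition bergman_space :: "real \<Rightarrow> real \<Rightarrow> (complex ^ 'n \<Rightarrow> complex) set" where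
  "bergman_space p \<alpha> =
     {f. mv_holomorphic_on f unit_ball \<and> (\<integral>\<^sup>+z. ennreal (norm (f z) powr p) \<partial>nu_w \<alpha>) < \<infinity>}"

definition bergman_op_norm ::
  "real \<Rightarrow> real \<Rightarrow> real \<Rightarrow> real \<Rightarrow>
   ((complex ^ 'n \<Rightarrow> complex) \<Rightarrow> (complex ^ 'n \<Rightarrow> complex)) \<Rightarrow> ennreal" where
  "bergman_op_norm p \<alpha> q \<beta> T =
     (SUP f \<in> {f \<in> bergman_space p \<alpha>. bergman_norm p \<alpha> f \<le> 1}. bergman_norm q \<beta> (T f))"

text \<open>For \<open>z = 0\<close> the quotient is \<open>0\<close> by convention, so \<open>P\<^sub>0 = 0\<close>.\<close>

definition proj_span :: "complex ^ 'n \<Rightarrow> complex ^ 'n \<Rightarrow> complex ^ 'n" where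
  "proj_span z w = (herm_inner w z / herm_inner z z) *s z"

definition ball_involution :: "complex ^ 'n \<Rightarrow> complex ^ 'n \<Rightarrow> complex ^ 'n" where
  "ball_involution z w =
     (1 / (1 - herm_inner w z)) *s
       (z - proj_span z w - sqrt (1 - (norm z)\<^sup>2) *\<^sub>R (w - proj_span z w))"

definition pseudo_hyp_dist :: "complex ^ 'n \<Rightarrow> complex ^ 'n \<Rightarrow> real" where
  "pseudo_hyp_dist z w = norm (ball_involution z w)"

definition joint_pullback ::
  "real \<Rightarrow> real \<Rightarrow> (complex ^ 'n \<Rightarrow> complex ^ 'n) \<Rightarrow> (complex ^ 'n \<Rightarrow> complex ^ 'n) \<Rightarrow>
   (complex ^ 'n) measure" where
  "joint_pullback \<beta> q \<phi> \<psi> =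
     measure_of unit_ball (sets ball_borel)
       (\<lambda>E. (\<integral>\<^sup>+z\<in>\<phi> -` E. ennreal (pseudo_hyp_dist (\<phi> z) (\<psi> z) powr q) \<partial>nu_w \<beta>) +
            (\<integral>\<^sup>+z\<in>\<psi> -` E. ennreal (pseudo_hyp_dist (\<phi> z) (\<psi> z) powr q) \<partial>nu_w \<beta>))"

definition bergman_carleson :: "real \<Rightarrow> real \<Rightarrow> (complex ^ 'n) measure \<Rightarrow> bool" where
  "bergman_carleson lam \<alpha> \<mu> \<longleftrightarrow>
     sets \<mu> = sets ball_borel \<and>
     (\<forall>p q. 0 < p \<longrightarrow> 0 < q \<longrightarrow> q / p = lam \<longrightarrow>
        (\<exists>C>0. \<forall>f \<in> bergman_space p \<alpha>.
           (\<integral>\<^sup>+z. ennreal (norm (f z) powr q) \<partial>\<mu>) \<le> ennreal C * epowr (bergman_norm p \<alpha> f) q))"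

text \<open>\<^const>\<open>measure_of\<close> only yields the prescribed set function if that is a measure. The
  following facts confirm it for holomorphic self-maps.\<close>

lemma sets_nu_w [measurable_cong]: "sets (nu_w \<alpha>) = sets ball_borel"
  by (simp add: nu_w_def nu_def uniform_measure_def ball_borel_def sets_restrict_space)

lemma space_ball_borel: "space ball_borel = unit_ball"
  by (simp add: ball_borel_def space_restrict_space)

lemma space_nu_w: "space (nu_w \<alpha>) = unit_ball"
  using sets_eq_imp_space_eq[OF sets_nu_w] by (simp add: space_ball_borel)

lemma holomorphic_self_map_measurable:
  fixes \<phi> :: "complex ^ 'n \<Rightarrow> complex ^ 'n"
  assumes "holomorphic_self_map \<phi>"
  shows "\<phi> \<in> measurable ball_borel ball_borel"
proof -
  have "continuous_on unit_ball (\<lambda>z. \<phi> z $ j)" for j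
    using assms unfolding holomorphic_self_map_def mv_holomorphic_on_def
    by (meson continuous_at_imp_continuous_on has_derivative_continuous)
  then have "continuous_on unit_ball (\<lambda>z. \<chi> j. \<phi> z $ j)"
    by (intro continuous_on_vec_lambda)
  then have "\<phi> \<in> borel_measurable (restrict_space borel unit_ball)"
    by (intro borel_measurable_continuous_on_restrict) simp
  with assms show ?thesis
    unfolding ball_borel_def holomorphic_self_map_def
    by (auto intro!: measurable_restrict_space2 simp: space_restrict_space)
qed

lemma pseudo_hyp_dist_measurable:
  fixes \<phi> \<psi> :: "complex ^ 'n \<Rightarrow> complex ^ 'n"
  assumes "holomorphic_self_map \<phi>" "holomorphic_self_map \<psi>"
  shows "(\<lambda>z. pseudo_hyp_dist (\<phi> z) (\<psi> z)) \<in> borel_measurable ball_borel"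
proof -
  have comp: "(\<lambda>z. \<theta> z $ i) \<in> borel_measurable ball_borel"
    if "holomorphic_self_map \<theta>" for \<theta> :: "complex ^ 'n \<Rightarrow> complex ^ 'n" and i
  proof -
    have "\<theta> \<in> borel_measurable ball_borel"
      using holomorphic_self_map_measurable[OF that]
      by (simp add: ball_borel_def measurable_restrict_space2_iff)
    moreover have "(\<lambda>x :: complex ^ 'n. x $ i) \<in> borel_measurable borel"
      by (intro borel_measurable_continuous_onI continuous_intros)
    ultimately show ?thesis by (rule measurable_compose)
  qed
  note [measurable] = comp[OF assms(1)] comp[OF assms(2)]
  have [measurable]: "cnj \<in> borel_measurable borel"
    by (intro borel_measurable_continuous_onI continuous_intros)
  have [measurable]: "(\<lambda>z. norm (\<phi> z)) \<in> borel_measurable ball_borel"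
    unfolding norm_vec_def L2_set_def by measurable
  show ?thesis
    unfolding pseudo_hyp_dist_def norm_vec_def L2_set_def
    unfolding ball_involution_def proj_span_def herm_inner_def
      vector_minus_component vector_scaleR_component vector_smult_component
    by measurable
qed

lemma emeasure_joint_pullback:
  fixes \<phi> \<psi> :: "complex ^ 'n \<Rightarrow> complex ^ 'n"
  assumes "holomorphic_self_map \<phi>" "holomorphic_self_map \<psi>" "E \<in> sets ball_borel"
  shows "emeasure (joint_pullback \<beta> q \<phi> \<psi>) E =
           (\<integral>\<^sup>+z\<in>\<phi> -` E. ennreal (pseudo_hyp_dist (\<phi> z) (\<psi> z) powr q) \<partial>nu_w \<beta>) +
           (\<integral>\<^sup>+z\<in>\<psi> -` E. ennreal (pseudo_hyp_dist (\<phi> z) (\<psi> z) powr q) \<partial>nu_w \<beta>)"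
proof -
  define \<rho> where "\<rho> = (\<lambda>z. ennreal (pseudo_hyp_dist (\<phi> z) (\<psi> z) powr q))"
  define M where "M = (\<lambda>\<theta> :: complex ^ 'n \<Rightarrow> complex ^ 'n. distr (density (nu_w \<beta>) \<rho>) ball_borel \<theta>)"
  have [measurable]: "\<rho> \<in> borel_measurable (nu_w \<beta>)"
    using pseudo_hyp_dist_measurable[OF assms(1,2)]
    unfolding \<rho>_def measurable_cong_sets[OF sets_nu_w refl] by measurable
  have M: "(\<integral>\<^sup>+z\<in>\<theta> -` A. \<rho> z \<partial>nu_w \<beta>) = emeasure (M \<theta>) A"
    if "A \<in> sets ball_borel" "holomorphic_self_map \<theta>" for A and \<theta> :: "complex ^ 'n \<Rightarrow> complex ^ 'n"
  proof -
    have \<theta>: "\<theta> \<in> measurable (nu_w \<beta>) ball_borel"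
      using holomorphic_self_map_measurable[OF that(2)]
      unfolding measurable_cong_sets[OF sets_nu_w refl] .
    have "emeasure (M \<theta>) A = (\<integral>\<^sup>+z\<in>\<theta> -` A \<inter> space (nu_w \<beta>). \<rho> z \<partial>nu_w \<beta>)"
      unfolding M_def using \<theta> that
      by (subst emeasure_distr) (simp_all add: emeasure_density measurable_sets)
    also have "\<dots> = (\<integral>\<^sup>+z\<in>\<theta> -` A. \<rho> z \<partial>nu_w \<beta>)"
      by (rule nn_integral_cong) (simp add: indicator_def)
    finally show ?thesis by simp
  qed
  have sets_M: "sets (M \<theta>) = sets ball_borel" for \<theta> by (simp add: M_def)
  have "countably_additive (sets ball_borel)
          (\<lambda>A. (\<integral>\<^sup>+z\<in>\<phi> -` A. \<rho> z \<partial>nu_w \<beta>) + (\<integral>\<^sup>+z\<in>\<psi> -` A. \<rho> z \<partial>nu_w \<beta>))"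
  proof (rule countably_additiveI)
    fix A :: "nat \<Rightarrow> (complex ^ 'n) set"
    assume A: "range A \<subseteq> sets ball_borel" "disjoint_family A" "(\<Union>i. A i) \<in> sets ball_borel"
    have "A i \<in> sets ball_borel" for i using A(1) by blast
    moreover have "(\<Sum>i. emeasure (M \<theta>) (A i)) = emeasure (M \<theta>) (\<Union>i. A i)" for \<theta>
      using A by (intro suminf_emeasure) (simp_all add: sets_M)
    ultimately show "(\<Sum>i. (\<integral>\<^sup>+z\<in>\<phi> -` A i. \<rho> z \<partial>nu_w \<beta>) + (\<integral>\<^sup>+z\<in>\<psi> -` A i. \<rho> z \<partial>nu_w \<beta>)) =
        (\<integral>\<^sup>+z\<in>\<phi> -` (\<Union>i. A i). \<rho> z \<partial>nu_w \<beta>) + (\<integral>\<^sup>+z\<in>\<psi> -` (\<Union>i. A i). \<rho> z \<partial>nu_w \<beta>)"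
      using A(3) by (simp only: M assms(1,2) suminf_add[OF summableI summableI, symmetric])
  qed
  moreover have "positive (sets ball_borel)
      (\<lambda>A. (\<integral>\<^sup>+z\<in>\<phi> -` A. \<rho> z \<partial>nu_w \<beta>) + (\<integral>\<^sup>+z\<in>\<psi> -` A. \<rho> z \<partial>nu_w \<beta>))"
    by (simp add: positive_def)
  moreover have "sigma_algebra unit_ball (sets (ball_borel :: (complex ^ 'n) measure))"
    using sets.sigma_algebra_axioms[of "ball_borel :: (complex ^ 'n) measure"]
    by (simp add: space_ball_borel)
  ultimately show ?thesis
    unfolding joint_pullback_def \<rho>_def[symmetric]
    using assms(3) by (intro emeasure_measure_of_sigma) (simp_all add: \<rho>_def)
qed

end

theory Submission
  imports Defs "HOL-Complex_Analysis.Conformal_Mappings"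
begin

text \<open>Write \<open>n\<close> for the dimension, \<open>e = (n + 1 + \<alpha>) \<lambda>\<close>, \<open>\<omega>\<close> for the joint pull-back measure, \<open>D(a)\<close>
  for the pseudo-hyperbolic ball of radius \<open>1/2\<close> about \<open>a\<close>, and \<open>S\<close> for the supremum over \<open>a\<close> of the
  integrals of the kernels \<open>K\<^sub>a(w) = (1 - |a|\<^sup>2)\<^sup>s / |1 - \<langle>a, w\<rangle>|\<^bsup>e + s\<^esup>\<close> against \<open>\<omega>\<close>, which is the
  right-hand side of the norm formula. Everything follows from three estimates.

  \<^item> Upper bound. On \<open>D(z)\<close> the value \<open>|f(z)|\<^sup>p\<close> is at most \<open>C (1 - |z|\<^sup>2)\<^bsup>-(n + 1 + \<alpha>)\<^esup>\<close> times the
    mass \<open>\<integral> |f|\<^sup>p d\<nu>\<^sub>\<alpha>\<close> over \<open>D(z)\<close>, and a difference \<open>f(z) - f(w)\<close> gains the additional factor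
    \<open>\<rho>(z, w)\<close>. Since \<open>q \<ge> p\<close>, all but one power of the local mass can be replaced by the full mass
    \<open>\<parallel>f\<parallel>\<^sup>p\<close>; the remaining expression is linear in the local mass, and interchanging the integrals
    bounds both \<open>\<integral> |f|\<^sup>q d\<omega>\<close> and \<open>\<integral> |f \<circ> \<phi> - f \<circ> \<psi>|\<^sup>q d\<nu>\<^sub>\<beta>\<close> by \<open>C S \<parallel>f\<parallel>\<^sup>q\<close>
    (\<open>pointwise_local_mass\<close>, \<open>upper_estimate\<close>).

  \<^item> Lower bound. The functions \<open>h\<^sup>m\<close> and \<open>h\<^sup>m (\<sigma>\<^sub>a)\<^sub>j\<close> with \<open>h(z) = (1 - |a|\<^sup>2) / (1 - \<langle>z, a\<rangle>)\<close> have
    norms at most of order \<open>(1 - |a|\<^sup>2)\<^bsup>(n + 1 + \<alpha>)/p\<^esup>\<close>, and their differences between a point of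
    \<open>D(a)\<close> and any other point of the ball control \<open>\<rho>\<close>. Hence an operator bound gives
    \<open>\<omega>(D(a)) \<le> C (1 - |a|\<^sup>2)\<^sup>e\<close> (\<open>lower_estimate\<close>). A Carleson inequality gives the same conclusion
    by testing on \<open>h\<^sup>m\<close> alone (\<open>bergman_carleson_imp_ball_le\<close>).

  \<^item> From balls to kernels. If \<open>\<omega>(D(a)) \<le> M (1 - |a|\<^sup>2)\<^sup>e\<close> for all \<open>a\<close>, then \<open>S \<le> C M\<close>: by the
    sub-mean value estimate \<open>K\<^sub>a\<close> is dominated by its local means, and the Forelli-Rudin estimate
    bounds the integral that is left after interchanging (\<open>carleson_sup_le_of_ball_le\<close>).

  These give the two-sided norm estimate, and they show that boundedness, finiteness of \<open>S\<close> and the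
  Carleson property are equivalent. An operator that merely maps \<open>A\<^sup>p\<^sub>\<alpha>\<close> into \<open>A\<^sup>q\<^sub>\<beta>\<close> is bounded by a
  uniform boundedness argument for the truncations of the operator to the sets where
  \<open>\<phi>\<close> and \<open>\<psi>\<close> stay away from the sphere (\<open>bounded_of_maps_into\<close>).

  Sub-mean value estimates near \<open>z\<close> are made in an affine chart that stretches by \<open>1 - |z|\<^sup>2\<close> along
  \<open>z\<close> and by its square root orthogonally to \<open>z\<close>. The automorphisms \<open>\<sigma>\<^sub>a\<close> enter only through
  algebraic identities.\<close>

section \<open>Hermitian geometry of the ball\<close>

lemma herm_inner_add_left: "herm_inner (x + y) w = herm_inner x w + herm_inner y w"
  by (simp add: herm_inner_def algebra_simps sum.distrib)

lemma herm_inner_diff_left: "herm_inner (x - y) w = herm_inner x w - herm_inner y w"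
  by (simp add: herm_inner_def algebra_simps sum_subtractf)

lemma herm_inner_smult_left: "herm_inner (c *s x) w = c * herm_inner x w"
  by (simp add: herm_inner_def sum_distrib_left mult_ac)

lemma herm_inner_scaleR_left: "herm_inner (r *\<^sub>R x) w = of_real r * herm_inner x w"
  unfolding herm_inner_def sum_distrib_left by (rule sum.cong) (simp_all add: scaleR_conv_of_real[where 'a=complex])

lemma cnj_herm_inner: "cnj (herm_inner x y) = herm_inner y x"
  by (simp add: herm_inner_def mult.commute)

lemma herm_inner_diff_right: "herm_inner w (x - y) = herm_inner w x - herm_inner w y"
  by (metis cnj_herm_inner complex_cnj_diff herm_inner_diff_left)

lemma herm_inner_add_right: "herm_inner w (x + y) = herm_inner w x + herm_inner w y"
  by (metis cnj_herm_inner complex_cnj_add herm_inner_add_left)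

lemma herm_inner_smult_right: "herm_inner w (c *s x) = cnj c * herm_inner w x"
  by (metis cnj_herm_inner complex_cnj_mult herm_inner_smult_left)

lemma herm_inner_scaleR_right: "herm_inner w (r *\<^sub>R x) = of_real r * herm_inner w x"
  by (metis cnj_herm_inner complex_cnj_mult complex_cnj_complex_of_real herm_inner_scaleR_left)

lemmas herm_inner_simps = herm_inner_add_left herm_inner_diff_left herm_inner_smult_left
  herm_inner_scaleR_left herm_inner_add_right herm_inner_diff_right herm_inner_smult_right
  herm_inner_scaleR_right

lemma herm_inner_zero [simp]: "herm_inner 0 w = 0" "herm_inner w 0 = 0"
  by (simp_all add: herm_inner_def)

lemma herm_inner_self: "herm_inner z z = complex_of_real ((norm z)\<^sup>2)"
  by (simp add: herm_inner_def norm_vec_def L2_set_def sum_nonneg flip: complex_norm_square)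

lemma herm_inner_self_eq_0_iff [simp]: "herm_inner z z = 0 \<longleftrightarrow> z = 0"
  by (simp add: herm_inner_self)

lemma inner_eq_Re_herm_inner: "x \<bullet> y = Re (herm_inner x y)"
  by (simp add: inner_vec_def herm_inner_def inner_complex_def)

lemma norm_herm_inner_le: "norm (herm_inner z w) \<le> norm z * norm w"
proof -
  have "norm (herm_inner z w) \<le> (\<Sum>j\<in>UNIV. \<bar>norm (z $ j)\<bar> * \<bar>norm (w $ j)\<bar>)"
    unfolding herm_inner_def by (rule order_trans[OF norm_sum]) (simp add: norm_mult)
  also have "\<dots> \<le> norm z * norm w"
    unfolding norm_vec_def by (rule L2_set_mult_ineq)
  finally show ?thesis .
qed

lemma norm_one_minus_herm_inner_commute: "norm (1 - herm_inner z w) = norm (1 - herm_inner w z)"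
  by (metis cnj_herm_inner complex_cnj_diff complex_cnj_one complex_mod_cnj)

lemma norm_smult_vec: "norm (c *s (x :: complex ^ 'n)) = norm c * norm x"
  unfolding norm_vec_def vector_smult_component norm_mult
  by (simp add: L2_set_def power_mult_distrib real_sqrt_mult flip: sum_distrib_left)

lemma herm_inner_proj_left: "herm_inner (proj_span a z) w = herm_inner z a * herm_inner a w / herm_inner a a"
  by (simp add: proj_span_def herm_inner_smult_left)

lemma herm_inner_proj_right: "herm_inner w (proj_span a z) = herm_inner w a * herm_inner a z / herm_inner a a"
  by (simp add: proj_span_def herm_inner_smult_right cnj_herm_inner)

lemma herm_inner_proj_self: "herm_inner (proj_span a z) a = herm_inner z a"
  by (cases "a = 0") (simp_all add: herm_inner_proj_left)

lemma proj_span_linear: "linear (proj_span a)"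
  by (rule linearI) (simp_all add: proj_span_def herm_inner_simps vec_eq_iff add_divide_distrib
      scaleR_conv_of_real[where 'a=complex] ring_distribs)

lemma proj_span_smult: "proj_span a (c *s z) = c *s proj_span a z"
  by (simp add: proj_span_def herm_inner_simps vec_eq_iff)

lemma proj_span_idem [simp]: "proj_span a (proj_span a z) = proj_span a z"
  by (simp add: proj_span_def[of a "proj_span a z"] herm_inner_proj_self) (simp add: proj_span_def)

lemma proj_span_self [simp]: "proj_span a a = a"
  by (simp add: proj_span_def vec_eq_iff)

lemma norm_proj_span_sq:
  "(norm z)\<^sup>2 = (norm (proj_span a z))\<^sup>2 + (norm (z - proj_span a z))\<^sup>2"
proof -
  have "herm_inner z z = herm_inner (proj_span a z) (proj_span a z) +
      herm_inner (z - proj_span a z) (z - proj_span a z)"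
    by (simp add: herm_inner_simps herm_inner_proj_left herm_inner_proj_right)
  then have "complex_of_real ((norm z)\<^sup>2) =
      of_real ((norm (proj_span a z))\<^sup>2 + (norm (z - proj_span a z))\<^sup>2)"
    unfolding herm_inner_self by simp
  then show ?thesis unfolding of_real_eq_iff .
qed

definition defect :: "complex ^ 'n \<Rightarrow> real" where "defect z = 1 - (norm z)\<^sup>2"

lemma norm_one_minus_herm_inner_ge:
  assumes "norm z \<le> 1" "norm w \<le> 1"
  shows "1 - norm w \<le> norm (1 - herm_inner z w)" "1 - norm z \<le> norm (1 - herm_inner z w)"
proof -
  have "norm (herm_inner z w) \<le> norm z * norm w" by (rule norm_herm_inner_le)
  moreover have "norm z * norm w \<le> norm w" "norm z * norm w \<le> norm z"
    using assms by (simp_all add: mult_left_le mult_left_le_one_le)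
  moreover have "1 - norm (herm_inner z w) \<le> norm (1 - herm_inner z w)"
    using norm_triangle_ineq2[of 1 "herm_inner z w"] by simp
  ultimately show "1 - norm w \<le> norm (1 - herm_inner z w)" "1 - norm z \<le> norm (1 - herm_inner z w)"
    by linarith+
qed

lemma defect_pos: "z \<in> unit_ball \<Longrightarrow> 0 < defect z"
  by (simp add: defect_def power_less_one_iff abs_square_less_1)

lemma defect_le_1: "defect z \<le> 1"
  by (simp add: defect_def)

lemma defect_le: "norm z \<le> 1 \<Longrightarrow> defect z \<le> 2 * (1 - norm z)"
proof -
  assume "norm z \<le> 1"
  have "defect z = (1 - norm z) * (1 + norm z)" by (simp add: defect_def power2_eq_square algebra_simps)
  also have "\<dots> \<le> (1 - norm z) * 2" using \<open>norm z \<le> 1\<close> by (intro mult_left_mono) auto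
  finally show ?thesis by simp
qed

lemma defect_le_norm:
  assumes "z \<in> unit_ball" "w \<in> unit_ball"
  shows "defect w \<le> 2 * norm (1 - herm_inner z w)" "defect z \<le> 2 * norm (1 - herm_inner z w)"
  using norm_one_minus_herm_inner_ge[of z w] defect_le[of z] defect_le[of w] assms by auto

lemma one_minus_herm_inner_nz:
  assumes "z \<in> unit_ball" "w \<in> unit_ball"
  shows "1 - herm_inner z w \<noteq> 0"
  using norm_one_minus_herm_inner_ge[of z w] assms by auto

text \<open>Everything about the pseudo-hyperbolic distance comes from this polarized identity: it says
  at once that \<open>\<sigma>\<^sub>a\<close> maps the ball into itself and that it preserves \<open>\<rho>\<close>.\<close>

lemma ball_involution_identity:
  assumes "a \<in> unit_ball" "z \<in> unit_ball" "w \<in> unit_ball"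
  shows "1 - herm_inner (ball_involution a z) (ball_involution a w) =
    of_real (defect a) * (1 - herm_inner z w) / ((1 - herm_inner z a) * (1 - herm_inner a w))"
proof -
  define s where "s = sqrt (defect a)"
  have s2: "complex_of_real s * complex_of_real s = 1 - herm_inner a a"
    using defect_pos[OF assms(1)]
    by (simp add: s_def defect_def herm_inner_self flip: of_real_mult)
  define d e where "d = 1 - herm_inner z a" and "e = 1 - herm_inner w a"
  have nz: "d \<noteq> 0" "e \<noteq> 0" "cnj e \<noteq> 0"
    using one_minus_herm_inner_nz assms by (auto simp: d_def e_def)
  have ce: "cnj e = 1 - herm_inner a w" by (simp add: e_def cnj_herm_inner)
  define X where "X = herm_inner (a - proj_span a z - s *\<^sub>R (z - proj_span a z))
      (a - proj_span a w - s *\<^sub>R (w - proj_span a w))"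
  have "X = herm_inner a a - herm_inner a w - herm_inner z a + herm_inner z a * herm_inner a w / herm_inner a a
      + of_real s * of_real s * (herm_inner z w - herm_inner z a * herm_inner a w / herm_inner a a)"
    unfolding X_def
    by (cases "a = 0") (simp_all add: herm_inner_simps herm_inner_proj_left herm_inner_proj_right algebra_simps
        add_divide_distrib diff_divide_distrib)
  also have "\<dots> = d * cnj e - of_real (defect a) * (1 - herm_inner z w)"
    unfolding s2 ce d_def
    by (cases "a = 0") (simp_all add: defect_def field_simps herm_inner_self)
  finally have X: "X = d * cnj e - of_real (defect a) * (1 - herm_inner z w)" .
  have "herm_inner (ball_involution a z) (ball_involution a w) = X / (d * cnj e)"
    unfolding ball_involution_def X_def herm_inner_smult_left herm_inner_smult_right s_def defect_def
      d_def e_def by (simp add: cnj_herm_inner)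
  then show ?thesis using nz X by (simp add: diff_divide_distrib ce d_def)
qed

lemma defect_ball_involution:
  assumes "a \<in> unit_ball" "z \<in> unit_ball"
  shows "defect (ball_involution a z) = defect a * defect z / (norm (1 - herm_inner z a))\<^sup>2"
proof -
  have "complex_of_real (defect (ball_involution a z)) =
      1 - herm_inner (ball_involution a z) (ball_involution a z)"
    by (simp add: defect_def herm_inner_self)
  also have "\<dots> = of_real (defect a * defect z) / ((1 - herm_inner z a) * cnj (1 - herm_inner z a))"
    unfolding ball_involution_identity[OF assms assms(2)]
    by (simp add: cnj_herm_inner defect_def herm_inner_self)
  also have "\<dots> = of_real (defect a * defect z / (norm (1 - herm_inner z a))\<^sup>2)"
    by (metis complex_norm_square of_real_divide)
  finally show ?thesis by (simp only: of_real_eq_iff)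
qed

lemma ball_involution_in_ball:
  assumes "a \<in> unit_ball" "z \<in> unit_ball"
  shows "ball_involution a z \<in> unit_ball"
proof -
  have "defect (ball_involution a z) > 0"
    unfolding defect_ball_involution[OF assms]
    using assms one_minus_herm_inner_nz[OF assms(2,1)]
    by (intro divide_pos_pos mult_pos_pos defect_pos) auto
  then show ?thesis by (simp add: defect_def abs_square_less_1)
qed

lemma pseudo_hyp_dist_sq:
  assumes "a \<in> unit_ball" "z \<in> unit_ball"
  shows "1 - (pseudo_hyp_dist a z)\<^sup>2 = defect a * defect z / (norm (1 - herm_inner z a))\<^sup>2"
  using defect_ball_involution[OF assms] by (simp add: defect_def pseudo_hyp_dist_def)

lemma pseudo_hyp_dist_nonneg [simp]: "0 \<le> pseudo_hyp_dist a z"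
  by (simp add: pseudo_hyp_dist_def)

lemma pseudo_hyp_dist_less_1:
  "a \<in> unit_ball \<Longrightarrow> z \<in> unit_ball \<Longrightarrow> pseudo_hyp_dist a z < 1"
  using ball_involution_in_ball by (auto simp: pseudo_hyp_dist_def)

lemma pseudo_hyp_dist_commute:
  assumes "a \<in> unit_ball" "z \<in> unit_ball"
  shows "pseudo_hyp_dist a z = pseudo_hyp_dist z a"
proof -
  have "(pseudo_hyp_dist a z)\<^sup>2 = (pseudo_hyp_dist z a)\<^sup>2"
    using pseudo_hyp_dist_sq[OF assms] pseudo_hyp_dist_sq[OF assms(2,1)]
    unfolding norm_one_minus_herm_inner_commute[of a z] mult.commute[of "defect z"] by linarith
  then show ?thesis by (simp add: power2_eq_iff_nonneg)
qed

lemma pseudo_hyp_dist_invariant: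
  assumes "a \<in> unit_ball" "z \<in> unit_ball" "w \<in> unit_ball"
  shows "pseudo_hyp_dist (ball_involution a z) (ball_involution a w) = pseudo_hyp_dist z w"
proof -
  have "(norm (1 - herm_inner (ball_involution a w) (ball_involution a z)))\<^sup>2 =
     (defect a)\<^sup>2 * (norm (1 - herm_inner w z))\<^sup>2 /
       ((norm (1 - herm_inner w a))\<^sup>2 * (norm (1 - herm_inner z a))\<^sup>2)"
    unfolding ball_involution_identity[OF assms(1,3,2)] norm_divide norm_mult
    by (simp add: power_divide power_mult_distrib norm_one_minus_herm_inner_commute[of a z])
  moreover have "1 - (pseudo_hyp_dist (ball_involution a z) (ball_involution a w))\<^sup>2 =
      (defect a * defect z / (norm (1 - herm_inner z a))\<^sup>2) * (defect a * defect w / (norm (1 - herm_inner w a))\<^sup>2) /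
      (norm (1 - herm_inner (ball_involution a w) (ball_involution a z)))\<^sup>2"
    using pseudo_hyp_dist_sq[OF ball_involution_in_ball[OF assms(1,2)] ball_involution_in_ball[OF assms(1,3)]]
    unfolding defect_ball_involution[OF assms(1,2)] defect_ball_involution[OF assms(1,3)] .
  ultimately have "1 - (pseudo_hyp_dist (ball_involution a z) (ball_involution a w))\<^sup>2
      = 1 - (pseudo_hyp_dist z w)\<^sup>2"
    unfolding pseudo_hyp_dist_sq[OF assms(2,3)]
    using defect_pos[OF assms(1)] one_minus_herm_inner_nz[OF assms(2,1)]
      one_minus_herm_inner_nz[OF assms(3,1)] by (simp add: power2_eq_square)
  then show ?thesis by (simp add: power2_eq_iff_nonneg)
qed

text \<open>The numerator of \<open>\<rho>\<^sup>2 = (|1 - \<langle>z, w\<rangle>|\<^sup>2 - (1 - |z|\<^sup>2)(1 - |w|\<^sup>2)) / |1 - \<langle>z, w\<rangle>|\<^sup>2\<close> is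
  \<open>|z - w|\<^sup>2 + |\<langle>z, w\<rangle>|\<^sup>2 - |z|\<^sup>2|w|\<^sup>2\<close>, hence at most \<open>|z - w|\<^sup>2\<close>. Thus \<open>\<rho>\<close> is dominated by the
  Euclidean distance as soon as one of the points stays away from the sphere.\<close>

lemma pseudo_hyp_dist_le_norm:
  assumes "z \<in> unit_ball" "w \<in> unit_ball"
  shows "pseudo_hyp_dist z w \<le> norm (z - w) / (1 - norm z)"
proof -
  define N where "N = norm (1 - herm_inner w z)"
  have N: "1 - norm z \<le> N" and z: "0 < 1 - norm z"
    using norm_one_minus_herm_inner_ge(1)[of w z] assms by (auto simp: N_def)
  have "N\<^sup>2 = 1 - 2 * Re (herm_inner w z) + (norm (herm_inner w z))\<^sup>2"
    unfolding N_def cmod_power2 by (simp add: power2_eq_square algebra_simps)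
  also have "(norm (herm_inner w z))\<^sup>2 \<le> (norm w * norm z)\<^sup>2"
    by (intro power_mono norm_herm_inner_le) simp
  also have "2 * Re (herm_inner w z) = (norm w)\<^sup>2 + (norm z)\<^sup>2 - (norm (z - w))\<^sup>2"
    by (simp add: power2_norm_eq_inner inner_diff_left inner_diff_right inner_commute
        flip: inner_eq_Re_herm_inner)
  finally have "N\<^sup>2 - defect z * defect w \<le> (norm (z - w))\<^sup>2"
    by (simp add: defect_def algebra_simps power_mult_distrib)
  moreover have "(pseudo_hyp_dist z w)\<^sup>2 * N\<^sup>2 = N\<^sup>2 - defect z * defect w"
  proof -
    have "N\<^sup>2 \<noteq> 0" using N z by auto
    then show ?thesis using pseudo_hyp_dist_sq[OF assms] unfolding N_def[symmetric]
      by (simp add: field_simps)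
  qed
  ultimately have "pseudo_hyp_dist z w * N \<le> norm (z - w)"
    by (metis norm_ge_zero power2_le_imp_le power_mult_distrib)
  moreover have "pseudo_hyp_dist z w * (1 - norm z) \<le> pseudo_hyp_dist z w * N"
    using N by (intro mult_left_mono) auto
  ultimately show ?thesis using z by (simp add: field_simps)
qed

definition bergman_ball :: "complex ^ 'n \<Rightarrow> (complex ^ 'n) set" where
  "bergman_ball z = {w \<in> unit_ball. pseudo_hyp_dist z w < 1 / 2}"

lemma pseudo_hyp_dist_formula:
  assumes "z \<in> unit_ball" "w \<in> unit_ball"
  shows "(pseudo_hyp_dist z w * norm (1 - herm_inner w z))\<^sup>2 =
    (norm (z - proj_span z w))\<^sup>2 + defect z * (norm (w - proj_span z w))\<^sup>2"
proof -
  have s: "(sqrt (1 - (norm z)\<^sup>2))\<^sup>2 = defect z"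
    using defect_pos[OF assms(1)] by (simp add: defect_def)
  define X where "X = z - proj_span z w - sqrt (1 - (norm z)\<^sup>2) *\<^sub>R (w - proj_span z w)"
  have "pseudo_hyp_dist z w * norm (1 - herm_inner w z) = norm X"
    unfolding pseudo_hyp_dist_def ball_involution_def norm_smult_vec X_def[symmetric]
    using one_minus_herm_inner_nz[OF assms(2,1)] by (simp add: norm_divide)
  moreover have "proj_span z X = z - proj_span z w"
    unfolding X_def using proj_span_linear[of z] by (simp add: linear_diff linear_cmul)
  moreover have "norm (X - (z - proj_span z w)) = sqrt (1 - (norm z)\<^sup>2) * norm (w - proj_span z w)"
    unfolding X_def using defect_pos[OF assms(1)] by (simp add: defect_def)
  ultimately show ?thesis
    using norm_proj_span_sq[of X z] s by (simp add: power_mult_distrib)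
qed

lemma herm_inner_diff_proj_self: "herm_inner (w - z) z = herm_inner (proj_span z w - z) z"
  by (simp add: herm_inner_diff_left herm_inner_proj_self)

text \<open>In \<open>1 - \<langle>w, z\<rangle> = (1 - |z|\<^sup>2) - \<langle>Pw - z, z\<rangle>\<close>, where \<open>P\<close> is the projection to the line of \<open>z\<close>, the
  last term is at most \<open>\<rho>(z, w) |1 - \<langle>w, z\<rangle>|\<close> by \<open>pseudo_hyp_dist_formula\<close> and can be absorbed.\<close>

lemma norm_one_minus_herm_inner_le:
  assumes "z \<in> unit_ball" "w \<in> unit_ball"
  shows "(1 - pseudo_hyp_dist z w) * norm (1 - herm_inner w z) \<le> defect z"
proof -
  have "1 - herm_inner w z = of_real (defect z) - herm_inner (proj_span z w - z) z"
    unfolding herm_inner_diff_proj_self[symmetric]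
    by (simp add: defect_def herm_inner_diff_left herm_inner_self)
  then have "norm (1 - herm_inner w z) \<le> defect z + norm (herm_inner (proj_span z w - z) z)"
    using norm_triangle_ineq4[of "of_real (defect z)" "herm_inner (proj_span z w - z) z"]
      defect_pos[OF assms(1)] by simp
  also have "norm (herm_inner (proj_span z w - z) z) \<le> norm (proj_span z w - z) * norm z"
    by (rule norm_herm_inner_le)
  also have "\<dots> \<le> norm (proj_span z w - z) * 1"
    using assms by (intro mult_left_mono) auto
  also have "norm (proj_span z w - z) \<le> pseudo_hyp_dist z w * norm (1 - herm_inner w z)"
  proof (rule power2_le_imp_le)
    show "(norm (proj_span z w - z))\<^sup>2 \<le> (pseudo_hyp_dist z w * norm (1 - herm_inner w z))\<^sup>2"
      unfolding pseudo_hyp_dist_formula[OF assms] using defect_pos[OF assms(1)]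
      by (simp add: norm_minus_commute)
  qed simp
  finally show ?thesis by (simp add: algebra_simps)
qed

lemma bergman_ball_sub: "w \<in> bergman_ball z \<Longrightarrow> w \<in> unit_ball"
  by (simp add: bergman_ball_def)

lemma bergman_ball_commute:
  "z \<in> unit_ball \<Longrightarrow> w \<in> unit_ball \<Longrightarrow> w \<in> bergman_ball z \<longleftrightarrow> z \<in> bergman_ball w"
  by (simp add: bergman_ball_def pseudo_hyp_dist_commute)

text \<open>This is what makes \<open>D(z)\<close> usable as a unit of averaging: weights and kernels vary on it by
  bounded factors only.\<close>

lemma bergman_ball_compare:
  assumes "z \<in> unit_ball" "w \<in> bergman_ball z"
  shows "norm (1 - herm_inner w z) \<le> 2 * defect z" "defect w \<le> 4 * defect z" "defect z \<le> 4 * defect w"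
proof -
  have *: "norm (1 - herm_inner y x) \<le> 2 * defect x" if "x \<in> unit_ball" "y \<in> bergman_ball x" for x y
  proof -
    have "1 / 2 * norm (1 - herm_inner y x) \<le> (1 - pseudo_hyp_dist x y) * norm (1 - herm_inner y x)"
      using that by (intro mult_right_mono) (auto simp: bergman_ball_def)
    then show ?thesis using norm_one_minus_herm_inner_le[of x y] that by (simp add: bergman_ball_def)
  qed
  have w: "w \<in> unit_ball" "z \<in> bergman_ball w" using assms bergman_ball_commute bergman_ball_sub by blast+
  show "norm (1 - herm_inner w z) \<le> 2 * defect z" by (rule *[OF assms])
  then show "defect w \<le> 4 * defect z" using defect_le_norm[of w z] assms w by simp
  show "defect z \<le> 4 * defect w" using *[OF w] defect_le_norm[of z w] assms w by simp
qed

text \<open>With two independent factors the compositions and inverses of these maps are again of this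
  form.\<close>

definition stretch :: "real \<Rightarrow> real \<Rightarrow> complex ^ 'n \<Rightarrow> complex ^ 'n \<Rightarrow> complex ^ 'n" where
  "stretch s t a u = s *\<^sub>R proj_span a u + t *\<^sub>R (u - proj_span a u)"

lemma proj_span_stretch: "proj_span a (stretch s t a u) = s *\<^sub>R proj_span a u"
  unfolding stretch_def using proj_span_linear[of a] by (simp add: linear_diff linear_cmul linear_add)

lemma stretch_stretch: "stretch s t a (stretch s' t' a u) = stretch (s * s') (t * t') a u"
  unfolding stretch_def[of s t a "stretch s' t' a u"] proj_span_stretch
  by (simp add: stretch_def algebra_simps)

lemma stretch_1 [simp]: "stretch 1 1 a u = u"
  by (simp add: stretch_def)

lemma linear_stretch: "linear (stretch s t a)"
  unfolding stretch_def using proj_span_linear[of a]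
  by (intro linearI) (simp_all add: linear_diff linear_cmul linear_add algebra_simps)

lemma stretch_smult: "stretch s t a (c *s u) = c *s stretch s t a u"
  unfolding stretch_def proj_span_smult by (simp add: vec_eq_iff scaleR_conv_of_real[where 'a=complex] algebra_simps)

lemma norm_stretch_sq:
  "(norm (stretch s t a u))\<^sup>2 = s\<^sup>2 * (norm (proj_span a u))\<^sup>2 + t\<^sup>2 * (norm (u - proj_span a u))\<^sup>2"
  using norm_proj_span_sq[of "stretch s t a u" a] unfolding proj_span_stretch
  by (simp add: stretch_def power_mult_distrib)

text \<open>The image of a small Euclidean ball under \<^term>\<open>ball_chart z\<close> is comparable with a
  pseudo-hyperbolic ball about \<open>z\<close>. This affine chart replaces the automorphism \<open>\<sigma>\<^sub>z\<close> in all
  volume computations.\<close>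

definition ball_chart :: "complex ^ 'n \<Rightarrow> complex ^ 'n \<Rightarrow> complex ^ 'n" where
  "ball_chart z u = z + stretch (defect z) (sqrt (defect z)) z u"

lemma ball_chart_props:
  assumes z: "z \<in> unit_ball" and u: "norm u \<le> 1 / 4"
  shows "ball_chart z u \<in> unit_ball" "pseudo_hyp_dist z (ball_chart z u) \<le> norm u / (1 - norm u)"
proof -
  define d where "d = defect z"
  define w where "w = ball_chart z u"
  have d: "0 < d" "d \<le> 1" using defect_pos[OF z] defect_le_1 by (auto simp: d_def)
  have sd: "sqrt d * sqrt d = d" using d by simp
  let ?P = "norm (proj_span z u)" and ?Q = "norm (u - proj_span z u)"
  have PQ: "?P\<^sup>2 + ?Q\<^sup>2 = (norm u)\<^sup>2" using norm_proj_span_sq[of u z] by simp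
  have P: "?P \<le> norm u" by (rule power2_le_imp_le) (use PQ in \<open>auto simp flip: PQ\<close>)
  have Pw: "proj_span z w = z + d *\<^sub>R proj_span z u"
    unfolding w_def ball_chart_def using proj_span_linear[of z]
    by (simp add: linear_add proj_span_stretch d_def)
  have Qw: "w - proj_span z w = sqrt d *\<^sub>R (u - proj_span z u)"
    unfolding Pw by (simp add: w_def ball_chart_def d_def stretch_def)
  have "(norm w)\<^sup>2 = (norm (z + d *\<^sub>R proj_span z u))\<^sup>2 + d * ?Q\<^sup>2"
    using norm_proj_span_sq[of w z] unfolding Qw using d by (simp add: Pw power_mult_distrib)
  also have "(norm (z + d *\<^sub>R proj_span z u))\<^sup>2 \<le> (norm z + d * ?P)\<^sup>2"
    using norm_triangle_ineq[of z "d *\<^sub>R proj_span z u"] d by (intro power_mono) auto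
  also have "(norm z + d * ?P)\<^sup>2 + d * ?Q\<^sup>2 = (norm z)\<^sup>2 + 2 * d * (norm z * ?P) + d * (d * ?P\<^sup>2) + d * ?Q\<^sup>2"
    by (simp add: power2_eq_square algebra_simps)
  also have "\<dots> \<le> (norm z)\<^sup>2 + 2 * d * (1 * (1/4)) + d * (1 * ?P\<^sup>2) + d * ?Q\<^sup>2"
    using d z P u by (intro add_mono mult_left_mono mult_mono) auto
  also have "\<dots> = (norm z)\<^sup>2 + d * (1/2 + (norm u)\<^sup>2)" unfolding PQ[symmetric] by (simp add: algebra_simps)
  also have "\<dots> \<le> (norm z)\<^sup>2 + d * (1/2 + (1/4)\<^sup>2)"
    using d u by (intro add_left_mono mult_left_mono power_mono) auto
  also have "(norm z)\<^sup>2 = 1 - d" by (simp add: d_def defect_def)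
  also have "1 - d + d * (1/2 + (1/4)\<^sup>2) < 1" using d by (simp add: power2_eq_square)
  finally have "(norm w)\<^sup>2 < 1" by simp
  then show w: "ball_chart z u \<in> unit_ball" by (simp add: w_def abs_square_less_1)
  then have w: "w \<in> unit_ball" by (simp add: w_def)
  have "(pseudo_hyp_dist z w * norm (1 - herm_inner w z))\<^sup>2 = (d * norm u)\<^sup>2"
    unfolding pseudo_hyp_dist_formula[OF z w] Qw using d
    by (simp add: Pw power_mult_distrib sd flip: d_def PQ) (simp add: power2_eq_square algebra_simps)
  then have e: "pseudo_hyp_dist z w * norm (1 - herm_inner w z) = d * norm u"
    using d by simp
  have "1 - herm_inner w z = of_real d - herm_inner (proj_span z w - z) z"
    unfolding herm_inner_diff_proj_self[symmetric] d_def
    by (simp add: defect_def herm_inner_diff_left herm_inner_self)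
  then have "d - norm (herm_inner (proj_span z w - z) z) \<le> norm (1 - herm_inner w z)"
    using norm_triangle_ineq2[of "of_real d" "herm_inner (proj_span z w - z) z"] d by simp
  moreover have "norm (herm_inner (proj_span z w - z) z) \<le> d * ?P * norm z"
    using norm_herm_inner_le[of "proj_span z w - z" z] d by (simp add: Pw)
  moreover have "d * ?P * norm z \<le> d * norm u * 1"
    using d P z by (intro mult_mono) auto
  ultimately have "d * (1 - norm u) \<le> norm (1 - herm_inner w z)" by (simp add: algebra_simps)
  then have "pseudo_hyp_dist z w * (d * (1 - norm u)) \<le> d * norm u"
    unfolding e[symmetric] by (intro mult_left_mono) auto
  then have "d * (pseudo_hyp_dist z w * (1 - norm u)) \<le> d * norm u" by (simp only: mult_ac)
  then have "pseudo_hyp_dist z w * (1 - norm u) \<le> norm u"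
    using d by (simp only: mult_le_cancel_left_pos)
  then show "pseudo_hyp_dist z (ball_chart z u) \<le> norm u / (1 - norm u)"
    using u by (simp add: w_def field_simps)
qed

lemma ball_chart_in_bergman_ball:
  assumes z: "z \<in> unit_ball" and u: "norm u \<le> 1 / 4"
  shows "ball_chart z u \<in> bergman_ball z"
proof -
  have "norm u / (1 - norm u) < 1 / 2" using u by (simp add: field_simps)
  then show ?thesis using ball_chart_props(1)[OF assms] le_less_trans[OF ball_chart_props(2)[OF assms]]
    unfolding bergman_ball_def by blast
qed

lemma ball_chart_0 [simp]: "ball_chart z 0 = z"
  using linear_stretch[of "defect z" "sqrt (defect z)" z] by (simp add: ball_chart_def linear_0)

text \<open>The inverse chart sends \<open>w\<close> to a point of norm
  \<open>\<rho>(z, w) |1 - \<langle>w, z\<rangle>| / (1 - |z|\<^sup>2)\<close>, by \<open>pseudo_hyp_dist_formula\<close>.\<close>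

lemma ball_chart_surj:
  assumes z: "z \<in> unit_ball" and w: "w \<in> unit_ball"
  obtains u where "w = ball_chart z u" "norm u * (1 - pseudo_hyp_dist z w) \<le> pseudo_hyp_dist z w"
proof
  define d where "d = defect z"
  have d: "0 < d" "d \<le> 1" using defect_pos[OF z] defect_le_1 by (auto simp: d_def)
  have sd: "sqrt d * sqrt d = d" using d by simp
  define u where "u = stretch (1 / d) (1 / sqrt d) z (w - z)"
  show "w = ball_chart z u"
    using d by (simp add: u_def ball_chart_def stretch_stretch flip: d_def)
  have P: "proj_span z (w - z) = proj_span z w - z"
    using proj_span_linear[of z] by (simp add: linear_diff)
  have "(d * norm u)\<^sup>2 = (norm (z - proj_span z w))\<^sup>2 + d * (norm (w - proj_span z w))\<^sup>2"
    unfolding power_mult_distrib u_def norm_stretch_sq P using d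
    by (simp add: field_simps power2_eq_square norm_minus_commute)
  then have "(d * norm u)\<^sup>2 = (pseudo_hyp_dist z w * norm (1 - herm_inner w z))\<^sup>2"
    unfolding pseudo_hyp_dist_formula[OF z w] d_def by simp
  then have "d * norm u = pseudo_hyp_dist z w * norm (1 - herm_inner w z)"
    using d by simp
  then have "d * norm u * (1 - pseudo_hyp_dist z w) =
      pseudo_hyp_dist z w * ((1 - pseudo_hyp_dist z w) * norm (1 - herm_inner w z))" by simp
  also have "\<dots> \<le> pseudo_hyp_dist z w * d"
    unfolding d_def using norm_one_minus_herm_inner_le[OF z w] by (intro mult_left_mono) auto
  finally have "d * (norm u * (1 - pseudo_hyp_dist z w)) \<le> d * pseudo_hyp_dist z w"
    by (simp only: mult_ac)
  then show "norm u * (1 - pseudo_hyp_dist z w) \<le> pseudo_hyp_dist z w"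
    using d by (simp only: mult_le_cancel_left_pos)
qed

section \<open>Volume of the charts\<close>

text \<open>Let \<open>U\<close> be the unit ball. The two sides, multiplied by the measure of \<open>U\<close>, are the two iterated
  integrals of \<open>(x, y) \<mapsto> 1\<^sub>U(x) 1\<^sub>A(f x + y)\<close>; translation invariance evaluates one of them, and
  translation invariance together with \<open>f\<^sup>-\<^sup>1(U) = U\<close> the other.\<close>

lemma emeasure_lborel_vimage_isometry:
  fixes f g :: "'a::euclidean_space \<Rightarrow> 'a"
  assumes "linear f" and iso: "\<And>x. norm (f x) = norm x" and fg: "\<And>y. f (g y) = y"
    and [measurable]: "A \<in> sets borel"
  shows "emeasure lborel (f -` A) = emeasure lborel A"
proof -
  have [measurable]: "f \<in> borel_measurable borel"
    using assms(1) by (intro borel_measurable_continuous_onI linear_continuous_on) (simp add: linear_conv_bounded_linear)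
  have fdiff: "f (x - y) = f x - f y" for x y using assms(1) by (rule linear_diff)
  define U where "U = (ball 0 1 :: 'a set)"
  have [measurable]: "U \<in> sets borel" by (simp add: U_def)
  have shift: "(\<integral>\<^sup>+x. h (c + x) \<partial>lborel) = (\<integral>\<^sup>+x. h x \<partial>lborel)"
    if [measurable]: "h \<in> borel_measurable borel" for h :: "'a \<Rightarrow> ennreal" and c
    by (subst (2) lborel_distr_plus[of c, symmetric]) (simp add: nn_integral_distr)
  have U: "indicator U (x - g y) = (indicator U (f x - y) :: ennreal)" for x y
    using iso[of "x - g y"] unfolding fdiff fg by (simp add: U_def indicator_def)
  have "emeasure lborel U * emeasure lborel A =
      (\<integral>\<^sup>+x. indicator U x * (\<integral>\<^sup>+y. indicator A (f x + y) \<partial>lborel) \<partial>lborel)"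
    by (simp add: shift nn_integral_multc)
  also have "\<dots> = (\<integral>\<^sup>+x. (\<integral>\<^sup>+y. indicator U x * indicator A (f x + y) \<partial>lborel) \<partial>lborel)"
    by (simp add: nn_integral_cmult)
  also have "\<dots> = (\<integral>\<^sup>+y. (\<integral>\<^sup>+x. indicator U x * indicator A (f x + y) \<partial>lborel) \<partial>lborel)"
    by (rule lborel_pair.Fubini') measurable
  also have "\<dots> = (\<integral>\<^sup>+y. (\<integral>\<^sup>+x. indicator U (f x - y) * indicator A (f x) \<partial>lborel) \<partial>lborel)"
  proof (rule nn_integral_cong)
    fix y
    have "(\<integral>\<^sup>+x. indicator U x * indicator A (f x + y) \<partial>lborel) =
        (\<integral>\<^sup>+x. indicator U (- g y + x) * indicator A (f (- g y + x) + y) \<partial>lborel)"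
      by (rule shift[symmetric]) measurable
    also have "\<dots> = (\<integral>\<^sup>+x. indicator U (f x - y) * indicator A (f x) \<partial>lborel)"
      by (simp add: U fdiff fg)
    finally show "(\<integral>\<^sup>+x. indicator U x * indicator A (f x + y) \<partial>lborel) =
      (\<integral>\<^sup>+x. indicator U (f x - y) * indicator A (f x) \<partial>lborel)" .
  qed
  also have "\<dots> = (\<integral>\<^sup>+x. (\<integral>\<^sup>+y. indicator U (f x - y) * indicator A (f x) \<partial>lborel) \<partial>lborel)"
    by (rule lborel_pair.Fubini') measurable
  also have "\<dots> = (\<integral>\<^sup>+x. emeasure lborel U * indicator (f -` A) x \<partial>lborel)"
  proof (rule nn_integral_cong)
    fix x
    have "(\<integral>\<^sup>+y. indicator U (f x - y) * indicator A (f x) \<partial>lborel) =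
        (\<integral>\<^sup>+y. indicator U (f x - y) \<partial>lborel) * indicator A (f x)"
      by (rule nn_integral_multc) measurable
    also have "(\<integral>\<^sup>+y. indicator U (f x - y) \<partial>lborel) = (\<integral>\<^sup>+y. indicator (ball (f x) 1) y \<partial>lborel)"
      by (intro nn_integral_cong) (auto simp: U_def indicator_def dist_norm norm_minus_commute)
    also have "\<dots> = emeasure lborel U" by (simp add: U_def emeasure_ball)
    finally show "(\<integral>\<^sup>+y. indicator U (f x - y) * indicator A (f x) \<partial>lborel) =
        emeasure lborel U * indicator (f -` A) x" by (simp add: indicator_def)
  qed
  also have "\<dots> = emeasure lborel U * emeasure lborel (f -` A)"
  proof -
    have "f -` A \<in> sets lborel" using measurable_sets[of f borel borel A] by simp
    then show ?thesis by (simp add: nn_integral_cmult)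
  qed
  finally have "emeasure lborel U * emeasure lborel A = emeasure lborel U * emeasure lborel (f -` A)" .
  moreover have "emeasure lborel U \<noteq> 0" "emeasure lborel U \<noteq> \<infinity>"
    by (simp_all add: U_def emeasure_ball unit_ball_vol_pos less_imp_neq[symmetric])
  ultimately show ?thesis by (simp add: ennreal_mult_cancel_left)
qed

definition axis_scaling :: "'a::euclidean_space \<Rightarrow> real \<Rightarrow> 'a \<Rightarrow> 'a" where
  "axis_scaling v k x = x + ((k - 1) * (x \<bullet> v)) *\<^sub>R v"

lemma borel_measurable_axis_scaling [measurable]: "axis_scaling v k \<in> borel_measurable borel"
  unfolding axis_scaling_def by measurable

text \<open>For a basis vector this is the scaling of one coordinate; a reflection carries a basis vector
  to any other unit vector.\<close>

lemma emeasure_lborel_vimage_axis_scaling: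
  fixes v :: "'a::euclidean_space"
  assumes k: "0 < k" and v: "norm v = 1" and A: "A \<in> sets borel"
  shows "emeasure lborel A = ennreal k * emeasure lborel (axis_scaling v k -` A)"
proof -
  have basis: "emeasure lborel A = ennreal k * emeasure lborel (axis_scaling b k -` A)"
    if b: "b \<in> Basis" and A: "A \<in> sets borel" for b :: 'a and A
  proof -
    define c where "c = (\<lambda>j. if j = b then k else 1)"
    have T: "(\<lambda>x. 0 + (\<Sum>j\<in>Basis. (c j * (x \<bullet> j)) *\<^sub>R j)) = axis_scaling b k"
    proof
      fix x :: 'a
      have "(\<Sum>j\<in>Basis. (c j * (x \<bullet> j)) *\<^sub>R j) =
         (\<Sum>j\<in>Basis. (x \<bullet> j) *\<^sub>R j) + (\<Sum>j\<in>Basis. (if j = b then ((k - 1) * (x \<bullet> j)) *\<^sub>R j else 0))"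
        unfolding sum.distrib[symmetric]
        by (intro sum.cong) (auto simp: c_def algebra_simps)
      also have "\<dots> = axis_scaling b k x"
        using b by (simp add: axis_scaling_def euclidean_representation)
      finally show "0 + (\<Sum>j\<in>Basis. (c j * (x \<bullet> j)) *\<^sub>R j) = axis_scaling b k x" by simp
    qed
    have pr: "(\<Prod>j\<in>Basis. \<bar>c j\<bar>) = k"
    proof -
      have "(\<Prod>j\<in>Basis. \<bar>c j\<bar>) = (\<Prod>j\<in>Basis. if j = b then k else 1)"
        using k by (intro prod.cong) (auto simp: c_def)
      then show ?thesis using b by simp
    qed
    have "lborel = density (distr lborel borel (axis_scaling b k)) (\<lambda>_. ennreal k)"
      using lborel_affine_euclidean[of c 0] k unfolding T pr by (simp add: c_def)
    then have "emeasure lborel A = emeasure (density (distr lborel borel (axis_scaling b k)) (\<lambda>_. ennreal k)) A"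
      by simp
    also have "\<dots> = ennreal k * emeasure (distr lborel borel (axis_scaling b k)) A"
      using A by (subst emeasure_density) (auto simp: nn_integral_cmult)
    also have "emeasure (distr lborel borel (axis_scaling b k)) A = emeasure lborel (axis_scaling b k -` A)"
      using A by (subst emeasure_distr) auto
    finally show ?thesis .
  qed
  obtain b :: 'a where b: "b \<in> Basis" using nonempty_Basis by blast
  show ?thesis
  proof (cases "b = v")
    case True
    then show ?thesis using basis[OF b A] by simp
  next
    case False
    define w where "w = b - v"
    define H where "H = (\<lambda>x. x - (2 * (x \<bullet> w) / (w \<bullet> w)) *\<^sub>R w)"
    have w: "w \<bullet> w \<noteq> 0" using False by (simp add: w_def)
    have b1: "b \<bullet> b = 1" "v \<bullet> v = 1" using b v by (simp_all add: inner_Basis norm_eq_1)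
    have ww: "w \<bullet> w = 2 * (b \<bullet> w)"
      using b1 by (simp add: w_def inner_diff_left inner_diff_right inner_commute)
    have Hb: "H b = v" using w unfolding H_def ww by (simp add: w_def)
    have lin: "linear H"
      unfolding H_def by (intro linearI) (auto simp: inner_add_left algebra_simps add_divide_distrib)
    have inn: "H x \<bullet> H y = x \<bullet> y" for x y
      using w by (simp add: H_def inner_diff_left inner_diff_right inner_commute)
    have inv: "H (H x) = x" for x
      using w by (simp add: H_def inner_diff_left algebra_simps flip: scaleR_left_diff_distrib)
    have nrm: "norm (H x) = norm x" for x by (simp add: norm_eq_sqrt_inner inn)
    have conj: "axis_scaling v k x = H (axis_scaling b k (H x))" for x
    proof -
      have "x \<bullet> v = H x \<bullet> b" using inn[of x "H b"] inn[of "H x" b] inv Hb by metis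
      then show ?thesis
        using lin inv[of x] Hb unfolding axis_scaling_def by (simp add: linear_add linear_cmul)
    qed
    have [measurable]: "H \<in> borel_measurable borel"
      unfolding H_def by measurable
    have sH: "H -` B \<in> sets borel" if "B \<in> sets borel" for B
      using measurable_sets[of H borel borel B] that by simp
    have sR: "axis_scaling b k -` B \<in> sets borel" if "B \<in> sets borel" for B
      using measurable_sets[OF borel_measurable_axis_scaling that, of b k] by simp
    note iso = emeasure_lborel_vimage_isometry[OF lin nrm inv]
    have "emeasure lborel A = emeasure lborel (H -` A)" using iso[OF A] by simp
    also have "\<dots> = ennreal k * emeasure lborel (axis_scaling b k -` (H -` A))"
      by (rule basis[OF b sH[OF A]])
    also have "emeasure lborel (axis_scaling b k -` (H -` A)) =
        emeasure lborel (H -` (axis_scaling b k -` (H -` A)))"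
      using iso[OF sR[OF sH[OF A]]] by simp
    also have "H -` (axis_scaling b k -` (H -` A)) = axis_scaling v k -` A"
      by (auto simp: conj)
    finally show ?thesis .
  qed
qed

lemma DIM_complex_vec: "DIM(complex ^ 'n) = 2 * CARD('n)"
  by simp

lemma borel_measurable_stretch [measurable]: "stretch s t a \<in> borel_measurable borel"
  using linear_stretch
  by (intro borel_measurable_continuous_onI linear_continuous_on) (simp add: linear_conv_bounded_linear)

lemma vimage_stretch_borel: "A \<in> sets borel \<Longrightarrow> stretch s t a -` A \<in> sets borel"
  using measurable_sets[OF borel_measurable_stretch, of A s t a] by simp

text \<open>For \<open>s = d\<close> and \<open>t = \<surd>d\<close> the stretch is a homothety by \<open>\<surd>d\<close> followed by the scalings by \<open>\<surd>d\<close>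
  in the two real directions \<open>e\<close> and \<open>\<i>e\<close>, where \<open>e = a / |a|\<close>. This gives the Jacobian
  \<open>(\<surd>d)\<^bsup>2n\<^esup> (\<surd>d)\<^sup>2 = d\<^bsup>n + 1\<^esup>\<close>. For \<open>a = 0\<close> the projection vanishes, and the factor is correct only
  if \<open>d = 1\<close>.\<close>

lemma emeasure_lborel_vimage_stretch:
  fixes a :: "complex ^ 'n"
  assumes d: "0 < d" and a: "a \<noteq> 0 \<or> d = 1" and A: "A \<in> sets borel"
  shows "emeasure lborel A = ennreal (d ^ (CARD('n) + 1)) * emeasure lborel (stretch d (sqrt d) a -` A)"
proof (cases "a = 0")
  case True
  then show ?thesis using a by (simp add: stretch_def proj_span_def vimage_def)
next
  case False
  define k where "k = sqrt d"
  have k: "0 < k" "k * k = d" using d by (auto simp: k_def)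
  define e where "e = (1 / norm a) *\<^sub>R a"
  define e' where "e' = \<i> *s e"
  have e: "norm e = 1" "norm e' = 1" using False by (simp_all add: e_def e'_def norm_smult_vec)
  have ie: "u \<bullet> e' = Im (herm_inner u e)" for u
    by (simp add: inner_eq_Re_herm_inner e'_def herm_inner_smult_right)
  have "e' \<bullet> e = 0"
    using e(1) by (simp add: inner_eq_Re_herm_inner e'_def herm_inner_smult_left herm_inner_self)
  have P: "proj_span a u = (u \<bullet> e) *\<^sub>R e + (u \<bullet> e') *\<^sub>R e'" for u
  proof -
    have "proj_span a u = herm_inner u e *s e"
      using False by (simp add: proj_span_def e_def herm_inner_scaleR_right herm_inner_self vec_eq_iff
          power2_eq_square scaleR_conv_of_real[where 'a=complex])
    also have "\<dots> = of_real (u \<bullet> e) *s e + (of_real (u \<bullet> e') * \<i>) *s e"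
      unfolding ie inner_eq_Re_herm_inner[of u e] vec.scale_left_distrib[symmetric]
      by (simp add: complex_eq_iff vec_eq_iff)
    finally show ?thesis by (simp add: e'_def vec_eq_iff scaleR_conv_of_real[where 'a=complex])
  qed
  have st: "stretch d (sqrt d) a = (\<lambda>u. k *\<^sub>R axis_scaling e k (axis_scaling e' k u))"
  proof
    fix u
    have "axis_scaling e k (axis_scaling e' k u) = u + (k - 1) *\<^sub>R proj_span a u"
      unfolding P by (simp add: axis_scaling_def inner_add_left \<open>e' \<bullet> e = 0\<close> algebra_simps)
    note * = this
    show "stretch d (sqrt d) a u = k *\<^sub>R axis_scaling e k (axis_scaling e' k u)"
      unfolding * stretch_def k_def[symmetric] by (simp add: algebra_simps k(2))
  qed
  define B where "B = (\<lambda>x. k *\<^sub>R x) -` A"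
  have B: "B \<in> sets borel"
    unfolding B_def using measurable_sets[of "\<lambda>x. k *\<^sub>R x" borel borel A] A by simp
  have B': "axis_scaling e k -` B \<in> sets borel"
    using measurable_sets[OF borel_measurable_axis_scaling B, of e k] by simp
  have "emeasure lborel A = emeasure (density (distr lborel borel (\<lambda>x. 0 + k *\<^sub>R x))
      (\<lambda>_. ennreal (\<bar>k\<bar> ^ DIM(complex ^ 'n)))) A"
    using lborel_affine[of k "0 :: complex ^ 'n"] k by simp
  also have "\<dots> = ennreal (k ^ (2 * CARD('n))) * emeasure lborel B"
    using A k unfolding DIM_complex_vec
    by (subst emeasure_density) (auto simp: nn_integral_cmult emeasure_distr B_def)
  also have "emeasure lborel B = ennreal k * emeasure lborel (axis_scaling e k -` B)"
    by (rule emeasure_lborel_vimage_axis_scaling[OF k(1) e(1) B])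
  also have "emeasure lborel (axis_scaling e k -` B) =
      ennreal k * emeasure lborel (axis_scaling e' k -` (axis_scaling e k -` B))"
    by (rule emeasure_lborel_vimage_axis_scaling[OF k(1) e(2) B'])
  also have "axis_scaling e' k -` (axis_scaling e k -` B) = stretch d (sqrt d) a -` A"
    unfolding st B_def by auto
  also have "ennreal (k ^ (2 * CARD('n))) * (ennreal k * (ennreal k * X)) =
      ennreal (d ^ (CARD('n) + 1)) * X" for X
  proof -
    have "ennreal (k ^ (2 * CARD('n))) * (ennreal k * ennreal k) = ennreal (k ^ (2 * CARD('n)) * (k * k))"
      using k(1) by (simp add: mult.assoc flip: ennreal_mult)
    also have "k ^ (2 * CARD('n)) * (k * k) = d ^ (CARD('n) + 1)"
      using k(2) by (simp add: power_mult power2_eq_square)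
    finally show ?thesis by (metis mult.assoc)
  qed
  finally show ?thesis .
qed

lemma
  fixes z :: "complex ^ 'n"
  assumes z: "z \<in> unit_ball" and B: "B \<in> sets borel"
  shows ball_chart_image_borel: "ball_chart z ` B \<in> sets borel"
    and emeasure_ball_chart_image:
      "emeasure lborel (ball_chart z ` B) = ennreal (defect z ^ (CARD('n) + 1)) * emeasure lborel B"
proof -
  define d where "d = defect z"
  have d: "0 < d" using defect_pos[OF z] by (simp add: d_def)
  define X where "X = stretch (1 / d) (sqrt (1 / d)) z -` B"
  have X: "X \<in> sets borel" unfolding X_def by (rule vimage_stretch_borel[OF B])
  have inv: "stretch (1 / d) (sqrt (1 / d)) z (stretch d (sqrt d) z u) = u"
    "stretch d (sqrt d) z (stretch (1 / d) (sqrt (1 / d)) z u) = u" for u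
    using d by (simp_all add: stretch_stretch real_sqrt_divide)
  have img: "ball_chart z ` B = (\<lambda>x. - z + x) -` X"
  proof (intro equalityI subsetI)
    fix y assume "y \<in> ball_chart z ` B"
    then show "y \<in> (\<lambda>x. - z + x) -` X"
      by (auto simp: ball_chart_def X_def inv simp flip: d_def)
  next
    fix y assume "y \<in> (\<lambda>x. - z + x) -` X"
    then have "stretch (1 / d) (sqrt (1 / d)) z (y - z) \<in> B" by (simp add: X_def)
    moreover have "y = ball_chart z (stretch (1 / d) (sqrt (1 / d)) z (y - z))"
      by (simp add: ball_chart_def inv flip: d_def)
    ultimately show "y \<in> ball_chart z ` B" by blast
  qed
  show "ball_chart z ` B \<in> sets borel"
    unfolding img using measurable_sets[OF _ X, of "\<lambda>x. - z + x" borel]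
    unfolding space_borel Int_UNIV_right by measurable
  have "emeasure lborel (ball_chart z ` B) = emeasure (distr lborel borel (\<lambda>x. - z + x)) X"
    unfolding img using X by (subst emeasure_distr) auto
  also have "\<dots> = emeasure lborel X" unfolding lborel_distr_plus ..
  finally have *: "emeasure lborel (ball_chart z ` B) = emeasure lborel X" .
  have "emeasure lborel B = ennreal ((1 / d) ^ (CARD('n) + 1)) * emeasure lborel X"
    unfolding X_def using d z B
    by (intro emeasure_lborel_vimage_stretch) (auto simp: d_def defect_def)
  then have "ennreal (d ^ (CARD('n) + 1)) * emeasure lborel B =
      ennreal (d ^ (CARD('n) + 1) * (1 / d) ^ (CARD('n) + 1)) * emeasure lborel X"
    using d by (simp only: ennreal_mult zero_le_power zero_le_divide_1_iff less_imp_le mult.assoc)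
  also have "d ^ (CARD('n) + 1) * (1 / d) ^ (CARD('n) + 1) = 1"
    using d unfolding power_mult_distrib[symmetric] by simp
  finally show "emeasure lborel (ball_chart z ` B) = ennreal (defect z ^ (CARD('n) + 1)) * emeasure lborel B"
    using * by (simp add: d_def)
qed

section \<open>Holomorphic functions of several variables\<close>

lemma bounded_linear_smult_left: "bounded_linear (\<lambda>c. c *s (v :: complex ^ 'n))"
  by (rule bounded_linear_intro[of _ "norm v"])
    (auto simp: vec_eq_iff ring_distribs scaleR_conv_of_real[where 'a=complex] norm_smult_vec)

lemma mv_holomorphic_on_subset: "mv_holomorphic_on f T \<Longrightarrow> S \<subseteq> T \<Longrightarrow> mv_holomorphic_on f S"
  by (auto simp: mv_holomorphic_on_def)

lemma mv_holomorphic_on_const [intro]: "mv_holomorphic_on (\<lambda>_. c) S"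
  unfolding mv_holomorphic_on_def by (auto intro!: exI[of _ "\<lambda>_. 0"])

lemma mv_holomorphic_on_add [intro]:
  assumes "mv_holomorphic_on f S" "mv_holomorphic_on g S"
  shows "mv_holomorphic_on (\<lambda>z. f z + g z) S"
  unfolding mv_holomorphic_on_def
proof
  fix z assume "z \<in> S"
  then obtain D E where "(f has_derivative D) (at z)" "\<forall>c v. D (c *s v) = c * D v"
    "(g has_derivative E) (at z)" "\<forall>c v. E (c *s v) = c * E v"
    using assms unfolding mv_holomorphic_on_def by metis
  then show "\<exists>D. ((\<lambda>z. f z + g z) has_derivative D) (at z) \<and> (\<forall>c v. D (c *s v) = c * D v)"
    by (intro exI[of _ "\<lambda>v. D v + E v"]) (auto intro!: derivative_eq_intros simp: algebra_simps)
qed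

lemma mv_holomorphic_on_mult [intro]:
  assumes "mv_holomorphic_on f S" "mv_holomorphic_on g S"
  shows "mv_holomorphic_on (\<lambda>z. f z * g z) S"
  unfolding mv_holomorphic_on_def
proof
  fix z assume "z \<in> S"
  then obtain D E where "(f has_derivative D) (at z)" "\<forall>c v. D (c *s v) = c * D v"
    "(g has_derivative E) (at z)" "\<forall>c v. E (c *s v) = c * E v"
    using assms unfolding mv_holomorphic_on_def by metis
  moreover from this have "((\<lambda>z. f z * g z) has_derivative (\<lambda>v. f z * E v + D v * g z)) (at z)"
    by (intro has_derivative_mult)
  ultimately show "\<exists>D. ((\<lambda>z. f z * g z) has_derivative D) (at z) \<and> (\<forall>c v. D (c *s v) = c * D v)"
    by (intro exI[of _ "\<lambda>v. f z * E v + D v * g z"]) (simp add: algebra_simps)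
qed

lemma mv_holomorphic_on_cmult: "mv_holomorphic_on f S \<Longrightarrow> mv_holomorphic_on (\<lambda>z. c * f z) S"
  by (rule mv_holomorphic_on_mult) auto

lemma mv_holomorphic_on_diff [intro]:
  assumes "mv_holomorphic_on f S" "mv_holomorphic_on g S"
  shows "mv_holomorphic_on (\<lambda>z. f z - g z) S"
  using mv_holomorphic_on_add[OF assms(1) mv_holomorphic_on_cmult[OF assms(2), of "-1"]] by simp

lemma mv_holomorphic_on_power [intro]:
  "mv_holomorphic_on f S \<Longrightarrow> mv_holomorphic_on (\<lambda>z. f z ^ m) S"
  by (induction m) auto

lemma mv_holomorphic_on_sum [intro]:
  "(\<And>i. i \<in> I \<Longrightarrow> mv_holomorphic_on (f i) S) \<Longrightarrow> mv_holomorphic_on (\<lambda>z. \<Sum>i\<in>I. f i z) S"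
  by (induction I rule: infinite_finite_induct) auto

lemma mv_holomorphic_on_inverse [intro]:
  assumes "mv_holomorphic_on f S" "\<And>z. z \<in> S \<Longrightarrow> f z \<noteq> 0"
  shows "mv_holomorphic_on (\<lambda>z. inverse (f z)) S"
  unfolding mv_holomorphic_on_def
proof
  fix z assume z: "z \<in> S"
  then obtain D where "(f has_derivative D) (at z)" "\<forall>c v. D (c *s v) = c * D v"
    using assms unfolding mv_holomorphic_on_def by metis
  then show "\<exists>D. ((\<lambda>z. inverse (f z)) has_derivative D) (at z) \<and> (\<forall>c v. D (c *s v) = c * D v)"
    using assms(2)[OF z]
    by (intro exI[of _ "\<lambda>v. - (inverse (f z) * D v * inverse (f z))"]) (auto intro!: has_derivative_inverse)
qed

lemma mv_holomorphic_on_linear: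
  assumes "bounded_linear L" "\<And>c v. L (c *s v) = c * L v"
  shows "mv_holomorphic_on L S"
  unfolding mv_holomorphic_on_def
  using assms bounded_linear_imp_has_derivative by blast

lemma mv_holomorphic_on_nth [intro]: "mv_holomorphic_on (\<lambda>z. z $ j) S"
  by (rule mv_holomorphic_on_linear) (auto intro: bounded_linear_vec_nth)

lemma mv_holomorphic_on_herm_inner [intro]: "mv_holomorphic_on (\<lambda>z. herm_inner z a) S"
  unfolding herm_inner_def by (intro mv_holomorphic_on_sum mv_holomorphic_on_mult) auto

lemma mv_holomorphic_on_continuous:
  "mv_holomorphic_on f S \<Longrightarrow> continuous_on S f"
  unfolding mv_holomorphic_on_def by (meson continuous_at_imp_continuous_on has_derivative_continuous)

lemma mv_holomorphic_on_compose:
  fixes \<phi> :: "complex ^ 'n \<Rightarrow> complex ^ 'n"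
  assumes f: "mv_holomorphic_on f T" and \<phi>: "\<And>j. mv_holomorphic_on (\<lambda>z. \<phi> z $ j) S" "\<phi> ` S \<subseteq> T"
  shows "mv_holomorphic_on (\<lambda>z. f (\<phi> z)) S"
  unfolding mv_holomorphic_on_def
proof
  fix z assume z: "z \<in> S"
  have "\<forall>j. \<exists>D. ((\<lambda>z. \<phi> z $ j) has_derivative D) (at z) \<and> (\<forall>c v. D (c *s v) = c * D v)"
    using \<phi>(1) z unfolding mv_holomorphic_on_def by blast
  then obtain D where D: "\<And>j. ((\<lambda>z. \<phi> z $ j) has_derivative D j) (at z)" "\<And>j c v. D j (c *s v) = c * D j v"
    unfolding choice_iff by blast
  obtain E where E: "(f has_derivative E) (at (\<phi> z))" "\<And>c v. E (c *s v) = c * E v"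
    using f \<phi>(2) z unfolding mv_holomorphic_on_def by blast
  have sm: "(\<Sum>j\<in>UNIV. (x $ j) *s axis j 1) = x" for x :: "complex ^ 'n"
    by (simp add: vec_eq_iff sum_component axis_def if_distrib cong: if_cong)
  have "((\<lambda>z. \<Sum>j\<in>UNIV. (\<phi> z $ j) *s axis j 1) has_derivative (\<lambda>v. \<Sum>j\<in>UNIV. D j v *s axis j 1)) (at z)"
    by (intro has_derivative_sum bounded_linear.has_derivative[OF bounded_linear_smult_left] D)
  then have "(\<phi> has_derivative (\<lambda>v. \<Sum>j\<in>UNIV. D j v *s axis j 1)) (at z)"
    unfolding sm .
  from has_derivative_compose[OF this E(1)]
  have "((\<lambda>z. f (\<phi> z)) has_derivative (\<lambda>v. E (\<Sum>j\<in>UNIV. D j v *s axis j 1))) (at z)" .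
  moreover have "E (\<Sum>j\<in>UNIV. D j (c *s v) *s axis j 1) = c * E (\<Sum>j\<in>UNIV. D j v *s axis j 1)" for c v
    unfolding D(2) E(2)[symmetric] vec.scale_sum_right vector_smult_assoc ..
  ultimately show "\<exists>D. ((\<lambda>z. f (\<phi> z)) has_derivative D) (at z) \<and> (\<forall>c v. D (c *s v) = c * D v)"
    by blast
qed

lemma mv_holomorphic_comp_self_map:
  assumes "mv_holomorphic_on f unit_ball" "holomorphic_self_map \<phi>"
  shows "mv_holomorphic_on (\<lambda>z. f (\<phi> z)) unit_ball"
  using mv_holomorphic_on_compose[OF assms(1), of \<phi> unit_ball] assms(2)
  by (simp add: holomorphic_self_map_def)

lemma mv_holomorphic_slice:
  fixes f :: "complex ^ 'n \<Rightarrow> complex"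
  assumes "(f has_derivative D) (at (a + x *s v))" "\<And>c v. D (c *s v) = c * D v"
  shows "((\<lambda>\<zeta>. f (a + \<zeta> *s v)) has_field_derivative D v) (at x)"
proof -
  have "((\<lambda>\<zeta>. a + \<zeta> *s v) has_derivative (\<lambda>h. h *s v)) (at x)"
    using has_derivative_add[OF has_derivative_const[of a]
        bounded_linear_imp_has_derivative[OF bounded_linear_smult_left[of v]], of "at x"] by simp
  from has_derivative_compose[OF this assms(1)] show ?thesis
    unfolding has_field_derivative_def assms(2) by (simp add: mult.commute[of _ "D v"])
qed

text \<open>Both parts are the Schwarz lemma on the one-dimensional slices through \<open>a\<close>, applied to
  \<open>(F - F(a)) / L\<close> for all \<open>L > 2K\<close>.\<close>

lemma
  assumes hol: "mv_holomorphic_on F (ball a R)" and R: "0 < R"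
    and K: "\<And>x. x \<in> ball a R \<Longrightarrow> norm (F x) \<le> K"
  shows mv_holomorphic_lipschitz: "u \<in> ball a R \<Longrightarrow> norm (F u - F a) \<le> 2 * K / R * norm (u - a)"
    and mv_holomorphic_derivative_bound:
      "(F has_derivative D) (at a) \<Longrightarrow> (\<And>c v. D (c *s v) = c * D v) \<Longrightarrow> norm (D v) \<le> 2 * K / R * norm v"
proof -
  have a: "a \<in> ball a R" using R by simp
  have K0: "0 \<le> K" using K[OF a] norm_ge_zero order_trans by blast
  \<comment> \<open>The Schwarz lemma on the slice through \<open>a\<close> in the direction \<open>v\<close>.\<close>
  have main: "(\<forall>\<zeta>. norm \<zeta> < 1 \<longrightarrow> norm (F (a + \<zeta> *s v) - F a) \<le> L * norm \<zeta>) \<and>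
     (\<forall>D. (F has_derivative D) (at a) \<longrightarrow> (\<forall>c v. D (c *s v) = c * D v) \<longrightarrow> norm (D v) \<le> L)"
    if v: "norm v \<le> R" and L: "2 * K < L" for v L
  proof -
    define g where "g = (\<lambda>\<zeta>. (F (a + \<zeta> *s v) - F a) / of_real L)"
    have L0: "0 < L" using L K0 by linarith
    have inb: "a + \<zeta> *s v \<in> ball a R" if "norm \<zeta> < 1" for \<zeta>
    proof -
      have "norm \<zeta> * norm v \<le> norm \<zeta> * R" using v by (intro mult_left_mono) auto
      also have "\<dots> < 1 * R" using that R by (intro mult_strict_right_mono) auto
      finally show ?thesis by (simp add: dist_norm norm_smult_vec)
    qed
    have der: "(g has_field_derivative D v / of_real L) (at \<zeta>)"
      if "(F has_derivative D) (at (a + \<zeta> *s v))" "\<And>c v. D (c *s v) = c * D v" for D \<zeta>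
      unfolding g_def using L0
      by (auto intro!: derivative_eq_intros mv_holomorphic_slice[OF that])
    have "g holomorphic_on ball 0 1"
    proof (subst holomorphic_on_open[OF open_ball], intro ballI)
      fix \<zeta> :: complex assume "\<zeta> \<in> ball 0 1"
      then have "a + \<zeta> *s v \<in> ball a R" using inb by simp
      with hol show "\<exists>f'. (g has_field_derivative f') (at \<zeta>)"
        unfolding mv_holomorphic_on_def using der by metis
    qed
    moreover have "g 0 = 0" by (simp add: g_def)
    moreover have "norm (g \<zeta>) < 1" if "norm \<zeta> < 1" for \<zeta>
    proof -
      have "norm (F (a + \<zeta> *s v) - F a) \<le> K + K"
        by (rule norm_triangle_le_diff) (intro add_mono K inb that a)
      also have "\<dots> < L" using L by simp
      finally show ?thesis using L0 by (simp add: g_def norm_divide)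
    qed
    ultimately have S: "\<And>\<zeta>. norm \<zeta> < 1 \<Longrightarrow> norm (g \<zeta>) \<le> norm \<zeta>" "norm (deriv g 0) \<le> 1"
      using Schwarz_Lemma[of g] by (metis norm_zero zero_less_one)+
    show ?thesis
    proof (intro conjI allI impI)
      show "norm (F (a + \<zeta> *s v) - F a) \<le> L * norm \<zeta>" if "norm \<zeta> < 1" for \<zeta>
        using S(1)[OF that] L0 by (simp add: g_def norm_divide field_simps)
      fix D assume "(F has_derivative D) (at a)" "\<forall>c v. D (c *s v) = c * D v"
      then have "deriv g 0 = D v / of_real L" by (intro DERIV_imp_deriv der) auto
      then show "norm (D v) \<le> L" using S(2) L0 by (simp add: norm_divide)
    qed
  qed
  show "norm (F u - F a) \<le> 2 * K / R * norm (u - a)" if u: "u \<in> ball a R"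
  proof (cases "u = a")
    case False
    define r where "r = norm (u - a)"
    have r: "0 < r" "r < R" using False u by (auto simp: r_def dist_norm norm_minus_commute)
    define v where "v = complex_of_real (R / r) *s (u - a)"
    have v: "norm v \<le> R" using r R unfolding v_def norm_smult_vec norm_of_real r_def[symmetric] by simp
    have uv: "u = a + complex_of_real (r / R) *s v"
    proof -
      have "complex_of_real (r / R) * complex_of_real (R / r) = 1"
        unfolding of_real_mult[symmetric] using r R by simp
      then show ?thesis unfolding v_def vector_smult_assoc by simp
    qed
    have "norm (F u - F a) * (R / r) \<le> L" if "2 * K < L" for L
      using conjunct1[OF main[OF v that], rule_format, of "complex_of_real (r / R)"] r R
      by (simp add: field_simps flip: uv of_real_divide)
    then have "norm (F u - F a) * (R / r) \<le> 2 * K" by (rule dense_ge)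
    then show ?thesis using r R by (simp add: field_simps flip: r_def)
  qed simp
  show "norm (D v) \<le> 2 * K / R * norm v"
    if D: "(F has_derivative D) (at a)" "\<And>c v. D (c *s v) = c * D v"
  proof (cases "v = 0")
    case True
    then show ?thesis using D(2)[of 0 v] by simp
  next
    case False
    define c where "c = complex_of_real (R / norm v)"
    have "norm (c *s v) \<le> R" unfolding c_def norm_smult_vec norm_of_real using False R by simp
    then have "norm (D (c *s v)) \<le> L" if "2 * K < L" for L
      using main that D by blast
    then have "norm (D (c *s v)) \<le> 2 * K" by (rule dense_ge)
    then have "R / norm v * norm (D v) \<le> 2 * K"
      unfolding D(2) norm_mult c_def norm_of_real using R by simp
    then show ?thesis using False R by (simp add: field_simps)
  qed
qed

text \<open>A substitute for the sub-mean value property of \<open>|F|\<^sup>p\<close> that works for all \<open>p > 0\<close> at once: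
  at a point where \<open>(1/4 - |x|)\<^bsup>2n\<^esup> |F(x)|\<^sup>p\<close> is largest, \<open>F\<close> is bounded nearby by a multiple of
  its own value, so that by the Schwarz lemma \<open>|F|\<close> stays above half that value on a ball of
  radius comparable with \<open>1/4 - |x|\<close>.\<close>

lemma large_on_subball:
  fixes p :: real
  assumes p: "0 < p"
  shows "\<exists>C>0. \<forall>F :: complex ^ 'n \<Rightarrow> complex. mv_holomorphic_on F (cball 0 (1/4)) \<longrightarrow>
    (\<forall>u\<in>cball 0 (1/8). \<exists>a R y. 0 < R \<and> 0 \<le> y \<and> ball a R \<subseteq> ball 0 (1/4) \<and>
       (\<forall>x\<in>ball a R. y \<le> norm (F x) powr p) \<and> norm (F u) powr p \<le> C * R ^ (2 * CARD('n)) * y)"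
proof -
  define N where "N = 2 * CARD('n)"
  define K where "K = 2 powr (N / p)"
  have K1: "1 \<le> K" using p by (simp add: K_def ge_one_powr_ge_zero)
  define C where "C = (64 * K) ^ N * 2 powr p"
  have C: "0 < C" using K1 by (simp add: C_def)
  have "\<exists>a R y. 0 < R \<and> 0 \<le> y \<and> ball a R \<subseteq> ball 0 (1/4) \<and>
       (\<forall>x\<in>ball a R. y \<le> norm (F x) powr p) \<and> norm (F u) powr p \<le> C * R ^ N * y"
    if F: "mv_holomorphic_on F (cball 0 (1/4))" and u: "u \<in> cball 0 (1/8)"
    for F :: "complex ^ 'n \<Rightarrow> complex" and u
  proof -
    define h where "h = (\<lambda>x. (1/4 - norm x) ^ N * norm (F x) powr p)"
    have "continuous_on (cball 0 (1/4)) h"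
      unfolding h_def using p
      by (intro continuous_intros continuous_on_powr' mv_holomorphic_on_continuous[OF F]) auto
    then obtain a where a: "a \<in> cball 0 (1/4)" and amax: "\<And>x. x \<in> cball 0 (1/4) \<Longrightarrow> h x \<le> h a"
      using continuous_attains_sup[of "cball 0 (1/4)" h] by fastforce
    have hu: "(1/8) ^ N * norm (F u) powr p \<le> h u"
      unfolding h_def using u by (intro mult_right_mono power_mono) auto
    have hua: "h u \<le> h a" using u by (intro amax) auto
    show ?thesis
    proof (cases "h a = 0")
      case True
      then have "(1/8) ^ N * norm (F u) powr p \<le> 0" using hu hua by linarith
      moreover have "0 < (1/8 :: real) ^ N" by simp
      ultimately have "norm (F u) powr p \<le> 0" by (meson mult_pos_pos not_le)
      then show ?thesis by (intro exI[of _ 0] exI[of _ "1/4"] exI[of _ 0]) auto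
    next
      case False
      define d where "d = 1/4 - norm a"
      define Y where "Y = norm (F a)"
      have N0: "0 < N" by (simp add: N_def)
      have "norm a \<noteq> 1/4" using False N0 by (auto simp: h_def)
      then have d: "0 < d" using a by (simp add: d_def)
      have Y: "0 < Y" using False by (auto simp: Y_def h_def)
      have le: "norm (F x) \<le> K * Y" if x: "x \<in> ball a (d/2)" for x
      proof -
        have nx: "d / 2 \<le> 1/4 - norm x"
          using x norm_triangle_ineq2[of x a] by (simp add: d_def dist_norm norm_minus_commute)
        have "(d/2) ^ N * norm (F x) powr p \<le> h x"
          unfolding h_def using nx d by (intro mult_right_mono power_mono) auto
        also have "\<dots> \<le> h a" using nx d by (intro amax) auto
        also have "h a = (d/2) ^ N * (2 ^ N * Y powr p)" 
          by (simp add: h_def d_def Y_def power_divide)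
        finally have "norm (F x) powr p \<le> 2 ^ N * Y powr p" using d by simp
        also have "\<dots> = (K * Y) powr p"
          using p Y by (simp add: K_def powr_mult powr_powr powr_realpow)
        finally show ?thesis using p K1 Y powr_less_mono2[of p "K * Y" "norm (F x)"] by fastforce
      qed
      define R where "R = d / (8 * K)"
      have R: "0 < R" "R \<le> d / 2" using d K1 by (auto simp: R_def field_simps)
      have d4: "ball a (d/2) \<subseteq> ball 0 (1/4)"
      proof
        fix x assume "x \<in> ball a (d/2)"
        then show "x \<in> ball 0 (1/4)"
          using norm_triangle_ineq2[of x a] d by (simp add: d_def dist_norm norm_minus_commute)
      qed
      define y where "y = (Y / 2) powr p"
      have "y \<le> norm (F x) powr p" if x: "x \<in> ball a R" for x
      proof -
        have "norm (F x - F a) \<le> 2 * (K * Y) / (d/2) * norm (x - a)"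
        proof (rule mv_holomorphic_lipschitz)
          show "mv_holomorphic_on F (ball a (d/2))"
            using d4 by (intro mv_holomorphic_on_subset[OF F]) force
        qed (use d x R le in auto)
        also have "\<dots> \<le> 2 * (K * Y) / (d/2) * R"
          using x d K1 Y by (intro mult_left_mono) (auto simp: dist_norm norm_minus_commute)
        also have "\<dots> = Y / 2" using d K1 by (simp add: R_def)
        finally have "Y / 2 \<le> norm (F x)"
          using norm_triangle_ineq2[of "F a" "F x"] by (simp add: Y_def norm_minus_commute)
        then show ?thesis unfolding y_def using p Y by (intro powr_mono2) auto
      qed
      moreover have "norm (F u) powr p \<le> C * R ^ N * y"
      proof -
        have "(1/8) ^ N * norm (F u) powr p \<le> d ^ N * Y powr p"
          using hu hua by (simp add: h_def d_def Y_def)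
        then have "norm (F u) powr p \<le> 8 ^ N * (d ^ N * Y powr p)"
          by (simp add: power_divide field_simps)
        also have "d ^ N = (8 * K) ^ N * R ^ N"
          unfolding power_mult_distrib[symmetric] using K1 by (simp add: R_def)
        also have "Y powr p = 2 powr p * y"
          using Y by (simp add: y_def powr_divide)
        also have "8 ^ N * ((8 * K) ^ N * R ^ N * (2 powr p * y)) = (8 * (8 * K)) ^ N * 2 powr p * R ^ N * y"
          by (simp only: power_mult_distrib mult_ac)
        also have "\<dots> = C * R ^ N * y" by (simp add: C_def)
        finally show ?thesis .
      qed
      moreover have "ball a R \<subseteq> ball 0 (1/4)" using d4 R subset_ball[of R "d/2" a] by blast
      ultimately show ?thesis using R y_def by (intro exI[of _ a] exI[of _ R] exI[of _ y]) auto
    qed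
  qed
  with C show ?thesis unfolding N_def by blast
qed

section \<open>The weighted measures and the Forelli-Rudin estimate\<close>

lemma continuous_on_herm_inner [continuous_intros]:
  "continuous_on S f \<Longrightarrow> continuous_on S g \<Longrightarrow> continuous_on S (\<lambda>x. herm_inner (f x) (g x))"
  unfolding herm_inner_def by (intro continuous_intros)

lemma borel_measurable_herm_inner [measurable (raw)]:
  "f \<in> borel_measurable M \<Longrightarrow> g \<in> borel_measurable M \<Longrightarrow>
    (\<lambda>x. herm_inner (f x) (g x)) \<in> borel_measurable M"
  by (rule borel_measurable_continuous_Pair) (auto intro!: continuous_intros)

lemma borel_measurable_defect [measurable (raw)]:
  "f \<in> borel_measurable M \<Longrightarrow> (\<lambda>x. defect (f x)) \<in> borel_measurable M"
  unfolding defect_def by measurable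

lemma nn_integral_powr_0:
  assumes "-1 < \<alpha>" "0 \<le> t"
  shows "(\<integral>\<^sup>+y. ennreal (y powr \<alpha>) * indicator {0..t} y \<partial>lborel) = ennreal (t powr (\<alpha> + 1) / (\<alpha> + 1))"
  using assms by (intro nn_integral_has_integral_lebesgue' has_integral_powr_from_0) auto

text \<open>The weight \<open>(1 - |u|)\<^sup>\<alpha>\<close> may be singular on the sphere. Averaging the integral over the
  dilations \<open>u \<mapsto> \<tau> u\<close>, \<open>1 - t \<le> \<tau> \<le> 1\<close>, integrates the weight along rays, where
  it is harmless; what remains is the Lebesgue measure of a slightly larger set.\<close>

lemma nn_integral_radial_weight_le:
  fixes A A' :: "'a::euclidean_space set"
  assumes \<alpha>: "-1 < \<alpha>" and t: "0 < t" "t \<le> 1 / 2"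
    and [measurable]: "A \<in> sets borel" "A' \<in> sets borel"
    and A: "\<And>u. u \<in> A \<Longrightarrow> 1 / 2 \<le> norm u \<and> norm u \<le> 1 \<and> 1 - norm u \<le> t"
    and A': "\<And>u \<tau>. \<tau> *\<^sub>R u \<in> A \<Longrightarrow> 1 - t \<le> \<tau> \<Longrightarrow> \<tau> \<le> 1 \<Longrightarrow> u \<in> A'"
  shows "(\<integral>\<^sup>+u. ennreal ((1 - norm u) powr \<alpha>) * indicator A u \<partial>lborel) \<le>
    ennreal (2 / (\<alpha> + 1) * t powr \<alpha>) * emeasure lborel A'"
proof -
  define g where "g = (\<lambda>u. ennreal ((1 - norm u) powr \<alpha>) * indicator A u)"
  have [measurable]: "g \<in> borel_measurable borel" unfolding g_def by measurable
  define X where "X = (\<integral>\<^sup>+u. g u \<partial>lborel)"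
  have dil: "X \<le> (\<integral>\<^sup>+u. g (\<tau> *\<^sub>R u) \<partial>lborel)" if \<tau>: "1 - t \<le> \<tau>" "\<tau> \<le> 1" for \<tau>
  proof -
    have "0 < \<tau>" using \<tau> t by simp
    then have "X = (\<integral>\<^sup>+u. g u \<partial>density (distr lborel borel (\<lambda>x. 0 + \<tau> *\<^sub>R x)) (\<lambda>_. ennreal (\<bar>\<tau>\<bar> ^ DIM('a))))"
      unfolding X_def using lborel_affine[of \<tau> "0 :: 'a"] by simp
    also have "\<dots> = ennreal (\<bar>\<tau>\<bar> ^ DIM('a)) * (\<integral>\<^sup>+u. g (\<tau> *\<^sub>R u) \<partial>lborel)"
      by (simp add: nn_integral_density nn_integral_cmult nn_integral_distr)
    also have "\<dots> \<le> 1 * (\<integral>\<^sup>+u. g (\<tau> *\<^sub>R u) \<partial>lborel)"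
      using \<tau> \<open>0 < \<tau>\<close> by (intro mult_right_mono) (auto simp: power_le_one)
    finally show ?thesis by simp
  qed
  have "ennreal t * X = (\<integral>\<^sup>+\<tau>. X * indicator {1 - t..1} \<tau> \<partial>lborel)"
    using t by (simp add: nn_integral_cmult mult.commute)
  also have "\<dots> \<le> (\<integral>\<^sup>+\<tau>. (\<integral>\<^sup>+u. g (\<tau> *\<^sub>R u) * indicator {1 - t..1} \<tau> \<partial>lborel) \<partial>lborel)"
    by (intro nn_integral_mono) (auto simp: indicator_def intro!: dil)
  also have "\<dots> = (\<integral>\<^sup>+u. (\<integral>\<^sup>+\<tau>. g (\<tau> *\<^sub>R u) * indicator {1 - t..1} \<tau> \<partial>lborel) \<partial>lborel)"
    by (rule lborel_pair.Fubini') measurable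
  also have "\<dots> \<le> (\<integral>\<^sup>+u. ennreal (2 / (\<alpha> + 1) * t powr (\<alpha> + 1)) * indicator A' u \<partial>lborel)"
  proof (rule nn_integral_mono)
    fix u :: 'a
    define r where "r = norm u"
    show "(\<integral>\<^sup>+\<tau>. g (\<tau> *\<^sub>R u) * indicator {1 - t..1} \<tau> \<partial>lborel) \<le>
        ennreal (2 / (\<alpha> + 1) * t powr (\<alpha> + 1)) * indicator A' u"
    proof (cases "\<exists>\<tau>\<in>{1 - t..1}. \<tau> *\<^sub>R u \<in> A")
      case False
      then have "(\<lambda>\<tau>. g (\<tau> *\<^sub>R u) * indicator {1 - t..1} \<tau>) = (\<lambda>_. 0)"
        by (intro ext) (auto simp: g_def split: split_indicator)
      then show ?thesis by (simp only:) simp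
    next
      case True
      then obtain \<tau>0 where \<tau>0: "1 - t \<le> \<tau>0" "\<tau>0 \<le> 1" "\<tau>0 *\<^sub>R u \<in> A" by auto
      have uA: "u \<in> A'" using A' \<tau>0 by blast
      have "1 / 2 \<le> \<tau>0 * r" using A[OF \<tau>0(3)] \<tau>0 t by (simp add: r_def)
      also have "\<tau>0 * r \<le> 1 * r" using \<tau>0 by (intro mult_right_mono) (auto simp: r_def)
      finally have r: "1 / 2 \<le> r" by simp
      define h where "h = (\<lambda>y. ennreal (y powr \<alpha>) * indicator {0..t} y)"
      have [measurable]: "h \<in> borel_measurable borel" unfolding h_def by measurable
      have le: "g (\<tau> *\<^sub>R u) * indicator {1 - t..1} \<tau> \<le> h (1 + (- r) * \<tau>)" for \<tau>
      proof (cases "\<tau> \<in> {1 - t..1} \<and> \<tau> *\<^sub>R u \<in> A")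
        case True
        then have "norm (\<tau> *\<^sub>R u) = \<tau> * r" using t by (simp add: r_def)
        then show ?thesis using True A[of "\<tau> *\<^sub>R u"] by (auto simp: g_def h_def mult.commute)
      qed (auto simp: g_def)
      have "(\<integral>\<^sup>+\<tau>. g (\<tau> *\<^sub>R u) * indicator {1 - t..1} \<tau> \<partial>lborel) \<le> (\<integral>\<^sup>+\<tau>. h (1 + (- r) * \<tau>) \<partial>lborel)"
        by (intro nn_integral_mono le)
      also have "\<dots> \<le> ennreal 2 * (ennreal \<bar>- r\<bar> * (\<integral>\<^sup>+\<tau>. h (1 + (- r) * \<tau>) \<partial>lborel))"
      proof -
        have "1 * (\<integral>\<^sup>+\<tau>. h (1 + (- r) * \<tau>) \<partial>lborel) \<le> ennreal (2 * \<bar>- r\<bar>) * (\<integral>\<^sup>+\<tau>. h (1 + (- r) * \<tau>) \<partial>lborel)"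
          using r by (intro mult_right_mono) (auto simp: ennreal_1[symmetric] simp del: ennreal_1 intro!: ennreal_leI)
        then show ?thesis by (simp add: ennreal_mult mult.assoc)
      qed
      also have "ennreal \<bar>- r\<bar> * (\<integral>\<^sup>+\<tau>. h (1 + (- r) * \<tau>) \<partial>lborel) = (\<integral>\<^sup>+y. h y \<partial>lborel)"
        using r by (intro nn_integral_real_affine[symmetric]) auto
      also have "\<dots> = ennreal (t powr (\<alpha> + 1) / (\<alpha> + 1))"
        unfolding h_def using \<alpha> t by (intro nn_integral_powr_0) auto
      also have "ennreal 2 * \<dots> = ennreal (2 / (\<alpha> + 1) * t powr (\<alpha> + 1))"
        using \<alpha> by (subst ennreal_mult[symmetric]) auto
      finally show ?thesis using uA by simp
    qed
  qed
  also have "\<dots> = ennreal (2 / (\<alpha> + 1) * t powr (\<alpha> + 1)) * emeasure lborel A'"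
    by (simp add: nn_integral_cmult)
  also have "t powr (\<alpha> + 1) = t * t powr \<alpha>" using t by (simp add: powr_add)
  also have "2 / (\<alpha> + 1) * (t * t powr \<alpha>) = t * (2 / (\<alpha> + 1) * t powr \<alpha>)" by simp
  also have "ennreal (t * (2 / (\<alpha> + 1) * t powr \<alpha>)) * emeasure lborel A' =
      ennreal t * (ennreal (2 / (\<alpha> + 1) * t powr \<alpha>) * emeasure lborel A')"
    using t by (subst ennreal_mult') (simp_all add: mult.assoc)
  finally show ?thesis
    using t unfolding X_def g_def by (subst (asm) ennreal_mult_le_mult_iff) auto
qed

lemma defect_powr_le:
  assumes "u \<in> unit_ball"
  shows "defect u powr \<alpha> \<le> 2 powr \<bar>\<alpha>\<bar> * (1 - norm u) powr \<alpha>"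
proof -
  have "defect u = (1 + norm u) * (1 - norm u)"
    by (simp add: defect_def power2_eq_square algebra_simps)
  then have "defect u powr \<alpha> = (1 + norm u) powr \<alpha> * (1 - norm u) powr \<alpha>"
    using assms by (simp add: powr_mult)
  also have "(1 + norm u) powr \<alpha> \<le> (1 + norm u) powr \<bar>\<alpha>\<bar>"
    by (intro powr_mono) auto
  also have "\<dots> \<le> 2 powr \<bar>\<alpha>\<bar>" using assms by (intro powr_mono2) auto
  finally show ?thesis by (simp add: mult_right_mono)
qed

lemma nn_integral_defect_powr_le:
  fixes A A' :: "(complex ^ 'n) set"
  assumes \<alpha>: "-1 < \<alpha>" and t: "0 < t" "t \<le> 1 / 2"
    and [measurable]: "A \<in> sets borel" "A' \<in> sets borel"
    and A: "\<And>u. u \<in> A \<Longrightarrow> 1 / 2 \<le> norm u \<and> norm u < 1 \<and> 1 - norm u \<le> t"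
    and A': "\<And>u \<tau>. \<tau> *\<^sub>R u \<in> A \<Longrightarrow> 1 - t \<le> \<tau> \<Longrightarrow> \<tau> \<le> 1 \<Longrightarrow> u \<in> A'"
  shows "(\<integral>\<^sup>+u. ennreal (defect u powr \<alpha>) * indicator A u \<partial>lborel) \<le>
    ennreal (2 powr \<bar>\<alpha>\<bar> * 2 / (\<alpha> + 1) * t powr \<alpha>) * emeasure lborel A'"
proof -
  have "(\<integral>\<^sup>+u. ennreal (defect u powr \<alpha>) * indicator A u \<partial>lborel) \<le>
      (\<integral>\<^sup>+u. ennreal (2 powr \<bar>\<alpha>\<bar>) * (ennreal ((1 - norm u) powr \<alpha>) * indicator A u) \<partial>lborel)"
  proof (rule nn_integral_mono)
    fix u
    show "ennreal (defect u powr \<alpha>) * indicator A u \<le>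
        ennreal (2 powr \<bar>\<alpha>\<bar>) * (ennreal ((1 - norm u) powr \<alpha>) * indicator A u)"
      using A[of u] defect_powr_le[of u \<alpha>]
      by (auto simp: indicator_def simp flip: ennreal_mult intro!: ennreal_leI)
  qed
  also have "\<dots> = ennreal (2 powr \<bar>\<alpha>\<bar>) * (\<integral>\<^sup>+u. (ennreal ((1 - norm u) powr \<alpha>) * indicator A u) \<partial>lborel)"
    by (rule nn_integral_cmult) measurable
  also have "\<dots> \<le> ennreal (2 powr \<bar>\<alpha>\<bar>) * (ennreal (2 / (\<alpha> + 1) * t powr \<alpha>) * emeasure lborel A')"
    by (intro mult_left_mono nn_integral_radial_weight_le[OF \<alpha> t _ _ _ A']) (use A in \<open>auto simp: less_imp_le\<close>)
  also have "\<dots> = ennreal (2 powr \<bar>\<alpha>\<bar> * (2 / (\<alpha> + 1) * t powr \<alpha>)) * emeasure lborel A'"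
    by (subst ennreal_mult') (simp_all add: mult.assoc)
  finally show ?thesis by (simp add: mult.assoc)
qed

lemma nn_integral_defect_powr_finite:
  fixes \<alpha> :: real
  assumes \<alpha>: "-1 < \<alpha>"
  shows "(\<integral>\<^sup>+u. ennreal (defect u powr \<alpha>) * indicator unit_ball u \<partial>(lborel :: (complex ^ 'n) measure)) < \<infinity>"
proof -
  let ?l = "lborel :: (complex ^ 'n) measure"
  define A :: "(complex ^ 'n) set" where "A = {u. 1 / 2 \<le> norm u \<and> norm u < 1}"
  have A[measurable]: "A \<in> sets borel" unfolding A_def by measurable
  have [measurable]: "ball (0 :: complex ^ 'n) (1/2) \<in> sets borel" by simp
  have 1: "(\<integral>\<^sup>+u. ennreal (defect u powr \<alpha>) * indicator A u \<partial>?l) < \<infinity>"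
  proof -
    have "(\<integral>\<^sup>+u. ennreal (defect u powr \<alpha>) * indicator A u \<partial>?l) \<le>
      ennreal (2 powr \<bar>\<alpha>\<bar> * 2 / (\<alpha> + 1) * (1 / 2) powr \<alpha>) * emeasure ?l (cball 0 2)"
    proof (rule nn_integral_defect_powr_le[OF \<alpha> _ _ A])
      fix u :: "complex ^ 'n" and \<tau> :: real assume u: "\<tau> *\<^sub>R u \<in> A" "1 - 1 / 2 \<le> \<tau>" "\<tau> \<le> 1"
      then have "1 / 2 * norm u \<le> \<tau> * norm u" by (intro mult_right_mono) auto
      then show "u \<in> cball 0 2" using u by (simp add: A_def)
    qed (auto simp: A_def)
    also have "\<dots> < \<infinity>"
      using emeasure_lborel_cball_finite[of "0 :: complex ^ 'n" 2] by (simp add: ennreal_mult_less_top)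
    finally show ?thesis .
  qed
  have "(\<integral>\<^sup>+u. ennreal (defect u powr \<alpha>) * indicator (ball 0 (1/2)) u \<partial>?l) \<le>
      (\<integral>\<^sup>+u. ennreal (1 + (3/4) powr \<alpha>) * indicator (ball 0 (1/2)) u \<partial>?l)"
  proof (intro nn_integral_mono)
    fix u :: "complex ^ 'n"
    have "defect u powr \<alpha> \<le> 1 + (3/4) powr \<alpha>" if "norm u < 1 / 2"
    proof -
      have "(norm u)\<^sup>2 \<le> (1/2)\<^sup>2" using that by (intro power_mono) auto
      then have d: "3 / 4 \<le> defect u" by (simp add: defect_def power2_eq_square)
      show ?thesis
      proof (cases "\<alpha> \<ge> 0")
        case True
        then have "defect u powr \<alpha> \<le> 1" using d defect_le_1[of u] by (intro powr_le1) auto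
        then show ?thesis using powr_ge_zero[of "3/4" \<alpha>] by linarith
      next
        case False
        then have "defect u powr \<alpha> \<le> (3/4) powr \<alpha>" using d by (intro powr_mono2') auto
        then show ?thesis by simp
      qed
    qed
    then show "ennreal (defect u powr \<alpha>) * indicator (ball 0 (1/2)) u \<le>
        ennreal (1 + (3/4) powr \<alpha>) * indicator (ball 0 (1/2)) u"
      by (auto simp: indicator_def simp del: ennreal_plus intro!: ennreal_leI)
  qed
  also have "\<dots> < \<infinity>"
    using emeasure_lborel_ball_finite[of "0 :: complex ^ 'n" "1/2"]
    by (subst nn_integral_cmult_indicator) (auto simp: ennreal_mult_less_top simp del: ennreal_plus)
  finally have 2: "(\<integral>\<^sup>+u. ennreal (defect u powr \<alpha>) * indicator (ball 0 (1/2)) u \<partial>?l) < \<infinity>" .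
  have "(\<integral>\<^sup>+u. ennreal (defect u powr \<alpha>) * indicator unit_ball u \<partial>?l) =
      (\<integral>\<^sup>+u. ennreal (defect u powr \<alpha>) * indicator A u + ennreal (defect u powr \<alpha>) * indicator (ball 0 (1/2)) u \<partial>?l)"
    by (intro nn_integral_cong) (auto simp: A_def indicator_def)
  also have "\<dots> = (\<integral>\<^sup>+u. ennreal (defect u powr \<alpha>) * indicator A u \<partial>?l) +
      (\<integral>\<^sup>+u. ennreal (defect u powr \<alpha>) * indicator (ball 0 (1/2)) u \<partial>?l)"
    by (rule nn_integral_add) measurable
  finally show ?thesis using 1 2 by simp
qed

text \<open>All estimates are up to constants, so the normalizations of \<open>\<nu>\<close> and \<open>\<nu>\<^sub>\<alpha>\<close> may be dropped.
  Their product is a positive finite factor because \<open>(1 - |z|\<^sup>2)\<^sup>\<alpha>\<close> has a finite nonzero integral;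
  otherwise \<^const>\<open>c_const\<close> would be \<open>0\<close>.\<close>

lemma nn_integral_nu_w:
  assumes \<alpha>: "-1 < \<alpha>"
  shows "\<exists>k>0. \<forall>h :: complex ^ 'n \<Rightarrow> ennreal. h \<in> borel_measurable ball_borel \<longrightarrow>
    (\<integral>\<^sup>+z. h z \<partial>nu_w \<alpha>) =
      ennreal k * (\<integral>\<^sup>+z. h z * (ennreal (defect z powr \<alpha>) * indicator unit_ball z) \<partial>lborel)"
proof -
  let ?l = "lborel :: (complex ^ 'n) measure"
  let ?lb = "restrict_space ?l unit_ball"
  have sets_lb: "sets ?lb = sets ball_borel"
    by (simp add: ball_borel_def sets_restrict_space)
  have sets_nu: "sets (nu :: (complex ^ 'n) measure) = sets ball_borel"
    by (simp add: nu_def uniform_measure_def sets_lb)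
  note [measurable_cong] = sets_lb sets_nu
  have id: "(\<lambda>x. x) \<in> borel_measurable ball_borel"
    unfolding ball_borel_def by (rule measurable_restrict_space1) simp
  note [measurable] = borel_measurable_defect[OF id]
  have space_lb: "space ?lb = unit_ball" by (simp add: space_restrict_space)
  define V where "V = unit_ball_vol (real (DIM(complex ^ 'n)))"
  have V: "0 < V" by (simp add: V_def unit_ball_vol_pos)
  have eV: "emeasure ?lb unit_ball = ennreal V"
    by (subst emeasure_restrict_space) (auto simp: emeasure_ball V_def)
  have nu: "(\<integral>\<^sup>+z. h z \<partial>nu) = ennreal (1 / V) * (\<integral>\<^sup>+z. h z \<partial>?lb)"
    if [measurable]: "h \<in> borel_measurable ball_borel" for h :: "complex ^ 'n \<Rightarrow> ennreal"
  proof -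
    have "unit_ball \<in> sets ?lb" using sets.top[of ?lb] by (simp add: space_lb)
    moreover have "h \<in> borel_measurable ?lb" by measurable
    ultimately have "(\<integral>\<^sup>+z. h z \<partial>nu) = (\<integral>\<^sup>+z. h z * indicator unit_ball z \<partial>?lb) / emeasure ?lb unit_ball"
      unfolding nu_def by (intro nn_integral_uniform_measure)
    also have "(\<integral>\<^sup>+z. h z * indicator unit_ball z \<partial>?lb) = (\<integral>\<^sup>+z. h z \<partial>?lb)"
      by (intro nn_integral_cong) (simp add: space_lb)
    finally show ?thesis unfolding eV using V
      by (simp add: divide_ennreal_def inverse_ennreal mult.commute divide_inverse)
  qed
  define I where "I = enn2real (\<integral>\<^sup>+z. ennreal (defect z powr \<alpha>) \<partial>?lb)"
  have fin: "(\<integral>\<^sup>+z. ennreal (defect z powr \<alpha>) \<partial>?lb) < \<infinity>"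
    using nn_integral_defect_powr_finite[OF \<alpha>] by (simp add: nn_integral_restrict_space)
  have "(\<integral>\<^sup>+z. ennreal (defect z powr \<alpha>) \<partial>?lb) \<noteq> 0"
  proof
    assume "(\<integral>\<^sup>+z. ennreal (defect z powr \<alpha>) \<partial>?lb) = 0"
    then have "AE z in ?lb. ennreal (defect z powr \<alpha>) = 0"
      by (subst (asm) nn_integral_0_iff_AE) (auto, measurable)
    then have "AE z in ?lb. False"
    proof (rule AE_mp, intro AE_I2 impI)
      fix z assume "z \<in> space ?lb" "ennreal (defect z powr \<alpha>) = 0"
      then show False using defect_pos[of z] by (simp add: space_lb)
    qed
    then have "emeasure ?lb {z \<in> space ?lb. True} = 0" by (intro emeasure_eq_0_AE) simp
    moreover have "{z \<in> space ?lb. True} = space ?lb" by blast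
    ultimately have "emeasure ?lb (space ?lb) = 0" by (simp only:)
    then show False using eV V by (simp add: space_lb)
  qed
  then have I: "0 < I" using fin by (simp add: I_def enn2real_positive_iff zero_less_iff_neq_zero)
  have "(\<integral>z. (1 - (norm z)\<^sup>2) powr \<alpha> \<partial>(nu :: (complex ^ 'n) measure)) =
      enn2real (\<integral>\<^sup>+z. ennreal (defect z powr \<alpha>) \<partial>(nu :: (complex ^ 'n) measure))"
    unfolding defect_def[symmetric] by (rule integral_eq_nn_integral) measurable
  also have "\<dots> = I / V" using V unfolding I_def by (subst nu) (auto simp: enn2real_mult)
  finally have c: "c_const TYPE('n) \<alpha> = V / I" by (simp add: c_const_def)
  show ?thesis
  proof (intro exI[of _ "1 / I"] conjI allI impI)
    fix h :: "complex ^ 'n \<Rightarrow> ennreal" assume [measurable]: "h \<in> borel_measurable ball_borel"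
    have "(\<integral>\<^sup>+z. h z \<partial>nu_w \<alpha>) = (\<integral>\<^sup>+z. ennreal (V / I * defect z powr \<alpha>) * h z \<partial>nu)"
      unfolding nu_w_def c defect_def[symmetric] by (rule nn_integral_density) measurable
    also have "\<dots> = (\<integral>\<^sup>+z. ennreal (V / I) * (h z * ennreal (defect z powr \<alpha>)) \<partial>nu)"
    proof (rule nn_integral_cong)
      fix z :: "complex ^ 'n"
      have "ennreal (V / I * defect z powr \<alpha>) = ennreal (V / I) * ennreal (defect z powr \<alpha>)"
        using V I by (intro ennreal_mult) auto
      then show "ennreal (V / I * defect z powr \<alpha>) * h z =
          ennreal (V / I) * (h z * ennreal (defect z powr \<alpha>))" by (simp only: mult_ac)
    qed
    also have "\<dots> = ennreal (V / I) * (\<integral>\<^sup>+z. (h z * ennreal (defect z powr \<alpha>)) \<partial>nu)"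
      by (rule nn_integral_cmult) measurable
    also have "\<dots> = ennreal (V / I) * (ennreal (1 / V) * (\<integral>\<^sup>+z. (h z * ennreal (defect z powr \<alpha>)) \<partial>?lb))"
      by (subst nu) auto
    also have "\<dots> = ennreal (V / I * (1 / V)) * (\<integral>\<^sup>+z. (h z * ennreal (defect z powr \<alpha>)) \<partial>?lb)"
      using V I by (subst ennreal_mult) (auto simp: mult.assoc)
    also have "V / I * (1 / V) = 1 / I" using V by simp
    also have "(\<integral>\<^sup>+z. (h z * ennreal (defect z powr \<alpha>)) \<partial>?lb) =
        (\<integral>\<^sup>+z. h z * (ennreal (defect z powr \<alpha>) * indicator unit_ball z) \<partial>lborel)"
      by (subst nn_integral_restrict_space) (auto simp: mult.assoc)
    finally show "(\<integral>\<^sup>+z. h z \<partial>nu_w \<alpha>) =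
      ennreal (1 / I) * (\<integral>\<^sup>+z. h z * (ennreal (defect z powr \<alpha>) * indicator unit_ball z) \<partial>lborel)" .
  qed (use I in simp)
qed

lemma unit_ball_borel [measurable]: "unit_ball \<in> sets borel"
  by simp

lemma norm_proj_span_unit:
  assumes "norm e = 1"
  shows "norm (proj_span e u) = norm (herm_inner u e)" "norm (proj_span e u - e) = norm (1 - herm_inner u e)"
proof -
  have P: "proj_span e u = herm_inner u e *s e"
    using assms by (simp add: proj_span_def herm_inner_self)
  show "norm (proj_span e u) = norm (herm_inner u e)" using assms by (simp add: P norm_smult_vec)
  have "proj_span e u - e = (herm_inner u e - 1) *s e" by (simp add: P vec_eq_iff algebra_simps)
  then have "norm (proj_span e u - e) = norm (herm_inner u e - 1)"
    using assms by (simp only: norm_smult_vec)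
  then show "norm (proj_span e u - e) = norm (1 - herm_inner u e)"
    by (simp only: norm_minus_commute)
qed

text \<open>When \<open>a\<close> is within \<open>t\<close> of the sphere, such a slab has extent \<open>O(t)\<close> along \<open>a\<close> and, lying in a
  ball that exceeds the unit ball by \<open>O(t)\<close>, extent \<open>O(\<surd>t)\<close> in the orthogonal directions.\<close>

lemma emeasure_slab_le:
  fixes a :: "complex ^ 'n"
  assumes a: "3 / 4 \<le> norm a" "norm a < 1" and t: "0 < t" "t \<le> 1 / 4" "1 - norm a \<le> t"
  shows "emeasure lborel {u. norm u \<le> 1 / (1 - t) \<and> norm (1 - herm_inner u a) \<le> 3 * t} \<le>
    ennreal (t ^ (CARD('n) + 1)) * emeasure lborel (cball 0 7 :: (complex ^ 'n) set)"
proof -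
  define e where "e = (1 / norm a) *\<^sub>R a"
  have e: "norm e = 1" using a by (auto simp: e_def)
  have ua: "herm_inner u a = norm a * herm_inner u e" for u
    using a by (auto simp: e_def herm_inner_scaleR_right)
  define X where "X = stretch (1 / t) (sqrt (1 / t)) e -` cball 0 7"
  have X: "X \<in> sets borel" unfolding X_def by (rule vimage_stretch_borel) simp
  have "emeasure lborel (cball 0 7 :: (complex ^ 'n) set) = ennreal ((1 / t) ^ (CARD('n) + 1)) * emeasure lborel X"
    unfolding X_def using t e by (intro emeasure_lborel_vimage_stretch) auto
  then have "ennreal (t ^ (CARD('n) + 1)) * emeasure lborel (cball 0 7 :: (complex ^ 'n) set) =
      ennreal (t ^ (CARD('n) + 1) * (1 / t) ^ (CARD('n) + 1)) * emeasure lborel X"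
    using t by (simp only: ennreal_mult zero_le_power zero_le_divide_1_iff less_imp_le mult.assoc)
  also have "t ^ (CARD('n) + 1) * (1 / t) ^ (CARD('n) + 1) = 1"
    using t unfolding power_mult_distrib[symmetric] by simp
  also have "ennreal 1 * emeasure lborel X = emeasure (distr lborel borel (\<lambda>x. - e + x)) X"
    unfolding lborel_distr_plus by simp
  also have "\<dots> = emeasure lborel ((\<lambda>x. - e + x) -` X)"
    using X by (subst emeasure_distr) auto
  finally have *: "emeasure lborel ((\<lambda>x. - e + x) -` X) =
    ennreal (t ^ (CARD('n) + 1)) * emeasure lborel (cball 0 7 :: (complex ^ 'n) set)" by simp
  have "{u. norm u \<le> 1 / (1 - t) \<and> norm (1 - herm_inner u a) \<le> 3 * t} \<subseteq> (\<lambda>x. - e + x) -` X"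
  proof
    fix u assume u: "u \<in> {u. norm u \<le> 1 / (1 - t) \<and> norm (1 - herm_inner u a) \<le> 3 * t}"
    define h where "h = norm (herm_inner u e)"
    have "1 / (1 - t) \<le> 4 / 3" using t by (simp add: field_simps)
    then have u43: "norm u \<le> 4 / 3" using u by simp
    then have h: "h \<le> 4 / 3" using norm_herm_inner_le[of u e] e by (simp add: h_def)
    have "norm (1 - herm_inner u e) \<le> norm (1 - herm_inner u a) + norm (herm_inner u a - herm_inner u e)"
      using norm_triangle_ineq[of "1 - herm_inner u a" "herm_inner u a - herm_inner u e"] by simp
    also have "herm_inner u a - herm_inner u e = of_real (norm a - 1) * herm_inner u e"
      by (simp add: ua algebra_simps)
    also have "norm \<dots> = (1 - norm a) * h" using a by (simp only: norm_mult norm_of_real h_def) simp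
    also have "\<dots> \<le> t * (4 / 3)" using t a h by (intro mult_mono) (auto simp: h_def)
    finally have P: "norm (1 - herm_inner u e) \<le> 5 * t" using u t by simp
    have "1 - 5 * t \<le> h"
      using P norm_triangle_ineq2[of 1 "1 - herm_inner u e"] by (simp add: h_def)
    then have "1 - 10 * t \<le> 2 * h - 1" by simp
    also have "\<dots> \<le> h\<^sup>2" using zero_le_power2[of "h - 1"] by (simp add: power2_eq_square algebra_simps)
    finally have h2: "1 - 10 * t \<le> h\<^sup>2" .
    have "(norm u)\<^sup>2 \<le> (1 / (1 - t))\<^sup>2" using u by (intro power_mono) auto
    also have "\<dots> \<le> 1 + 4 * t"
    proof -
      have "0 \<le> t * (2 - 7 * t + 4 * t * t)" using t by (intro mult_nonneg_nonneg) auto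
      then have "1 \<le> (1 + 4 * t) * (1 - t)\<^sup>2" by (simp add: power2_eq_square algebra_simps)
      then show ?thesis using t by (simp add: power_divide divide_le_eq)
    qed
    finally have "(norm (u - proj_span e u))\<^sup>2 \<le> 14 * t"
      using norm_proj_span_sq[of u e] h2 by (simp add: norm_proj_span_unit[OF e] h_def)
    moreover have "proj_span e (u - e) = proj_span e u - e"
      using proj_span_linear[of e] by (simp add: linear_diff)
    ultimately have "(norm (stretch (1 / t) (sqrt (1 / t)) e (u - e)))\<^sup>2 \<le> (1 / t)\<^sup>2 * (5 * t)\<^sup>2 + (1 / t) * (14 * t)"
      using t P unfolding norm_stretch_sq
      by (intro add_mono mult_mono power_mono) (auto simp: norm_proj_span_unit[OF e])
    also have "\<dots> \<le> 7\<^sup>2" using t by (simp add: power2_eq_square)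
    finally have "norm (stretch (1 / t) (sqrt (1 / t)) e (u - e)) \<le> 7" by (rule power2_le_imp_le) simp
    then show "u \<in> (\<lambda>x. - e + x) -` X" by (simp add: X_def)
  qed
  moreover have "(\<lambda>x. - e + x) -` X \<in> sets borel"
    using measurable_sets[OF _ X, of "\<lambda>x. - e + x" borel]
    unfolding space_borel Int_UNIV_right by measurable
  ultimately show ?thesis using emeasure_mono[of _ "(\<lambda>x. - e + x) -` X" lborel] * by simp
qed

text \<open>For small \<open>t\<close>, dilating by \<open>\<tau> \<ge> 1 - t\<close> moves the slab into one of comparable thickness, whose
  volume is \<open>O(t\<^bsup>n + 1\<^esup>)\<close>; the averaged weight contributes \<open>O(t\<^sup>\<alpha>)\<close>. For \<open>t\<close> bounded below the total
  mass is enough.\<close>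

lemma nn_integral_defect_powr_slab:
  fixes \<alpha> :: real
  assumes \<alpha>: "-1 < \<alpha>"
  shows "\<exists>C>0. \<forall>(a :: complex ^ 'n)\<in>unit_ball. \<forall>t>0.
    (\<integral>\<^sup>+u. ennreal (defect u powr \<alpha>) * indicator {u\<in>unit_ball. norm (1 - herm_inner u a) \<le> t} u \<partial>lborel)
      \<le> ennreal (C * t powr (CARD('n) + 1 + \<alpha>))"
proof -
  let ?l = "lborel :: (complex ^ 'n) measure"
  define I where "I = enn2real (\<integral>\<^sup>+u. ennreal (defect u powr \<alpha>) * indicator unit_ball u \<partial>?l)"
  have I: "(\<integral>\<^sup>+u. ennreal (defect u powr \<alpha>) * indicator unit_ball u \<partial>?l) = ennreal I" "0 \<le> I"
    using nn_integral_defect_powr_finite[OF \<alpha>, where 'n = 'n] unfolding I_def by simp_all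
  define V where "V = unit_ball_vol (real (DIM(complex ^ 'n))) * 7 ^ DIM(complex ^ 'n)"
  have V: "0 < V" by (simp add: V_def unit_ball_vol_pos)
  define c where "c = 2 powr \<bar>\<alpha>\<bar> * 2 / (\<alpha> + 1) * V"
  have c: "0 < c" using \<alpha> V by (simp add: c_def)
  define \<gamma> where "\<gamma> = CARD('n) + 1 + \<alpha>"
  have \<gamma>: "0 < \<gamma>" using \<alpha> by (simp add: \<gamma>_def)
  define C where "C = c + I * 4 powr \<gamma>"
  have C: "c \<le> C" "I * 4 powr \<gamma> \<le> C" "0 < C" using c I(2) by (auto simp: C_def intro!: add_pos_nonneg)
  have "(\<integral>\<^sup>+u. ennreal (defect u powr \<alpha>) * indicator {u\<in>unit_ball. norm (1 - herm_inner u a) \<le> t} u \<partial>?l)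
      \<le> ennreal (C * t powr \<gamma>)" if a: "a \<in> unit_ball" and t: "0 < t" for a :: "complex ^ 'n" and t
  proof -
    define A where "A = {u\<in>unit_ball. norm (1 - herm_inner u a) \<le> t}"
    have A[measurable]: "A \<in> sets borel" unfolding A_def by measurable
    have "(\<integral>\<^sup>+u. ennreal (defect u powr \<alpha>) * indicator A u \<partial>?l) \<le> ennreal (C * t powr \<gamma>)"
    proof (cases "t \<le> 1 / 4")
      case False
      have "(\<integral>\<^sup>+u. ennreal (defect u powr \<alpha>) * indicator A u \<partial>?l) \<le>
          (\<integral>\<^sup>+u. ennreal (defect u powr \<alpha>) * indicator unit_ball u \<partial>?l)"
        by (intro nn_integral_mono) (auto simp: A_def indicator_def)
      also have "\<dots> \<le> ennreal (I * (4 * t) powr \<gamma>)"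
        unfolding I(1) using I(2) False \<gamma> 
        by (intro ennreal_leI) (auto intro!: mult_left_le_one_le simp: mult_le_cancel_left1 ge_one_powr_ge_zero)
      also have "\<dots> \<le> ennreal (C * t powr \<gamma>)"
        using C t by (intro ennreal_leI) (simp add: powr_mult mult.assoc[symmetric] mult_right_mono)
      finally show ?thesis .
    next
      case True
      show ?thesis
      proof (cases "A = {}")
        case False
        then obtain u0 where u0: "u0 \<in> A" by blast
        have A1: "1 - norm u \<le> t" "1 - norm a \<le> t" if "u \<in> A" for u
          using that a norm_one_minus_herm_inner_ge[of u a] by (auto simp: A_def)
        define A' where "A' = {u :: complex ^ 'n. norm u \<le> 1 / (1 - t) \<and> norm (1 - herm_inner u a) \<le> 3 * t}"
        have A'[measurable]: "A' \<in> sets borel" unfolding A'_def by measurable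
        have "(\<integral>\<^sup>+u. ennreal (defect u powr \<alpha>) * indicator A u \<partial>?l) \<le>
            ennreal (2 powr \<bar>\<alpha>\<bar> * 2 / (\<alpha> + 1) * t powr \<alpha>) * emeasure lborel A'"
        proof (rule nn_integral_defect_powr_le[OF \<alpha> t _ A A'])
          fix u :: "complex ^ 'n" and \<tau> :: real
          assume u: "\<tau> *\<^sub>R u \<in> A" "1 - t \<le> \<tau>" "\<tau> \<le> 1"
          have \<tau>: "0 < \<tau>" using u True by simp
          have "(1 - t) * norm u \<le> \<tau> * norm u" using u by (intro mult_right_mono) auto
          also have "\<dots> \<le> 1" using u \<tau> by (simp add: A_def)
          finally have nu: "norm u \<le> 1 / (1 - t)" using True by (simp add: field_simps)
          moreover have "1 / (1 - t) \<le> 4 / 3" using True by (simp add: field_simps)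
          ultimately have u43: "norm u \<le> 4 / 3" by simp
          have "norm (1 - herm_inner u a) \<le> norm (1 - herm_inner (\<tau> *\<^sub>R u) a) +
              norm (herm_inner (\<tau> *\<^sub>R u) a - herm_inner u a)"
            using norm_triangle_ineq[of "1 - herm_inner (\<tau> *\<^sub>R u) a" "herm_inner (\<tau> *\<^sub>R u) a - herm_inner u a"] by simp
          also have "herm_inner (\<tau> *\<^sub>R u) a - herm_inner u a = of_real (\<tau> - 1) * herm_inner u a"
            by (simp add: herm_inner_scaleR_left algebra_simps)
          also have "norm \<dots> = (1 - \<tau>) * norm (herm_inner u a)"
            using u by (simp only: norm_mult norm_of_real) simp
          also have "\<dots> \<le> t * (4 / 3 * 1)"
          proof (intro mult_mono order_trans[OF norm_herm_inner_le])
            show "norm u \<le> 4 / 3" by fact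
          qed (use u a in auto)
          finally have "norm (1 - herm_inner u a) \<le> 3 * t" using u t by (simp add: A_def)
          then show "u \<in> A'" using nu by (simp add: A'_def)
        next
          fix u assume "u \<in> A"
          then show "1 / 2 \<le> norm u \<and> norm u < 1 \<and> 1 - norm u \<le> t" using A1 True by (force simp: A_def)
        qed (use True in auto)
        also have "\<dots> \<le> ennreal (2 powr \<bar>\<alpha>\<bar> * 2 / (\<alpha> + 1) * t powr \<alpha>) *
            (ennreal (t ^ (CARD('n) + 1)) * emeasure lborel (cball 0 7 :: (complex ^ 'n) set))"
          unfolding A'_def using a t True A1[OF u0]
          by (intro mult_left_mono emeasure_slab_le) auto
        also have "emeasure lborel (cball 0 7 :: (complex ^ 'n) set) = ennreal V"
          by (simp add: emeasure_cball V_def)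
        also have "ennreal (2 powr \<bar>\<alpha>\<bar> * 2 / (\<alpha> + 1) * t powr \<alpha>) * (ennreal (t ^ (CARD('n) + 1)) * ennreal V)
            = ennreal (2 powr \<bar>\<alpha>\<bar> * 2 / (\<alpha> + 1) * t powr \<alpha> * (t ^ (CARD('n) + 1) * V))"
          using t V \<alpha> by (simp only: ennreal_mult[symmetric] mult_nonneg_nonneg zero_le_power less_imp_le
              powr_ge_zero divide_nonneg_pos zero_le_numeral)
        also have "2 powr \<bar>\<alpha>\<bar> * 2 / (\<alpha> + 1) * t powr \<alpha> * (t ^ (CARD('n) + 1) * V) = c * t powr \<gamma>"
        proof -
          have "t powr \<gamma> = t ^ (CARD('n) + 1) * t powr \<alpha>"
            unfolding \<gamma>_def powr_add using powr_realpow[OF t, of "CARD('n) + 1"] by (simp add: powr_add)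
          then show ?thesis by (simp add: c_def)
        qed
        also have "ennreal (c * t powr \<gamma>) \<le> ennreal (C * t powr \<gamma>)"
          using C by (intro ennreal_leI mult_right_mono) auto
        finally show ?thesis .
      qed simp
    qed
    then show ?thesis by (simp add: A_def)
  qed
  then show ?thesis using C unfolding \<gamma>_def by blast
qed

lemma id_ball_borel [measurable]: "(\<lambda>x. x) \<in> borel_measurable ball_borel"
  unfolding ball_borel_def by (rule measurable_restrict_space1) simp

text \<open>The layer cake formula turns the integral into one over the slabs of thickness \<open>t\<close>, and the slabs
  with \<open>t < (1 - |a|\<^sup>2) / 2\<close> are empty. The condition on \<open>b\<close> makes
  \<open>\<integral> t\<^bsup>n + 1 + \<alpha> - b - 1\<^esup> dt\<close> converge at infinity.\<close>

lemma forelli_rudin: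
  fixes \<alpha> b :: real
  assumes \<alpha>: "-1 < \<alpha>" and b: "CARD('n) + 1 + \<alpha> < b"
  shows "\<exists>C>0. \<forall>(a :: complex ^ 'n)\<in>unit_ball.
    (\<integral>\<^sup>+u. ennreal (norm (1 - herm_inner u a) powr (- b)) \<partial>nu_w \<alpha>) \<le>
      ennreal (C * defect a powr (CARD('n) + 1 + \<alpha> - b))"
proof -
  define \<gamma> where "\<gamma> = CARD('n) + 1 + \<alpha>"
  have \<gamma>: "0 < \<gamma>" "\<gamma> < b" using \<alpha> b by (auto simp: \<gamma>_def)
  obtain k where k: "0 < k" "\<And>h :: complex ^ 'n \<Rightarrow> ennreal. h \<in> borel_measurable ball_borel \<Longrightarrow>
    (\<integral>\<^sup>+z. h z \<partial>nu_w \<alpha>) =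
      ennreal k * (\<integral>\<^sup>+z. h z * (ennreal (defect z powr \<alpha>) * indicator unit_ball z) \<partial>lborel)"
    using nn_integral_nu_w[OF \<alpha>] by blast
  obtain C where C: "0 < C" "\<And>(a :: complex ^ 'n) t. a \<in> unit_ball \<Longrightarrow> 0 < t \<Longrightarrow>
    (\<integral>\<^sup>+u. ennreal (defect u powr \<alpha>) * indicator {u\<in>unit_ball. norm (1 - herm_inner u a) \<le> t} u \<partial>lborel)
      \<le> ennreal (C * t powr \<gamma>)"
    using nn_integral_defect_powr_slab[OF \<alpha>, where 'n = 'n] unfolding \<gamma>_def by blast
  define c where "c = k * (b * (C * ((1/2) powr (\<gamma> - b) / (b - \<gamma>))))"
  have c: "0 < c" using k(1) C(1) \<gamma> by (simp add: c_def)
  have "(\<integral>\<^sup>+u. ennreal (norm (1 - herm_inner u a) powr (- b)) \<partial>nu_w \<alpha>) \<le> ennreal (c * defect a powr (\<gamma> - b))"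
    if a: "a \<in> unit_ball" for a :: "complex ^ 'n"
  proof -
    define x where "x = (\<lambda>u :: complex ^ 'n. norm (1 - herm_inner u a))"
    have [measurable]: "x \<in> borel_measurable borel" unfolding x_def by measurable
    define w where "w = (\<lambda>u :: complex ^ 'n. ennreal (defect u powr \<alpha>) * indicator unit_ball u)"
    have [measurable]: "w \<in> borel_measurable borel" unfolding w_def by measurable
    define d where "d = defect a / 2"
    have d: "0 < d" using defect_pos[OF a] by (simp add: d_def)
    have xd: "d \<le> x u" if "u \<in> unit_ball" for u
      using defect_le_norm[OF that a] by (simp add: x_def d_def)
    \<comment> \<open>Layer cake: \<open>x\<^bsup>-b\<^esup>\<close> is \<open>b\<close> times the integral of \<open>t\<^bsup>-b-1\<^esup>\<close> over \<open>t \<ge> x\<close>.\<close>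
    have layer: "ennreal (y powr (- e)) =
        ennreal e * (\<integral>\<^sup>+t. ennreal (t powr (- e - 1)) * indicator {y..} t \<partial>lborel)" if "0 < y" "0 < e" for y e :: real
    proof -
      have "((\<lambda>t. t powr (- e - 1)) has_integral (y powr (- e) / e)) {y..}"
        using has_integral_powr_to_inf[of "- e - 1" y] that by simp
      then have "(\<integral>\<^sup>+t. ennreal (t powr (- e - 1)) * indicator {y..} t \<partial>lborel) = ennreal (y powr (- e) / e)"
        by (intro nn_integral_has_integral_lebesgue') auto
      then show ?thesis using that by (simp flip: ennreal_mult)
    qed
    have "(\<integral>\<^sup>+u. ennreal (x u powr (- b)) \<partial>nu_w \<alpha>) = ennreal k * (\<integral>\<^sup>+u. ennreal (x u powr (- b)) * w u \<partial>lborel)"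
      unfolding w_def x_def by (rule k(2)) measurable
    also have "(\<integral>\<^sup>+u. ennreal (x u powr (- b)) * w u \<partial>lborel) =
        (\<integral>\<^sup>+u. (\<integral>\<^sup>+t. ennreal b * (ennreal (t powr (- b - 1)) * (if x u \<le> t then w u else 0)) \<partial>lborel) \<partial>lborel)"
    proof (rule nn_integral_cong)
      fix u
      show "ennreal (x u powr (- b)) * w u =
        (\<integral>\<^sup>+t. ennreal b * (ennreal (t powr (- b - 1)) * (if x u \<le> t then w u else 0)) \<partial>lborel)"
      proof (cases "u \<in> unit_ball")
        case False
        then have w0: "w u = 0" by (simp add: w_def)
        show ?thesis unfolding w0 by simp
      next
        case True
        have "ennreal (x u powr (- b)) * w u =
            ennreal b * (\<integral>\<^sup>+t. ennreal (t powr (- b - 1)) * indicator {x u..} t \<partial>lborel) * w u"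
          using xd[OF True] d \<gamma> by (subst layer) auto
        also have "\<dots> = ennreal b * (\<integral>\<^sup>+t. ennreal (t powr (- b - 1)) * indicator {x u..} t * w u \<partial>lborel)"
          unfolding mult.assoc by (subst nn_integral_multc[symmetric]) (auto simp: mult.assoc)
        also have "\<dots> = (\<integral>\<^sup>+t. ennreal b * (ennreal (t powr (- b - 1)) * indicator {x u..} t * w u) \<partial>lborel)"
          by (rule nn_integral_cmult[symmetric]) measurable
        also have "\<dots> = (\<integral>\<^sup>+t. ennreal b * (ennreal (t powr (- b - 1)) * (if x u \<le> t then w u else 0)) \<partial>lborel)"
          by (intro nn_integral_cong) (auto simp: indicator_def)
        finally show ?thesis .
      qed
    qed
    also have "\<dots> = (\<integral>\<^sup>+t. (\<integral>\<^sup>+u. ennreal b * (ennreal (t powr (- b - 1)) * (if x u \<le> t then w u else 0)) \<partial>lborel) \<partial>lborel)"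
      by (rule lborel_pair.Fubini') measurable
    also have "\<dots> \<le> (\<integral>\<^sup>+t. ennreal (b * C) * (ennreal (t powr (- (b - \<gamma>) - 1)) * indicator {d..} t) \<partial>lborel)"
    proof (rule nn_integral_mono)
      fix t :: real
      have eq: "(\<integral>\<^sup>+u. ennreal b * (ennreal (t powr (- b - 1)) * (if x u \<le> t then w u else 0)) \<partial>lborel) =
          ennreal b * (ennreal (t powr (- b - 1)) *
            (\<integral>\<^sup>+u. ennreal (defect u powr \<alpha>) * indicator {u\<in>unit_ball. norm (1 - herm_inner u a) \<le> t} u \<partial>lborel))"
      proof -
        have "(\<integral>\<^sup>+u. ennreal b * (ennreal (t powr (- b - 1)) * (if x u \<le> t then w u else 0)) \<partial>lborel) =
          ennreal b * (ennreal (t powr (- b - 1)) * (\<integral>\<^sup>+u. (if x u \<le> t then w u else 0) \<partial>lborel))"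
          by (simp add: nn_integral_cmult)
        also have "(\<integral>\<^sup>+u. (if x u \<le> t then w u else 0) \<partial>lborel) =
           (\<integral>\<^sup>+u. ennreal (defect u powr \<alpha>) * indicator {u\<in>unit_ball. norm (1 - herm_inner u a) \<le> t} u \<partial>lborel)"
          by (intro nn_integral_cong) (auto simp: w_def x_def indicator_def)
        finally show ?thesis .
      qed
      show "(\<integral>\<^sup>+u. ennreal b * (ennreal (t powr (- b - 1)) * (if x u \<le> t then w u else 0)) \<partial>lborel)
          \<le> ennreal (b * C) * (ennreal (t powr (- (b - \<gamma>) - 1)) * indicator {d..} t)"
      proof (cases "d \<le> t")
        case False
        have "(if x u \<le> t then w u else 0) = 0" for u
          using xd[of u] False by (cases "u \<in> unit_ball") (auto simp: w_def)
        then show ?thesis by simp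
      next
        case True
        then have t: "0 < t" using d by simp
        have "(\<integral>\<^sup>+u. ennreal b * (ennreal (t powr (- b - 1)) * (if x u \<le> t then w u else 0)) \<partial>lborel) \<le>
            ennreal b * (ennreal (t powr (- b - 1)) * ennreal (C * t powr \<gamma>))"
          unfolding eq by (intro mult_left_mono C(2)[OF a t]) auto
        also have "\<dots> = ennreal (b * (t powr (- b - 1) * (C * t powr \<gamma>)))"
          using \<gamma> C(1) by (simp add: ennreal_mult)
        also have "b * (t powr (- b - 1) * (C * t powr \<gamma>)) = b * C * t powr (- (b - \<gamma>) - 1)"
        proof -
          have "t powr (- (b - \<gamma>) - 1) = t powr (- b - 1) * t powr \<gamma>"
            unfolding powr_add[symmetric] by (rule arg_cong[where f = "\<lambda>e. t powr e"]) simp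
          then show ?thesis by simp
        qed
        also have "ennreal \<dots> = ennreal (b * C) * (ennreal (t powr (- (b - \<gamma>) - 1)) * indicator {d..} t)"
          using True \<gamma> C(1) by (simp add: ennreal_mult)
        finally show ?thesis .
      qed
    qed
    also have "\<dots> = ennreal (b * C) * (\<integral>\<^sup>+t. ennreal (t powr (- (b - \<gamma>) - 1)) * indicator {d..} t \<partial>lborel)"
      by (rule nn_integral_cmult) measurable
    also have "(\<integral>\<^sup>+t. ennreal (t powr (- (b - \<gamma>) - 1)) * indicator {d..} t \<partial>lborel) =
        ennreal (d powr (- (b - \<gamma>)) / (b - \<gamma>))"
    proof -
      have "ennreal (1 / (b - \<gamma>)) * ennreal (d powr (- (b - \<gamma>))) = ennreal (1 / (b - \<gamma>)) * (ennreal (b - \<gamma>) *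
          (\<integral>\<^sup>+t. ennreal (t powr (- (b - \<gamma>) - 1)) * indicator {d..} t \<partial>lborel))"
        using layer[OF d, of "b - \<gamma>"] \<gamma> by simp
      also have "\<dots> = ennreal (1 / (b - \<gamma>) * (b - \<gamma>)) * (\<integral>\<^sup>+t. ennreal (t powr (- (b - \<gamma>) - 1)) * indicator {d..} t \<partial>lborel)"
        using \<gamma> by (subst ennreal_mult) (auto simp: mult.assoc)
      finally show ?thesis using \<gamma> by (simp flip: ennreal_mult)
    qed
    also have "ennreal (b * C) * ennreal (d powr (- (b - \<gamma>)) / (b - \<gamma>)) =
      ennreal (b * (C * ((1/2) powr (\<gamma> - b) / (b - \<gamma>))) * defect a powr (\<gamma> - b))"
    proof -
      have "d powr (- (b - \<gamma>)) = (1/2) powr (\<gamma> - b) * defect a powr (\<gamma> - b)"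
        using defect_pos[OF a] by (simp add: d_def powr_divide powr_mult powr_minus)
      then show ?thesis using \<gamma> C(1) by (subst ennreal_mult[symmetric]) (auto simp: mult_ac)
    qed
    also have "ennreal k * \<dots> = ennreal (c * defect a powr (\<gamma> - b))"
      using k(1) \<gamma> C(1) unfolding c_def by (subst ennreal_mult[symmetric]) (auto simp: mult_ac)
    finally show ?thesis
      unfolding x_def by (meson mult_left_mono order_trans order_refl zero_le)
  qed
  then show ?thesis using c unfolding \<gamma>_def by blast
qed

section \<open>Local mass and sub-mean value estimates\<close>

text \<open>In this form measurability in both variables is evident.\<close>

lemma bergman_ball_iff:
  assumes "z \<in> unit_ball" "w \<in> unit_ball"
  shows "w \<in> bergman_ball z \<longleftrightarrow> 3 * (norm (1 - herm_inner w z))\<^sup>2 < 4 * (defect z * defect w)"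
proof -
  have "pseudo_hyp_dist z w < 1 / 2 \<longleftrightarrow> (pseudo_hyp_dist z w)\<^sup>2 < (1 / 2)\<^sup>2"
    using power_strict_mono[of "pseudo_hyp_dist z w" "1/2" 2] power2_less_imp_less[of "pseudo_hyp_dist z w" "1/2"]
    by auto
  also have "\<dots> \<longleftrightarrow> 3 / 4 < 1 - (pseudo_hyp_dist z w)\<^sup>2" by (simp add: power2_eq_square)
  also have "\<dots> \<longleftrightarrow> 3 * (norm (1 - herm_inner w z))\<^sup>2 < 4 * (defect z * defect w)"
    unfolding pseudo_hyp_dist_sq[OF assms] using one_minus_herm_inner_nz[OF assms(2,1)]
    by (simp add: less_divide_eq mult.commute[of "defect z * defect w" 4])
  finally show ?thesis using assms by (simp add: bergman_ball_def)
qed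

lemma borel_measurable_indicator_bergman_ball:
  assumes [measurable]: "f \<in> measurable M ball_borel" "g \<in> measurable M ball_borel"
  shows "(\<lambda>x. indicator (bergman_ball (f x)) (g x) :: ennreal) \<in> borel_measurable M"
proof -
  have sp: "f x \<in> unit_ball" "g x \<in> unit_ball" if "x \<in> space M" for x
    using measurable_space[OF assms(1) that] measurable_space[OF assms(2) that]
    by (simp_all add: space_ball_borel)
  have [measurable]: "f \<in> borel_measurable M" "g \<in> borel_measurable M"
    using measurable_compose[OF assms(1) id_ball_borel] measurable_compose[OF assms(2) id_ball_borel]
    by simp_all
  have "(\<lambda>x. indicator (bergman_ball (f x)) (g x) :: ennreal) \<in> borel_measurable M \<longleftrightarrow>
    (\<lambda>x. if 3 * (norm (1 - herm_inner (g x) (f x)))\<^sup>2 < 4 * (defect (f x) * defect (g x)) then 1 else 0 :: ennreal)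
      \<in> borel_measurable M"
    by (rule measurable_cong) (simp add: indicator_def bergman_ball_iff[OF sp])
  also have "\<dots>" by measurable
  finally show ?thesis .
qed

lemma borel_measurable_indicator_bergman_ball' [measurable]:
  "z \<in> unit_ball \<Longrightarrow> (\<lambda>w. indicator (bergman_ball z) w :: ennreal) \<in> borel_measurable ball_borel"
  by (rule borel_measurable_indicator_bergman_ball) (auto simp: space_ball_borel)

lemma mv_holomorphic_borel_measurable [measurable_dest]:
  assumes "mv_holomorphic_on f unit_ball"
  shows "f \<in> borel_measurable ball_borel"
  unfolding ball_borel_def
  by (intro borel_measurable_continuous_on_restrict mv_holomorphic_on_continuous[OF assms]) 

lemma finite_measure_nu_w:
  assumes \<alpha>: "-1 < \<alpha>"
  shows "finite_measure (nu_w \<alpha> :: (complex ^ 'n) measure)"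
proof
  obtain k where k: "0 < k" "\<And>h :: complex ^ 'n \<Rightarrow> ennreal. h \<in> borel_measurable ball_borel \<Longrightarrow>
    (\<integral>\<^sup>+z. h z \<partial>nu_w \<alpha>) =
      ennreal k * (\<integral>\<^sup>+z. h z * (ennreal (defect z powr \<alpha>) * indicator unit_ball z) \<partial>lborel)"
    using nn_integral_nu_w[OF \<alpha>] by blast
  have "emeasure (nu_w \<alpha>) (space (nu_w \<alpha> :: (complex ^ 'n) measure)) = (\<integral>\<^sup>+z. 1 \<partial>(nu_w \<alpha> :: (complex ^ 'n) measure))"
    by simp
  also have "\<dots> < \<infinity>"
    using nn_integral_defect_powr_finite[OF \<alpha>, where 'n = 'n]
    by (subst k(2)) (auto simp: ennreal_mult_less_top)
  finally show "emeasure (nu_w \<alpha>) (space (nu_w \<alpha> :: (complex ^ 'n) measure)) \<noteq> \<infinity>" by simp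
qed

abbreviation bergman_mass :: "real \<Rightarrow> real \<Rightarrow> (complex ^ 'n \<Rightarrow> complex) \<Rightarrow> ennreal" where
  "bergman_mass p \<alpha> f \<equiv> \<integral>\<^sup>+z. ennreal (norm (f z) powr p) \<partial>nu_w \<alpha>"

definition local_mass :: "real \<Rightarrow> real \<Rightarrow> (complex ^ 'n \<Rightarrow> complex) \<Rightarrow> complex ^ 'n \<Rightarrow> ennreal" where
  "local_mass p \<alpha> f z = (\<integral>\<^sup>+w. ennreal (norm (f w) powr p) * indicator (bergman_ball z) w \<partial>nu_w \<alpha>)"

lemma local_mass_le: "local_mass p \<alpha> f z \<le> bergman_mass p \<alpha> f"
  unfolding local_mass_def by (intro nn_integral_mono) (auto simp: indicator_def)

lemma mv_holomorphic_ball_chart: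
  assumes f: "mv_holomorphic_on f unit_ball" and z: "z \<in> unit_ball"
  shows "mv_holomorphic_on (\<lambda>u. f (ball_chart z u)) (cball 0 (1/4))"
proof (rule mv_holomorphic_on_compose[OF f])
  show "ball_chart z ` cball 0 (1/4) \<subseteq> unit_ball"
    using ball_chart_props(1)[OF z] by auto
  fix j
  have "bounded_linear (\<lambda>u. stretch (defect z) (sqrt (defect z)) z u $ j)"
    using linear_stretch
    by (intro bounded_linear_compose[OF bounded_linear_vec_nth]) (simp add: linear_conv_bounded_linear)
  then have "mv_holomorphic_on (\<lambda>u. z $ j + stretch (defect z) (sqrt (defect z)) z u $ j) (cball 0 (1/4))"
    by (intro mv_holomorphic_on_add mv_holomorphic_on_const mv_holomorphic_on_linear) (auto simp: stretch_smult)
  then show "mv_holomorphic_on (\<lambda>u. ball_chart z u $ j) (cball 0 (1/4))"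
    by (simp add: ball_chart_def)
qed

lemma powr_lower_of_ratio:
  fixes x y \<alpha> :: real
  assumes "0 < x" "0 < y" "x \<le> 4 * y" "y \<le> 4 * x"
  shows "y powr \<alpha> \<le> 4 powr \<bar>\<alpha>\<bar> * x powr \<alpha>"
proof (cases "0 \<le> \<alpha>")
  case True
  then have "y powr \<alpha> \<le> (4 * x) powr \<alpha>" using assms by (intro powr_mono2) auto
  then show ?thesis using True assms by (simp add: powr_mult)
next
  case False
  then have "y powr \<alpha> \<le> (x / 4) powr \<alpha>" using assms by (intro powr_mono2') auto
  also have "\<dots> = x powr \<alpha> / 4 powr \<alpha>" using assms by (simp add: powr_divide)
  finally show ?thesis using False by (simp add: powr_minus field_simps)
qed

text \<open>The ball on which \<open>|f|\<close> is large is transported by the chart, which contributes the factor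
  \<open>(1 - |z|\<^sup>2)\<^bsup>n + 1\<^esup>\<close> to its volume, and on \<open>D(z)\<close> the weight is comparable with \<open>(1 - |z|\<^sup>2)\<^sup>\<alpha>\<close>.\<close>

lemma submean_nu_w:
  fixes p \<alpha> :: real
  assumes p: "0 < p" and \<alpha>: "-1 < \<alpha>"
  shows "\<exists>C>0. \<forall>f :: complex ^ 'n \<Rightarrow> complex. mv_holomorphic_on f unit_ball \<longrightarrow>
    (\<forall>z\<in>unit_ball. \<forall>u\<in>cball 0 (1/8). ennreal (norm (f (ball_chart z u)) powr p) \<le>
       ennreal (C * defect z powr (- (CARD('n) + 1 + \<alpha>))) * local_mass p \<alpha> f z)"
proof -
  obtain k where k: "0 < k" "\<And>h :: complex ^ 'n \<Rightarrow> ennreal. h \<in> borel_measurable ball_borel \<Longrightarrow>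
    (\<integral>\<^sup>+z. h z \<partial>nu_w \<alpha>) =
      ennreal k * (\<integral>\<^sup>+z. h z * (ennreal (defect z powr \<alpha>) * indicator unit_ball z) \<partial>lborel)"
    using nn_integral_nu_w[OF \<alpha>] by blast
  obtain C where C: "0 < C" "\<And>F :: complex ^ 'n \<Rightarrow> complex. mv_holomorphic_on F (cball 0 (1/4)) \<Longrightarrow>
    (\<forall>u\<in>cball 0 (1/8). \<exists>a R y. 0 < R \<and> 0 \<le> y \<and> ball a R \<subseteq> ball 0 (1/4) \<and>
       (\<forall>x\<in>ball a R. y \<le> norm (F x) powr p) \<and> norm (F u) powr p \<le> C * R ^ (2 * CARD('n)) * y)"
    using large_on_subball[OF p, where 'n = 'n] by blast
  define V where "V = unit_ball_vol (real (DIM(complex ^ 'n)))"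
  have V: "0 < V" by (simp add: V_def unit_ball_vol_pos)
  define c where "c = C * 4 powr \<bar>\<alpha>\<bar> / (k * V)"
  have c: "0 < c" using C k V by (simp add: c_def)
  have "ennreal (norm (f (ball_chart z u)) powr p) \<le>
      ennreal (c * defect z powr (- (CARD('n) + 1 + \<alpha>))) * local_mass p \<alpha> f z"
    if f: "mv_holomorphic_on f unit_ball" and z: "z \<in> unit_ball" and u: "u \<in> cball 0 (1/8)"
    for f :: "complex ^ 'n \<Rightarrow> complex" and z u
  proof -
    define d where "d = defect z"
    have d: "0 < d" using defect_pos[OF z] by (simp add: d_def)
    obtain a R y where R: "0 < R" and y: "0 \<le> y" and sub: "ball a R \<subseteq> ball 0 (1/4)"
      and low: "\<And>x. x \<in> ball a R \<Longrightarrow> y \<le> norm (f (ball_chart z x)) powr p"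
      and up: "norm (f (ball_chart z u)) powr p \<le> C * R ^ (2 * CARD('n)) * y"
      using C(2)[OF mv_holomorphic_ball_chart[OF f z]] u by blast
    define E where "E = ball_chart z ` ball a R"
    have E: "E \<in> sets borel" unfolding E_def by (rule ball_chart_image_borel[OF z]) simp
    have DE: "w \<in> bergman_ball z" "y \<le> norm (f w) powr p" "w \<in> unit_ball" if "w \<in> E" for w
    proof -
      from that obtain x where x: "x \<in> ball a R" "w = ball_chart z x" by (auto simp: E_def)
      then have "norm x \<le> 1 / 4" using sub by force
      then show "w \<in> bergman_ball z" using ball_chart_in_bergman_ball[OF z] x by simp
      then show "w \<in> unit_ball" by (rule bergman_ball_sub)
      show "y \<le> norm (f w) powr p" using low x by simp
    qed
    have [measurable]: "f \<in> borel_measurable ball_borel" by (rule mv_holomorphic_borel_measurable[OF f])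
    note [measurable] = borel_measurable_indicator_bergman_ball'[OF z]
    have "ennreal (k * (y * (d powr \<alpha> / 4 powr \<bar>\<alpha>\<bar>)) * (d ^ (CARD('n) + 1) * (V * R ^ (2 * CARD('n))))) =
        ennreal k * (ennreal (y * (d powr \<alpha> / 4 powr \<bar>\<alpha>\<bar>)) * emeasure lborel E)"
      unfolding E_def emeasure_ball_chart_image[OF z, of "ball a R", simplified]
      using k y d R V 
      by (simp add: emeasure_ball V_def d_def mult.assoc mult.commute[of "CARD('n)" 2] flip: ennreal_mult)
    also have "ennreal (y * (d powr \<alpha> / 4 powr \<bar>\<alpha>\<bar>)) * emeasure lborel E =
        (\<integral>\<^sup>+w. ennreal (y * (d powr \<alpha> / 4 powr \<bar>\<alpha>\<bar>)) * indicator E w \<partial>lborel)"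
      using E by (subst nn_integral_cmult_indicator) auto
    also have "\<dots> \<le> (\<integral>\<^sup>+w. (ennreal (norm (f w) powr p) * indicator (bergman_ball z) w) *
        (ennreal (defect w powr \<alpha>) * indicator unit_ball w) \<partial>lborel)"
    proof (rule nn_integral_mono)
      fix w
      show "ennreal (y * (d powr \<alpha> / 4 powr \<bar>\<alpha>\<bar>)) * indicator E w \<le> 
        (ennreal (norm (f w) powr p) * indicator (bergman_ball z) w) *
        (ennreal (defect w powr \<alpha>) * indicator unit_ball w)"
      proof (cases "w \<in> E")
        case True
        have "d powr \<alpha> \<le> 4 powr \<bar>\<alpha>\<bar> * defect w powr \<alpha>"
          using bergman_ball_compare[OF z DE(1)[OF True]] d defect_pos[OF DE(3)[OF True]]
          unfolding d_def by (intro powr_lower_of_ratio) auto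
        then have "y * (d powr \<alpha> / 4 powr \<bar>\<alpha>\<bar>) \<le> norm (f w) powr p * defect w powr \<alpha>"
          using DE(2)[OF True] by (intro mult_mono) (auto simp: field_simps)
        then show ?thesis using DE[OF True] True by (simp add: ennreal_leI flip: ennreal_mult)
      qed simp
    qed
    finally have main: "ennreal (k * (y * (d powr \<alpha> / 4 powr \<bar>\<alpha>\<bar>)) * (d ^ (CARD('n) + 1) * (V * R ^ (2 * CARD('n)))))
        \<le> local_mass p \<alpha> f z"
      unfolding local_mass_def by (subst k(2)) (auto simp: mult_left_mono)
    have "norm (f (ball_chart z u)) powr p \<le> C * R ^ (2 * CARD('n)) * y" by (rule up)
    also have "\<dots> = c * d powr (- (CARD('n) + 1 + \<alpha>)) *
        (k * (y * (d powr \<alpha> / 4 powr \<bar>\<alpha>\<bar>)) * (d ^ (CARD('n) + 1) * (V * R ^ (2 * CARD('n)))))"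
    proof -
      have "d powr (CARD('n) + 1 + \<alpha>) = d ^ (CARD('n) + 1) * d powr \<alpha>"
        using d powr_realpow[OF d, of "CARD('n) + 1"] by (simp add: powr_add)
      then have e: "d powr (- (CARD('n) + 1 + \<alpha>)) = 1 / (d ^ (CARD('n) + 1) * d powr \<alpha>)"
        unfolding powr_minus by (simp add: divide_inverse)
      have "C * r * y = (C * e / (k * V)) * (1 / (D * b)) * (k * (y * (b / e)) * (D * (V * r)))"
        if "0 < D" "0 < b" "0 < e" for r e D b :: real
        using that k V by (simp add: field_simps)
      from this[of "d ^ (CARD('n) + 1)" "d powr \<alpha>" "4 powr \<bar>\<alpha>\<bar>"] show ?thesis
        unfolding e c_def using d by simp
    qed
    finally have "ennreal (norm (f (ball_chart z u)) powr p) \<le> ennreal (c * d powr (- (CARD('n) + 1 + \<alpha>))) *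
        ennreal (k * (y * (d powr \<alpha> / 4 powr \<bar>\<alpha>\<bar>)) * (d ^ (CARD('n) + 1) * (V * R ^ (2 * CARD('n)))))"
      using c d k y V R by (subst ennreal_mult[symmetric]) (auto intro!: ennreal_leI)
    also have "\<dots> \<le> ennreal (c * d powr (- (CARD('n) + 1 + \<alpha>))) * local_mass p \<alpha> f z"
      by (intro mult_left_mono main) simp
    finally show ?thesis by (simp add: d_def)
  qed
  with c show ?thesis by blast
qed

lemma powr_le_mult_powr:
  fixes L P lam :: real
  assumes "0 \<le> L" "L \<le> P" "1 \<le> lam"
  shows "L powr lam \<le> L * P powr (lam - 1)"
proof (cases "L = 0")
  case False
  then have "L powr lam = L * L powr (lam - 1)" using assms by (simp add: powr_mult_base)
  also have "\<dots> \<le> L * P powr (lam - 1)" using assms by (intro mult_left_mono powr_mono2) auto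
  finally show ?thesis .
qed simp

lemma powr_add_le:
  fixes x y q :: real
  assumes "0 \<le> x" "0 \<le> y" "0 < q"
  shows "(x + y) powr q \<le> 2 powr q * (x powr q + y powr q)"
proof -
  have "(x + y) powr q \<le> (2 * max x y) powr q" using assms by (intro powr_mono2) auto
  also have "\<dots> = 2 powr q * max x y powr q" using assms by (simp add: powr_mult)
  also have "max x y powr q \<le> x powr q + y powr q" by (auto simp: max_def)
  finally show ?thesis by (simp add: mult_left_mono)
qed

text \<open>The pointwise heart of the upper estimates: \<open>f(z) - f(w)\<close> gains the factor \<open>\<rho>(z, w)\<close> over
  the local means of \<open>f\<close>. For small \<open>\<rho>\<close> this is the Schwarz lemma in the chart at \<open>z\<close>; otherwise
  \<open>\<rho>\<close> is bounded below and the two values can be estimated separately. The factor \<open>P\<^bsup>q/p-1\<^esup>\<close>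
  is what makes the right-hand side linear in the local mass.\<close>

lemma pointwise_local_mass:
  fixes p q \<alpha> :: real
  assumes p: "0 < p" and pq: "p \<le> q" and \<alpha>: "-1 < \<alpha>"
  defines "e \<equiv> (CARD('n) + 1 + \<alpha>) * (q / p)"
  shows "\<exists>C>0. \<forall>(f :: complex ^ 'n \<Rightarrow> complex) P. mv_holomorphic_on f unit_ball \<longrightarrow> 0 \<le> P \<longrightarrow>
    bergman_mass p \<alpha> f \<le> ennreal P \<longrightarrow>
    (\<forall>z\<in>unit_ball. ennreal (norm (f z) powr q) \<le>
        ennreal (C * P powr (q / p - 1)) * (ennreal (defect z powr (- e)) * local_mass p \<alpha> f z)) \<and>
    (\<forall>z\<in>unit_ball. \<forall>w\<in>unit_ball. ennreal (norm (f z - f w) powr q) \<le>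
        ennreal (C * P powr (q / p - 1)) * ((ennreal (defect z powr (- e)) * local_mass p \<alpha> f z +
          ennreal (defect w powr (- e)) * local_mass p \<alpha> f w) * ennreal (pseudo_hyp_dist z w powr q)))"
proof -
  define \<gamma> where "\<gamma> = CARD('n) + 1 + \<alpha>"
  define lam where "lam = q / p"
  have lam: "1 \<le> lam" "p * lam = q" "e = \<gamma> * lam" and q: "0 < q"
    using p pq by (auto simp: lam_def e_def \<gamma>_def)
  obtain c where c: "0 < c" "\<And>(f :: complex ^ 'n \<Rightarrow> complex) z u. mv_holomorphic_on f unit_ball \<Longrightarrow>
      z \<in> unit_ball \<Longrightarrow> u \<in> cball 0 (1/8) \<Longrightarrow> ennreal (norm (f (ball_chart z u)) powr p) \<le>
       ennreal (c * defect z powr (- \<gamma>)) * local_mass p \<alpha> f z"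
    using submean_nu_w[OF p \<alpha>, where 'n = 'n] unfolding \<gamma>_def by blast
  define C where "C = 18 powr q * c powr lam"
  have C: "0 < C" "c powr lam \<le> C" using c q by (auto simp: C_def mult_le_cancel_right1 ge_one_powr_ge_zero)
  have *: "ennreal (norm (f z) powr q) \<le>
        ennreal (C * P powr (q / p - 1)) * (ennreal (defect z powr (- e)) * local_mass p \<alpha> f z) \<and>
     (\<forall>w\<in>unit_ball. ennreal (norm (f z - f w) powr q) \<le>
        ennreal (C * P powr (q / p - 1)) * ((ennreal (defect z powr (- e)) * local_mass p \<alpha> f z +
          ennreal (defect w powr (- e)) * local_mass p \<alpha> f w) * ennreal (pseudo_hyp_dist z w powr q)))"
    if f: "mv_holomorphic_on f unit_ball" and P: "0 \<le> P" "bergman_mass p \<alpha> f \<le> ennreal P"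
      and z: "z \<in> unit_ball" for f :: "complex ^ 'n \<Rightarrow> complex" and P z
  proof -
    define L where "L = (\<lambda>z. enn2real (local_mass p \<alpha> f z))"
    have "local_mass p \<alpha> f z \<le> ennreal P" for z by (rule order_trans[OF local_mass_le P(2)])
    moreover from this have "local_mass p \<alpha> f z < top" for z
      using le_less_trans[OF _ ennreal_less_top] by blast
    ultimately have L: "local_mass p \<alpha> f z = ennreal (L z)" "0 \<le> L z" "L z \<le> P" for z
      unfolding L_def using P(1) by (auto simp: enn2real_leI)
    define B where "B = (\<lambda>z. defect z powr (- e) * L z)"
    have B0: "0 \<le> B z" for z using L(2) by (simp add: B_def)
    have B: "ennreal (defect z powr (- e)) * local_mass p \<alpha> f z = ennreal (B z)" for z
      unfolding L(1) B_def by (rule ennreal_mult[symmetric]) (auto simp: L)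
    define X where "X = (\<lambda>z. c * defect z powr (- \<gamma>) * L z)"
    have X0: "0 \<le> X z" for z using c(1) L(2) by (simp add: X_def)
    have XB: "X z powr lam \<le> c powr lam * P powr (lam - 1) * B z" if "z \<in> unit_ball" for z
    proof -
      have "X z powr lam = c powr lam * defect z powr (- e) * L z powr lam"
        using c(1) L(2) unfolding X_def lam(3) by (simp add: powr_mult powr_powr)
      also have "\<dots> \<le> c powr lam * defect z powr (- e) * (L z * P powr (lam - 1))"
        by (intro mult_left_mono powr_le_mult_powr L lam) auto
      finally show ?thesis by (simp add: B_def mult_ac)
    qed
    have up: "norm (f (ball_chart z u)) powr p \<le> X z" if "z \<in> unit_ball" "u \<in> cball 0 (1/8)" for z u
    proof -
      have "ennreal (norm (f (ball_chart z u)) powr p) \<le> ennreal (X z)"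
        using c(2)[OF f that] c(1) L unfolding X_def by (simp flip: ennreal_mult)
      then show ?thesis using X0 by (subst (asm) ennreal_le_iff) auto
    qed
    have one: "norm (f z) powr q \<le> c powr lam * P powr (lam - 1) * B z" if z: "z \<in> unit_ball" for z
    proof -
      have "norm (f z) powr q = (norm (f z) powr p) powr lam" by (simp add: powr_powr lam)
      also have "\<dots> \<le> X z powr lam" using up[OF z, of 0] lam by (intro powr_mono2) auto
      finally show ?thesis using XB[OF z] by simp
    qed
    have two: "norm (f z - f w) powr q \<le> C * P powr (lam - 1) * ((B z + B w) * pseudo_hyp_dist z w powr q)"
      if w: "w \<in> unit_ball" for w
    proof -
      define r where "r = pseudo_hyp_dist z w"
      have r: "0 \<le> r" by (simp add: r_def)
      show ?thesis
      proof (cases "r < 1 / 9")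
        case True
        obtain u where u: "w = ball_chart z u" "norm u * (1 - r) \<le> r"
          using ball_chart_surj[OF z w] unfolding r_def by blast
        have "norm u * (8/9) \<le> norm u * (1 - r)" using True by (intro mult_left_mono) auto
        then have ur: "norm u \<le> 9 / 8 * r" using u(2) by simp
        then have u8: "u \<in> ball 0 (1/8)" using True by simp
        define M where "M = X z powr (1 / p)"
        have "norm (f (ball_chart z u) - f (ball_chart z 0)) \<le> 2 * M / (1/8) * norm (u - 0)"
        proof (rule mv_holomorphic_lipschitz[of "\<lambda>u. f (ball_chart z u)"])
          show "mv_holomorphic_on (\<lambda>u. f (ball_chart z u)) (ball 0 (1/8))"
            by (rule mv_holomorphic_on_subset[OF mv_holomorphic_ball_chart[OF f z]]) auto
          fix x :: "complex ^ 'n" assume "x \<in> ball 0 (1/8)"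
          then have "norm (f (ball_chart z x)) powr p \<le> X z" using up[OF z] by simp
          then have "(norm (f (ball_chart z x)) powr p) powr (1 / p) \<le> M"
            unfolding M_def using p by (intro powr_mono2) auto
          then show "norm (f (ball_chart z x)) \<le> M" using p by (simp add: powr_powr)
        qed (use u8 in auto)
        also have "\<dots> \<le> 2 * M / (1/8) * (9 / 8 * r)"
          using ur by (intro mult_left_mono) (auto simp: M_def)
        finally have "norm (f z - f w) \<le> 18 * M * r"
          by (simp add: u(1) norm_minus_commute)
        then have "norm (f z - f w) powr q \<le> (18 * M * r) powr q" using q by (intro powr_mono2) auto
        also have "\<dots> = 18 powr q * X z powr lam * r powr q"
          using r by (simp add: powr_mult M_def powr_powr lam_def)
        also have "\<dots> \<le> 18 powr q * (c powr lam * P powr (lam - 1) * B z) * r powr q"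
          by (intro mult_left_mono mult_right_mono XB z) auto
        also have "\<dots> = C * P powr (lam - 1) * (B z * r powr q)" by (simp add: C_def)
        also have "\<dots> \<le> C * P powr (lam - 1) * ((B z + B w) * r powr q)"
          using C B0 by (intro mult_left_mono mult_right_mono) auto
        finally show ?thesis by (simp add: r_def)
      next
        case False
        have "norm (f z - f w) powr q \<le> (norm (f z) + norm (f w)) powr q"
          using q by (intro powr_mono2 norm_triangle_ineq4) auto
        also have "\<dots> \<le> 2 powr q * (norm (f z) powr q + norm (f w) powr q)"
          by (intro powr_add_le q) auto
        also have "\<dots> \<le> 2 powr q * (c powr lam * P powr (lam - 1) * B z + c powr lam * P powr (lam - 1) * B w)"
          by (intro mult_left_mono add_mono one z w) auto
        also have "\<dots> = 2 powr q * c powr lam * P powr (lam - 1) * (B z + B w) * 1"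
          by (simp add: algebra_simps)
        also have "\<dots> \<le> 2 powr q * c powr lam * P powr (lam - 1) * (B z + B w) * (9 * r) powr q"
          using False q B0 by (intro mult_left_mono ge_one_powr_ge_zero) auto
        also have "\<dots> = (2 powr q * 9 powr q) * c powr lam * P powr (lam - 1) * (B z + B w) * r powr q"
          using r by (simp add: powr_mult)
        also have "2 powr q * 9 powr q = (18 :: real) powr q" by (simp flip: powr_mult)
        finally show ?thesis by (simp add: C_def r_def mult_ac)
      qed
    qed
    show ?thesis
    proof (intro conjI ballI)
      have "norm (f z) powr q \<le> C * P powr (lam - 1) * B z"
        using one[OF z] C by (meson B0 mult_right_mono order_trans powr_ge_zero)
      then show "ennreal (norm (f z) powr q) \<le>
        ennreal (C * P powr (q / p - 1)) * (ennreal (defect z powr (- e)) * local_mass p \<alpha> f z)"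
        unfolding B lam_def using C B0 by (simp add: ennreal_leI flip: ennreal_mult)
      fix w :: "complex ^ 'n" assume "w \<in> unit_ball"
      from two[OF this] show "ennreal (norm (f z - f w) powr q) \<le>
        ennreal (C * P powr (q / p - 1)) * ((ennreal (defect z powr (- e)) * local_mass p \<alpha> f z +
          ennreal (defect w powr (- e)) * local_mass p \<alpha> f w) * ennreal (pseudo_hyp_dist z w powr q))"
        unfolding B lam_def using C B0 by (simp add: ennreal_leI flip: ennreal_mult ennreal_plus)
    qed
  qed
  then show ?thesis using C(1) by (intro exI[of _ C]) blast
qed

section \<open>Testing measures on kernels and on pseudo-hyperbolic balls\<close>

lemma bergman_ball_sets:
  assumes "u \<in> unit_ball"
  shows "bergman_ball u \<in> sets ball_borel"
proof -
  have "bergman_ball u \<inter> unit_ball \<in> sets ball_borel"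
    using borel_measurable_indicator_bergman_ball'[OF assms]
    by (subst (asm) borel_measurable_indicator_iff) (simp add: space_ball_borel)
  moreover have "bergman_ball u \<inter> unit_ball = bergman_ball u"
    using bergman_ball_sub by blast
  ultimately show ?thesis by simp
qed

definition carleson_kernel :: "real \<Rightarrow> real \<Rightarrow> complex ^ 'n \<Rightarrow> complex ^ 'n \<Rightarrow> real" where
  "carleson_kernel s e a w = defect a powr s / norm (1 - herm_inner a w) powr (e + s)"

abbreviation carleson_sup :: "real \<Rightarrow> real \<Rightarrow> (complex ^ 'n) measure \<Rightarrow> ennreal" where
  "carleson_sup s e \<omega> \<equiv> (SUP a\<in>unit_ball. \<integral>\<^sup>+w. ennreal (carleson_kernel s e a w) \<partial>\<omega>)"

lemma borel_measurable_carleson_kernel [measurable]: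
  "(\<lambda>w. carleson_kernel s e a w) \<in> borel_measurable ball_borel"
  unfolding carleson_kernel_def by measurable

lemma defect_powr_le_carleson_kernel:
  assumes u: "u \<in> unit_ball" and z: "z \<in> bergman_ball u" and e: "0 < e" and s: "0 < s"
  shows "defect z powr (- e) \<le> 4 powr e * 2 powr (e + s) * carleson_kernel s e u z"
proof -
  have zB: "z \<in> unit_ball" using z by (rule bergman_ball_sub)
  note cmp = bergman_ball_compare[OF u z]
  have du: "0 < defect u" by (rule defect_pos[OF u])
  have "defect z powr (- e) \<le> (defect u / 4) powr (- e)"
    using cmp du e by (intro powr_mono2') auto
  also have "\<dots> = 4 powr e * defect u powr (- e)"
    using du by (simp add: powr_divide powr_minus field_simps)
  also have "defect u powr (- e) = 2 powr (e + s) * (defect u powr s / (2 * defect u) powr (e + s))"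
    using du by (simp add: powr_mult powr_minus powr_add field_simps)
  also have "defect u powr s / (2 * defect u) powr (e + s) \<le> carleson_kernel s e u z"
    unfolding carleson_kernel_def
    using cmp(1) du e s one_minus_herm_inner_nz[OF u zB] norm_one_minus_herm_inner_commute[of u z]
    by (intro divide_left_mono powr_mono2 mult_pos_pos) (auto simp: powr_gt_zero)
  finally show ?thesis by (simp add: mult.assoc mult_left_mono)
qed

text \<open>Tonelli's theorem, together with the symmetry of the relation \<open>u \<in> D(z)\<close>.\<close>

lemma nn_integral_local_mass_swap:
  fixes f :: "complex ^ 'n \<Rightarrow> complex"
  assumes sets: "sets \<omega> = sets ball_borel" and fin: "finite_measure \<omega>" and \<alpha>: "-1 < \<alpha>"
    and f: "mv_holomorphic_on f unit_ball" and h[measurable]: "h \<in> borel_measurable ball_borel"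
  shows "(\<integral>\<^sup>+z. h z * local_mass p \<alpha> f z \<partial>\<omega>) =
    (\<integral>\<^sup>+u. ennreal (norm (f u) powr p) * (\<integral>\<^sup>+z. h z * indicator (bergman_ball u) z \<partial>\<omega>) \<partial>nu_w \<alpha>)"
proof -
  let ?\<nu> = "nu_w \<alpha> :: (complex ^ 'n) measure"
  interpret M: finite_measure \<omega> by fact
  interpret N: finite_measure ?\<nu> by (rule finite_measure_nu_w[OF \<alpha>])
  interpret P: pair_sigma_finite \<omega> ?\<nu> ..
  note [measurable_cong] = sets
  have [measurable]: "f \<in> borel_measurable ball_borel" by (rule mv_holomorphic_borel_measurable[OF f])
  have sp: "space \<omega> = unit_ball" "space ?\<nu> = unit_ball"
    using sets_eq_imp_space_eq[OF sets] by (simp_all add: space_ball_borel space_nu_w)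
  have [measurable]: "fst \<in> measurable (\<omega> \<Otimes>\<^sub>M ?\<nu>) ball_borel" "snd \<in> measurable (\<omega> \<Otimes>\<^sub>M ?\<nu>) ball_borel"
    using measurable_fst[of \<omega> ?\<nu>] measurable_snd[of \<omega> ?\<nu>]
      measurable_cong_sets[OF refl sets] measurable_cong_sets[OF refl sets_nu_w[of \<alpha>]] by blast+
  have [measurable]: "(\<lambda>x. indicator (bergman_ball (fst x)) (snd x) :: ennreal) \<in> borel_measurable (\<omega> \<Otimes>\<^sub>M ?\<nu>)"
    by (rule borel_measurable_indicator_bergman_ball) measurable
  have "(\<integral>\<^sup>+z. h z * local_mass p \<alpha> f z \<partial>\<omega>) =
      (\<integral>\<^sup>+z. (\<integral>\<^sup>+u. h z * (ennreal (norm (f u) powr p) * indicator (bergman_ball z) u) \<partial>?\<nu>) \<partial>\<omega>)"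
  proof (rule nn_integral_cong)
    fix z assume "z \<in> space \<omega>"
    then have z: "z \<in> unit_ball" by (simp add: sp)
    note [measurable] = borel_measurable_indicator_bergman_ball'[OF z]
    show "h z * local_mass p \<alpha> f z =
      (\<integral>\<^sup>+u. h z * (ennreal (norm (f u) powr p) * indicator (bergman_ball z) u) \<partial>?\<nu>)"
      unfolding local_mass_def by (rule nn_integral_cmult[symmetric]) measurable
  qed
  also have "\<dots> = (\<integral>\<^sup>+u. (\<integral>\<^sup>+z. h z * (ennreal (norm (f u) powr p) * indicator (bergman_ball z) u) \<partial>\<omega>) \<partial>?\<nu>)"
    by (rule P.Fubini'[symmetric]) (simp add: split_beta', measurable)
  also have "\<dots> = (\<integral>\<^sup>+u. ennreal (norm (f u) powr p) * (\<integral>\<^sup>+z. h z * indicator (bergman_ball u) z \<partial>\<omega>) \<partial>?\<nu>)"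
  proof (rule nn_integral_cong)
    fix u assume "u \<in> space ?\<nu>"
    then have u: "u \<in> unit_ball" by (simp add: sp)
    note [measurable] = borel_measurable_indicator_bergman_ball'[OF u]
    have "(\<integral>\<^sup>+z. h z * (ennreal (norm (f u) powr p) * indicator (bergman_ball z) u) \<partial>\<omega>) =
        (\<integral>\<^sup>+z. ennreal (norm (f u) powr p) * (h z * indicator (bergman_ball u) z) \<partial>\<omega>)"
      using u by (intro nn_integral_cong) (auto simp: sp indicator_def bergman_ball_commute[OF u] mult_ac)
    also have "\<dots> = ennreal (norm (f u) powr p) * (\<integral>\<^sup>+z. h z * indicator (bergman_ball u) z \<partial>\<omega>)"
      by (rule nn_integral_cmult) measurable
    finally show "(\<integral>\<^sup>+z. h z * (ennreal (norm (f u) powr p) * indicator (bergman_ball z) u) \<partial>\<omega>) =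
       ennreal (norm (f u) powr p) * (\<integral>\<^sup>+z. h z * indicator (bergman_ball u) z \<partial>\<omega>)" .
  qed
  finally show ?thesis .
qed

text \<open>After the interchange, \<open>\<integral> (1 - |z|\<^sup>2)\<^bsup>-e\<^esup> d\<omega>(z)\<close> over \<open>D(u)\<close> remains, and there the integrand is
  dominated by the kernel \<open>K\<^sub>u\<close>.\<close>

lemma nn_integral_local_mass_le:
  fixes f :: "complex ^ 'n \<Rightarrow> complex"
  assumes sets: "sets \<omega> = sets ball_borel" and fin: "finite_measure \<omega>" and \<alpha>: "-1 < \<alpha>"
    and f: "mv_holomorphic_on f unit_ball" and e: "0 < e" and s: "0 < s"
  shows "(\<integral>\<^sup>+z. ennreal (defect z powr (- e)) * local_mass p \<alpha> f z \<partial>\<omega>) \<le>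
    ennreal (4 powr e * 2 powr (e + s)) * carleson_sup s e \<omega> *
      bergman_mass p \<alpha> f"
proof -
  define S where "S = carleson_sup s e \<omega>"
  note [measurable_cong] = sets
  have [measurable]: "f \<in> borel_measurable ball_borel" by (rule mv_holomorphic_borel_measurable[OF f])
  have sp: "space \<omega> = unit_ball"
    using sets_eq_imp_space_eq[OF sets] by (simp_all add: space_ball_borel)
  have inner: "(\<integral>\<^sup>+z. ennreal (defect z powr (- e)) * indicator (bergman_ball u) z \<partial>\<omega>) \<le>
      ennreal (4 powr e * 2 powr (e + s)) * S" if u: "u \<in> unit_ball" for u
  proof -
    have "(\<integral>\<^sup>+z. ennreal (defect z powr (- e)) * indicator (bergman_ball u) z \<partial>\<omega>) \<le>
        (\<integral>\<^sup>+z. ennreal (4 powr e * 2 powr (e + s)) * ennreal (carleson_kernel s e u z) \<partial>\<omega>)"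
    proof (rule nn_integral_mono)
      fix z
      show "ennreal (defect z powr (- e)) * indicator (bergman_ball u) z \<le>
          ennreal (4 powr e * 2 powr (e + s)) * ennreal (carleson_kernel s e u z)"
        using defect_powr_le_carleson_kernel[OF u _ e s, of z]
        by (cases "z \<in> bergman_ball u") (auto simp: ennreal_leI simp flip: ennreal_mult')
    qed
    also have "\<dots> = ennreal (4 powr e * 2 powr (e + s)) * (\<integral>\<^sup>+z. ennreal (carleson_kernel s e u z) \<partial>\<omega>)"
      by (rule nn_integral_cmult) measurable
    also have "\<dots> \<le> ennreal (4 powr e * 2 powr (e + s)) * S"
      unfolding S_def using u by (intro mult_left_mono SUP_upper) auto
    finally show ?thesis .
  qed
  have "(\<integral>\<^sup>+z. ennreal (defect z powr (- e)) * local_mass p \<alpha> f z \<partial>\<omega>) =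
    (\<integral>\<^sup>+u. ennreal (norm (f u) powr p) * (\<integral>\<^sup>+z. ennreal (defect z powr (- e)) * indicator (bergman_ball u) z \<partial>\<omega>) \<partial>nu_w \<alpha>)"
    by (rule nn_integral_local_mass_swap[OF sets fin \<alpha> f]) measurable
  also have "\<dots> \<le> (\<integral>\<^sup>+u. (ennreal (4 powr e * 2 powr (e + s)) * S) * ennreal (norm (f u) powr p) \<partial>nu_w \<alpha>)"
  proof (rule nn_integral_mono)
    fix u :: "complex ^ 'n" assume "u \<in> space (nu_w \<alpha>)"
    then have u: "u \<in> unit_ball" by (simp add: space_nu_w)
    show "ennreal (norm (f u) powr p) * (\<integral>\<^sup>+z. ennreal (defect z powr (- e)) * indicator (bergman_ball u) z \<partial>\<omega>)
        \<le> (ennreal (4 powr e * 2 powr (e + s)) * S) * ennreal (norm (f u) powr p)"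
      using mult_left_mono[OF inner[OF u], of "ennreal (norm (f u) powr p)"] by (simp add: mult.commute)
  qed
  also have "\<dots> = (ennreal (4 powr e * 2 powr (e + s)) * S) * bergman_mass p \<alpha> f"
    by (rule nn_integral_cmult) measurable
  finally show ?thesis unfolding S_def .
qed

text \<open>The exponent of the kernel is absorbed into the measure: with \<open>\<alpha>' = e - n - 1 > -1\<close> the
  kernel is a constant multiple of \<open>|f|\<^sup>p\<close> for \<open>f(w) = 1 / (1 - \<langle>w, a\<rangle>)\<close> and \<open>p = e + s\<close>, the sub-mean
  value estimate for \<open>\<nu>\<^bsub>\<alpha>'\<^esub>\<close> has exactly the factor \<open>(1 - |w|\<^sup>2)\<^bsup>-e\<^esup>\<close>, and the Forelli-Rudin
  estimate applies since \<open>s > 0\<close>.\<close>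

lemma carleson_sup_le_of_ball_le:
  fixes e s :: real
  assumes e: "real CARD('n) < e" and s: "0 < s"
  shows "\<exists>C>0. \<forall>(\<omega> :: (complex ^ 'n) measure) M. sets \<omega> = sets ball_borel \<longrightarrow> finite_measure \<omega> \<longrightarrow> 0 \<le> M \<longrightarrow>
    (\<forall>a\<in>unit_ball. emeasure \<omega> (bergman_ball a) \<le> ennreal (M * defect a powr e)) \<longrightarrow>
    carleson_sup s e \<omega> \<le> ennreal (C * M)"
proof -
  define \<alpha> where "\<alpha> = e - CARD('n) - 1"
  define p where "p = e + s"
  have e0: "0 < e" using e by (rule le_less_trans[rotated]) simp
  have \<alpha>: "-1 < \<alpha>" and p: "0 < p" and e\<alpha>: "CARD('n) + 1 + \<alpha> = e" and ep: "e < p"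
    using e e0 s by (auto simp: \<alpha>_def p_def)
  obtain c where c: "0 < c" "\<And>(f :: complex ^ 'n \<Rightarrow> complex) z u. mv_holomorphic_on f unit_ball \<Longrightarrow>
      z \<in> unit_ball \<Longrightarrow> u \<in> cball 0 (1/8) \<Longrightarrow> ennreal (norm (f (ball_chart z u)) powr p) \<le>
       ennreal (c * defect z powr (- e)) * local_mass p \<alpha> f z"
    using submean_nu_w[OF p \<alpha>, where 'n = 'n] unfolding e\<alpha> by blast
  obtain F where F: "0 < F" "\<And>a :: complex ^ 'n. a \<in> unit_ball \<Longrightarrow>
    (\<integral>\<^sup>+u. ennreal (norm (1 - herm_inner u a) powr (- p)) \<partial>nu_w \<alpha>) \<le> ennreal (F * defect a powr (e - p))"
    using forelli_rudin[OF \<alpha>, of p, where 'n = 'n] ep unfolding e\<alpha> by blast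
  define C where "C = c * 4 powr e * F"
  have C: "0 < C" using c F by (simp add: C_def)
  have "(\<integral>\<^sup>+w. ennreal (carleson_kernel s e a w) \<partial>\<omega>) \<le> ennreal (C * M)"
    if sets: "sets \<omega> = sets ball_borel" and fin: "finite_measure \<omega>" and M: "0 \<le> M"
      and balls: "\<And>a. a \<in> unit_ball \<Longrightarrow> emeasure \<omega> (bergman_ball a) \<le> ennreal (M * defect a powr e)"
      and a: "a \<in> unit_ball" for \<omega> :: "(complex ^ 'n) measure" and M a
  proof -
    note [measurable_cong] = sets
    have sp: "space \<omega> = unit_ball"
      using sets_eq_imp_space_eq[OF sets] by (simp_all add: space_ball_borel)
    define f where "f = (\<lambda>w. inverse (1 - herm_inner w a))"
    have f: "mv_holomorphic_on f unit_ball"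
      unfolding f_def using one_minus_herm_inner_nz[OF _ a]
      by (intro mv_holomorphic_on_inverse mv_holomorphic_on_diff mv_holomorphic_on_const
          mv_holomorphic_on_herm_inner) auto
    have [measurable]: "f \<in> borel_measurable ball_borel" by (rule mv_holomorphic_borel_measurable[OF f])
    have nf: "norm (f w) powr p = norm (1 - herm_inner w a) powr (- p)" for w
      by (simp add: f_def norm_inverse powr_minus inverse_powr)
    define h where "h = (\<lambda>w :: complex ^ 'n. ennreal (defect a powr s * c) * ennreal (defect w powr (- e)))"
    have h[measurable]: "h \<in> borel_measurable ball_borel" unfolding h_def by measurable
    have "(\<integral>\<^sup>+w. ennreal (carleson_kernel s e a w) \<partial>\<omega>) \<le> (\<integral>\<^sup>+w. h w * local_mass p \<alpha> f w \<partial>\<omega>)"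
    proof (rule nn_integral_mono)
      fix w assume "w \<in> space \<omega>"
      then have w: "w \<in> unit_ball" by (simp add: sp)
      have "ennreal (carleson_kernel s e a w) = ennreal (defect a powr s) * ennreal (norm (f w) powr p)"
        unfolding nf carleson_kernel_def norm_one_minus_herm_inner_commute[of a w]
        unfolding p_def powr_minus[of _ "e + s"] by (simp add: divide_inverse flip: ennreal_mult)
      also have "\<dots> \<le> ennreal (defect a powr s) * (ennreal (c * defect w powr (- e)) * local_mass p \<alpha> f w)"
        using c(2)[OF f w, of 0] by (intro mult_left_mono) auto
      also have "\<dots> = h w * local_mass p \<alpha> f w"
        unfolding h_def using c(1) by (simp add: ennreal_mult mult.assoc)
      finally show "ennreal (carleson_kernel s e a w) \<le> h w * local_mass p \<alpha> f w" .
    qed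
    also have "\<dots> = (\<integral>\<^sup>+u. ennreal (norm (f u) powr p) * (\<integral>\<^sup>+z. h z * indicator (bergman_ball u) z \<partial>\<omega>) \<partial>nu_w \<alpha>)"
      by (rule nn_integral_local_mass_swap[OF sets fin \<alpha> f h])
    also have "\<dots> \<le> (\<integral>\<^sup>+u. ennreal (defect a powr s * c * 4 powr e * M) * ennreal (norm (f u) powr p) \<partial>nu_w \<alpha>)"
    proof (rule nn_integral_mono)
      fix u :: "complex ^ 'n" assume "u \<in> space (nu_w \<alpha>)"
      then have u: "u \<in> unit_ball" by (simp add: space_nu_w)
      have du: "0 < defect u" by (rule defect_pos[OF u])
      note [measurable] = borel_measurable_indicator_bergman_ball'[OF u]
      have Ds: "bergman_ball u \<in> sets \<omega>"
        unfolding sets by (rule bergman_ball_sets[OF u])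
      have "(\<integral>\<^sup>+z. h z * indicator (bergman_ball u) z \<partial>\<omega>) \<le>
          (\<integral>\<^sup>+z. ennreal (defect a powr s * c * (4 powr e * defect u powr (- e))) * indicator (bergman_ball u) z \<partial>\<omega>)"
      proof (rule nn_integral_mono)
        fix z
        show "h z * indicator (bergman_ball u) z \<le>
          ennreal (defect a powr s * c * (4 powr e * defect u powr (- e))) * indicator (bergman_ball u) z"
        proof (cases "z \<in> bergman_ball u")
          case True
          have "defect z powr (- e) \<le> (defect u / 4) powr (- e)"
            using bergman_ball_compare[OF u True] du e0 by (intro powr_mono2') auto
          also have "\<dots> = 4 powr e * defect u powr (- e)"
            using du by (simp add: powr_divide powr_minus field_simps)
          finally have "defect a powr s * c * defect z powr (- e) \<le>
              defect a powr s * c * (4 powr e * defect u powr (- e))"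
            using c(1) by (intro mult_left_mono) auto
          then show ?thesis using c(1) True by (simp add: h_def ennreal_leI flip: ennreal_mult)
        qed simp
      qed
      also have "\<dots> = ennreal (defect a powr s * c * (4 powr e * defect u powr (- e))) * emeasure \<omega> (bergman_ball u)"
        by (rule nn_integral_cmult_indicator[OF Ds])
      also have "\<dots> \<le> ennreal (defect a powr s * c * (4 powr e * defect u powr (- e))) * ennreal (M * defect u powr e)"
        by (intro mult_left_mono balls u) auto
      also have "\<dots> = ennreal (defect a powr s * c * 4 powr e * M)"
        using du c(1) M by (simp add: powr_minus field_simps flip: ennreal_mult)
      finally show "ennreal (norm (f u) powr p) * (\<integral>\<^sup>+z. h z * indicator (bergman_ball u) z \<partial>\<omega>) \<le>
          ennreal (defect a powr s * c * 4 powr e * M) * ennreal (norm (f u) powr p)"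
        unfolding mult.commute[of "ennreal (norm (f u) powr p)"] by (rule mult_right_mono) simp
    qed
    also have "\<dots> = ennreal (defect a powr s * c * 4 powr e * M) * bergman_mass p \<alpha> f"
      by (rule nn_integral_cmult) measurable
    also have "\<dots> \<le> ennreal (defect a powr s * c * 4 powr e * M) * ennreal (F * defect a powr (e - p))"
      unfolding nf by (intro mult_left_mono F a) auto
    also have "\<dots> = ennreal (defect a powr s * defect a powr (e - p) * (C * M))"
      using c(1) M F(1) by (simp add: C_def mult_ac flip: ennreal_mult)
    also have "defect a powr s * defect a powr (e - p) = 1"
      using defect_pos[OF a] unfolding powr_add[symmetric] by (simp add: p_def)
    finally show ?thesis by simp
  qed
  then show ?thesis using C by (intro exI[of _ C] conjI allI impI SUP_least) auto
qed

section \<open>Test functions\<close>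

definition test_fun :: "complex ^ 'n \<Rightarrow> nat \<Rightarrow> complex ^ 'n \<Rightarrow> complex" where
  "test_fun a m z = (of_real (defect a) * inverse (1 - herm_inner z a)) ^ m"

lemma norm_test_fun: "a \<in> unit_ball \<Longrightarrow> norm (test_fun a m z) = (defect a / norm (1 - herm_inner z a)) ^ m"
  using defect_pos[of a] by (simp add: test_fun_def norm_power norm_mult norm_inverse divide_inverse)

lemma mv_holomorphic_test_fun: "a \<in> unit_ball \<Longrightarrow> mv_holomorphic_on (test_fun a m) unit_ball"
  unfolding test_fun_def using one_minus_herm_inner_nz[of _ a] 
  by (intro mv_holomorphic_on_power mv_holomorphic_on_cmult mv_holomorphic_on_inverse) auto

lemma mv_holomorphic_ball_involution:
  assumes a: "a \<in> unit_ball"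
  shows "mv_holomorphic_on (\<lambda>z. ball_involution a z $ j) unit_ball"
proof -
  have "mv_holomorphic_on (\<lambda>z. inverse (1 - herm_inner z a) *
     (a $ j - herm_inner z a * (a $ j / herm_inner a a) - of_real (sqrt (1 - (norm a)\<^sup>2)) *
       (z $ j - herm_inner z a * (a $ j / herm_inner a a)))) unit_ball"
    using one_minus_herm_inner_nz[OF _ a]
    by (intro mv_holomorphic_on_mult mv_holomorphic_on_diff mv_holomorphic_on_inverse) auto
  moreover have "(\<lambda>z. ball_involution a z $ j) = (\<lambda>z. inverse (1 - herm_inner z a) *
     (a $ j - herm_inner z a * (a $ j / herm_inner a a) - of_real (sqrt (1 - (norm a)\<^sup>2)) *
       (z $ j - herm_inner z a * (a $ j / herm_inner a a))))"
    by (rule ext) (simp add: ball_involution_def proj_span_def scaleR_conv_of_real[where 'a=complex]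
        divide_inverse algebra_simps)
  ultimately show ?thesis by (simp only:)
qed

lemma test_fun_mass_le:
  fixes p \<alpha> :: real
  assumes p: "0 < p" and \<alpha>: "-1 < \<alpha>" and m: "CARD('n) + 1 + \<alpha> < m * p"
  shows "\<exists>C>0. \<forall>(a :: complex ^ 'n)\<in>unit_ball. \<forall>G. (\<forall>z\<in>unit_ball. norm (G z) \<le> norm (test_fun a m z)) \<longrightarrow>
    (\<integral>\<^sup>+z. ennreal (norm (G z :: complex) powr p) \<partial>nu_w \<alpha>) \<le> ennreal (C * defect a powr (CARD('n) + 1 + \<alpha>))"
proof -
  define b where "b = m * p"
  define \<gamma> where "\<gamma> = CARD('n) + 1 + \<alpha>"
  obtain F where F: "0 < F" "\<And>a :: complex ^ 'n. a \<in> unit_ball \<Longrightarrow>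
    (\<integral>\<^sup>+u. ennreal (norm (1 - herm_inner u a) powr (- b)) \<partial>nu_w \<alpha>) \<le> ennreal (F * defect a powr (\<gamma> - b))"
    using forelli_rudin[OF \<alpha>, of b, where 'n = 'n] m unfolding b_def \<gamma>_def by blast
  have "(\<integral>\<^sup>+z. ennreal (norm (G z) powr p) \<partial>nu_w \<alpha>) \<le> ennreal (F * defect a powr \<gamma>)"
    if a: "a \<in> unit_ball" and G: "\<And>z. z \<in> unit_ball \<Longrightarrow> norm (G z) \<le> norm (test_fun a m z)"
    for a :: "complex ^ 'n" and G :: "complex ^ 'n \<Rightarrow> complex"
  proof -
    have da: "0 < defect a" by (rule defect_pos[OF a])
    have "(\<integral>\<^sup>+z. ennreal (norm (G z) powr p) \<partial>nu_w \<alpha>) \<le>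
        (\<integral>\<^sup>+z. ennreal (defect a powr b) * ennreal (norm (1 - herm_inner z a) powr (- b)) \<partial>nu_w \<alpha>)"
    proof (rule nn_integral_mono)
      fix z :: "complex ^ 'n" assume "z \<in> space (nu_w \<alpha>)"
      then have z: "z \<in> unit_ball" by (simp add: space_nu_w)
      define x where "x = norm (1 - herm_inner z a)"
      have x: "0 < x" using one_minus_herm_inner_nz[OF z a] by (simp add: x_def)
      have "norm (G z) powr p \<le> ((defect a / x) ^ m) powr p"
        using G[OF z] p unfolding norm_test_fun[OF a] x_def by (intro powr_mono2) auto
      also have "\<dots> = (defect a / x) powr b"
        using da x by (simp add: b_def powr_powr flip: powr_realpow)
      also have "\<dots> = defect a powr b * x powr (- b)"
        using da x by (simp add: powr_divide powr_minus field_simps)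
      finally show "ennreal (norm (G z) powr p) \<le>
          ennreal (defect a powr b) * ennreal (norm (1 - herm_inner z a) powr (- b))"
        unfolding x_def by (subst ennreal_mult[symmetric]) (auto intro: ennreal_leI)
    qed
    also have "\<dots> = ennreal (defect a powr b) * (\<integral>\<^sup>+z. ennreal (norm (1 - herm_inner z a) powr (- b)) \<partial>nu_w \<alpha>)"
      by (rule nn_integral_cmult) measurable
    also have "\<dots> \<le> ennreal (defect a powr b) * ennreal (F * defect a powr (\<gamma> - b))"
      by (intro mult_left_mono F a) auto
    also have "\<dots> = ennreal (F * (defect a powr b * defect a powr (\<gamma> - b)))"
      using F(1) by (subst ennreal_mult[symmetric]) (auto simp: mult_ac)
    also have "defect a powr b * defect a powr (\<gamma> - b) = defect a powr \<gamma>"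
      by (simp flip: powr_add)
    finally show ?thesis .
  qed
  then show ?thesis using F(1) unfolding \<gamma>_def by (intro exI[of _ F]) blast
qed

text \<open>With \<open>h(z) = (1 - |a|\<^sup>2) / (1 - \<langle>z, a\<rangle>)\<close>, the index \<^const>\<open>None\<close> adds \<open>h\<^sup>m\<close> to the components
  of \<open>h\<^sup>m \<sigma>\<^sub>a\<close>: a difference of \<open>h\<^sup>m \<sigma>\<^sub>a\<close> may come from the factor \<open>h\<^sup>m\<close> as well as from \<open>\<sigma>\<^sub>a\<close>, and
  \<open>h\<^sup>m\<close> tells these apart.\<close>

definition test_family :: "complex ^ 'n \<Rightarrow> nat \<Rightarrow> 'n option \<Rightarrow> complex ^ 'n \<Rightarrow> complex" where
  "test_family a m i z = test_fun a m z * (case i of None \<Rightarrow> 1 | Some j \<Rightarrow> ball_involution a z $ j)"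

lemma mv_holomorphic_test_family:
  "a \<in> unit_ball \<Longrightarrow> mv_holomorphic_on (test_family a m i) unit_ball"
  unfolding test_family_def
  by (cases i) (auto intro!: mv_holomorphic_on_mult mv_holomorphic_test_fun mv_holomorphic_ball_involution)

lemma norm_test_family_le:
  assumes "a \<in> unit_ball" "z \<in> unit_ball"
  shows "norm (test_family a m i z) \<le> norm (test_fun a m z)"
proof (cases i)
  case (Some j)
  have "norm (ball_involution a z $ j) \<le> 1"
    using Finite_Cartesian_Product.norm_nth_le[of "ball_involution a z" j] ball_involution_in_ball[OF assms] by simp
  then show ?thesis by (simp add: test_family_def Some norm_mult mult_left_le)
qed (simp add: test_family_def)

text \<open>If \<open>z\<close> is close to \<open>a\<close>, then \<open>|h(z)|\<close> is bounded below, and the differences of the test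
  functions between \<open>z\<close> and an arbitrary point \<open>w\<close> control \<open>\<sigma>\<^sub>a(z) - \<sigma>\<^sub>a(w)\<close>. Since \<open>\<rho>\<close> is
  invariant under \<open>\<sigma>\<^sub>a\<close> and \<open>\<sigma>\<^sub>a(z)\<close> is near the origin, this controls \<open>\<rho>(z, w)\<close>.\<close>

lemma pseudo_hyp_dist_le_test_family:
  fixes a z w :: "complex ^ 'n"
  assumes a: "a \<in> unit_ball" and z: "z \<in> bergman_ball a" and w: "w \<in> unit_ball"
  shows "pseudo_hyp_dist z w \<le> 2 ^ (m + 1) * (\<Sum>i\<in>UNIV. norm (test_family a m i z - test_family a m i w))"
proof -
  have zB: "z \<in> unit_ball" using z by (rule bergman_ball_sub)
  have da: "0 < defect a" by (rule defect_pos[OF a])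
  define Z W where "Z = ball_involution a z" and "W = ball_involution a w"
  have ZW: "Z \<in> unit_ball" "W \<in> unit_ball" "norm Z < 1 / 2"
    using a zB w z by (auto simp: Z_def W_def bergman_ball_def pseudo_hyp_dist_def
        intro: ball_involution_in_ball[unfolded mem_ball_0])
  define x y where "x = test_fun a m z" and "y = test_fun a m w"
  define d where "d = (\<lambda>i. norm (test_family a m i z - test_family a m i w))"
  have "1 / 2 \<le> defect a / norm (1 - herm_inner z a)"
    using bergman_ball_compare(1)[OF a z] one_minus_herm_inner_nz[OF zB a] by (simp add: field_simps)
  then have "(1 / 2) ^ m \<le> norm x"
    unfolding x_def norm_test_fun[OF a] by (intro power_mono) auto
  then have "(1 / 2) ^ m * norm (Z - W) \<le> norm x * norm (Z - W)" by (intro mult_right_mono) auto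
  also have "norm x * norm (Z - W) = norm ((x *s Z - y *s W) - (x - y) *s W)"
  proof -
    have "(x *s Z - y *s W) - (x - y) *s W = x *s (Z - W)"
      by (simp add: vec_eq_iff algebra_simps)
    then show ?thesis by (simp only: norm_smult_vec)
  qed
  also have "\<dots> \<le> norm (x *s Z - y *s W) + norm ((x - y) *s W)" by (rule norm_triangle_ineq4)
  also have "norm (x *s Z - y *s W) \<le> (\<Sum>j\<in>UNIV. d (Some j))"
    unfolding norm_vec_def
    by (rule order_trans[OF L2_set_le_sum]) (auto simp: d_def test_family_def x_def y_def Z_def W_def)
  also have "norm ((x - y) *s W) \<le> d None"
  proof -
    have "norm (x - y) * norm W \<le> norm (x - y) * 1" using ZW by (intro mult_left_mono) auto
    moreover have "d None = norm (x - y)" by (simp add: d_def test_family_def x_def y_def)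
    ultimately show ?thesis unfolding norm_smult_vec by simp
  qed
  also have "(\<Sum>j\<in>UNIV. d (Some j)) + d None = (\<Sum>i\<in>UNIV. d i)"
    by (simp add: UNIV_option_conv sum.reindex)
  finally have le: "(1 / 2) ^ m * norm (Z - W) \<le> (\<Sum>i\<in>UNIV. d i)" by simp
  have "pseudo_hyp_dist z w = pseudo_hyp_dist Z W"
    unfolding Z_def W_def by (rule pseudo_hyp_dist_invariant[OF a zB w, symmetric])
  also have "\<dots> \<le> norm (Z - W) / (1 - norm Z)" by (rule pseudo_hyp_dist_le_norm) fact+
  also have "\<dots> \<le> norm (Z - W) / (1 / 2)" using ZW by (intro divide_left_mono) auto
  also have "\<dots> = 2 ^ (m + 1) * ((1 / 2) ^ m * norm (Z - W))" by (simp add: power_divide)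
  also have "\<dots> \<le> 2 ^ (m + 1) * (\<Sum>i\<in>UNIV. d i)" using le by (intro mult_left_mono) auto
  finally show ?thesis by (simp add: d_def)
qed

section \<open>Series of holomorphic functions and uniform boundedness\<close>

text \<open>Termwise differentiation: a uniform bound for the \<open>f\<^sub>i\<close> near a point bounds their derivatives
  near that point.\<close>

lemma mv_holomorphic_series:
  fixes f :: "nat \<Rightarrow> complex ^ 'n \<Rightarrow> complex" and c :: "nat \<Rightarrow> complex"
  assumes hol: "\<And>i. mv_holomorphic_on (f i) unit_ball" and c: "summable (\<lambda>i. norm (c i))"
    and bd: "\<And>z. z \<in> unit_ball \<Longrightarrow> \<exists>r>0. \<exists>M. ball z r \<subseteq> unit_ball \<and> (\<forall>i. \<forall>x\<in>ball z r. norm (f i x) \<le> M)"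
  shows "mv_holomorphic_on (\<lambda>z. \<Sum>i. c i * f i z) unit_ball"
    and "z \<in> unit_ball \<Longrightarrow> (\<lambda>i. c i * f i z) sums (\<Sum>i. c i * f i z)"
proof -
  have sums: "(\<lambda>i. c i * f i z) sums (\<Sum>i. c i * f i z)" if z: "z \<in> unit_ball" for z
  proof -
    obtain r M where r: "0 < r" and M: "\<And>i x. x \<in> ball z r \<Longrightarrow> norm (f i x) \<le> M"
      using bd[OF z] by blast
    have "summable (\<lambda>i. c i * f i z)"
    proof (rule summable_comparison_test'[of "\<lambda>i. norm (c i) * M" 0])
      show "summable (\<lambda>i. norm (c i) * M)" by (rule summable_mult2[OF c])
      show "norm (c n * f n z) \<le> norm (c n) * M" for n
        using M[of z n] r by (simp add: norm_mult mult_left_mono)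
    qed
    then show ?thesis by (rule summable_sums)
  qed
  then show "z \<in> unit_ball \<Longrightarrow> (\<lambda>i. c i * f i z) sums (\<Sum>i. c i * f i z)" .
  have "\<forall>i z. \<exists>D. z \<in> unit_ball \<longrightarrow> (f i has_derivative D) (at z) \<and> (\<forall>c v. D (c *s v) = c * D v)"
    using hol unfolding mv_holomorphic_on_def by blast
  then obtain D where D: "\<And>i z. z \<in> unit_ball \<Longrightarrow> (f i has_derivative D i z) (at z)"
    "\<And>i z c v. z \<in> unit_ball \<Longrightarrow> D i z (c *s v) = c * D i z v"
    unfolding choice_iff by blast
  show "mv_holomorphic_on (\<lambda>z. \<Sum>i. c i * f i z) unit_ball"
    unfolding mv_holomorphic_on_def
  proof
    fix z :: "complex ^ 'n" assume z: "z \<in> unit_ball"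
    obtain r M where r: "0 < r" and sub: "ball z r \<subseteq> unit_ball"
      and M: "\<And>i x. x \<in> ball z r \<Longrightarrow> norm (f i x) \<le> M"
      using bd[OF z] by blast
    define S where "S = ball z (r / 2)"
    define K where "K = 2 * M / (r / 2)"
    have sub2: "ball x (r / 2) \<subseteq> ball z r" if "x \<in> S" for x
    proof
      fix y assume "y \<in> ball x (r / 2)"
      then show "y \<in> ball z r"
        using that dist_triangle[of z y x] by (simp add: S_def dist_commute)
    qed
    have SB: "x \<in> unit_ball" if "x \<in> S" for x
      using sub2[OF that] sub r by (auto dest!: subsetD[of "ball x (r/2)" _ x])
    have DK: "norm (D i x h) \<le> K * norm h" if x: "x \<in> S" for i x h
      unfolding K_def
    proof (rule mv_holomorphic_derivative_bound)
      show "mv_holomorphic_on (f i) (ball x (r / 2))"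
        by (rule mv_holomorphic_on_subset[OF hol]) (use sub sub2[OF x] in blast)
      show "norm (f i y) \<le> M" if "y \<in> ball x (r / 2)" for y using M sub2[OF x] that by blast
      show "(f i has_derivative D i x) (at x)" by (rule D(1)[OF SB[OF x]])
      show "D i x (c *s v) = c * D i x v" for c v by (rule D(2)[OF SB[OF x]])
    qed (use r in auto)
    have K0: "0 \<le> K"
    proof -
      have "0 \<le> M" using M[of z 0] r order_trans[OF norm_ge_zero] by simp
      then show ?thesis using r by (simp add: K_def)
    qed
    have smD: "summable (\<lambda>i. norm (c i * D i x h))" if "x \<in> S" for x h
    proof (rule summable_comparison_test'[of "\<lambda>i. norm (c i) * (K * norm h)" 0])
      show "summable (\<lambda>i. norm (c i) * (K * norm h))" by (rule summable_mult2[OF c])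
      show "norm (norm (c n * D n x h)) \<le> norm (c n) * (K * norm h)" for n
        using DK[OF that, of n h] by (simp add: norm_mult mult_left_mono)
    qed
    define g' where "g' = (\<lambda>x h. \<Sum>i. c i * D i x h)"
    have "\<exists>g. \<forall>x\<in>S. (\<lambda>n. c n * f n x) sums (g x) \<and> (g has_derivative g' x) (at x within S)"
    proof (rule has_derivative_series)
      show "convex S" by (simp add: S_def)
      show "((\<lambda>x. c n * f n x) has_derivative (\<lambda>h. c n * D n x h)) (at x within S)" if "x \<in> S" for n x
        by (rule has_derivative_at_withinI[OF has_derivative_mult_right[OF D(1)[OF SB[OF that]]]])
      show "z \<in> S" using r by (simp add: S_def)
      show "(\<lambda>n. c n * f n z) sums (\<Sum>i. c i * f i z)" by (rule sums[OF z])
      fix e :: real assume e: "0 < e"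
      obtain n0 where n0: "\<And>n. n \<ge> n0 \<Longrightarrow> norm (\<Sum>i. norm (c (i + n))) < e / (K + 1)"
        using suminf_exist_split[OF _ c, of "e / (K + 1)"] e K0 by auto
      show "\<forall>\<^sub>F n in sequentially. \<forall>x\<in>S. \<forall>h. norm ((\<Sum>i<n. c i * D i x h) - g' x h) \<le> e * norm h"
        unfolding eventually_sequentially
      proof (intro exI[of _ n0] allI impI ballI)
        fix n x h assume n: "n0 \<le> n" and x: "x \<in> S"
        have sm: "summable (\<lambda>i. c i * D i x h)" using smD[OF x] by (rule summable_norm_cancel)
        have cn: "summable (\<lambda>i. norm (c (i + n)))" using c by (subst summable_iff_shift)
        have "g' x h - (\<Sum>i<n. c i * D i x h) = (\<Sum>i. c (i + n) * D (i + n) x h)"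
          unfolding g'_def by (rule suminf_minus_initial_segment[OF sm, symmetric])
        then have "norm ((\<Sum>i<n. c i * D i x h) - g' x h) = norm (\<Sum>i. c (i + n) * D (i + n) x h)"
          by (metis norm_minus_commute)
        also have "\<dots> \<le> (\<Sum>i. norm (c (i + n)) * (K * norm h))"
        proof (rule order_trans[OF summable_norm suminf_le])
          show "summable (\<lambda>i. norm (c (i + n) * D (i + n) x h))"
            using smD[OF x] by (subst summable_iff_shift[where f = "\<lambda>i. norm (c i * D i x h)"])
          then show "summable (\<lambda>i. norm (c (i + n) * D (i + n) x h))" .
          show "summable (\<lambda>i. norm (c (i + n)) * (K * norm h))" by (rule summable_mult2[OF cn])
          show "norm (c (i + n) * D (i + n) x h) \<le> norm (c (i + n)) * (K * norm h)" for i
            using DK[OF x, of "i + n" h] by (simp add: norm_mult mult_left_mono)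
        qed
        also have "\<dots> = (\<Sum>i. norm (c (i + n))) * (K * norm h)"
          by (rule suminf_mult2[OF cn, symmetric])
        also have "\<dots> \<le> (e / (K + 1)) * (K * norm h)"
          using n0[OF n] K0 by (intro mult_right_mono) auto
        also have "\<dots> = e * (K / (K + 1)) * norm h" by simp
        also have "\<dots> \<le> e * 1 * norm h"
          using e K0 by (intro mult_right_mono mult_left_mono) auto
        finally show "norm ((\<Sum>i<n. c i * D i x h) - g' x h) \<le> e * norm h" by simp
      qed
    qed
    then obtain g where g: "\<And>x. x \<in> S \<Longrightarrow> (\<lambda>n. c n * f n x) sums (g x)"
      "\<And>x. x \<in> S \<Longrightarrow> (g has_derivative g' x) (at x within S)" by blast
    have zS: "z \<in> S" "open S" using r by (auto simp: S_def)
    have "(g has_derivative g' z) (at z)"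
      using g(2)[OF zS(1)] unfolding at_within_open[OF zS] .
    then have "((\<lambda>z. \<Sum>i. c i * f i z) has_derivative g' z) (at z)"
      by (rule has_derivative_transform_within_open[OF _ zS(2,1)]) (use g(1) in \<open>simp add: sums_iff\<close>)
    moreover have "g' z (a *s v) = a * g' z v" for a v
    proof -
      have "g' z (a *s v) = (\<Sum>i. a * (c i * D i z v))"
        unfolding g'_def D(2)[OF z] by (simp add: mult_ac)
      then show ?thesis
        unfolding g'_def using suminf_mult[OF summable_norm_cancel[OF smD[OF zS(1)]]] by simp
    qed
    ultimately show "\<exists>D. ((\<lambda>z. \<Sum>i. c i * f i z) has_derivative D) (at z) \<and> (\<forall>c v. D (c *s v) = c * D v)"
      by blast
  qed
qed

text \<open>A form of the triangle inequality for \<open>|\<cdot>|\<^sup>p\<close> that serves all \<open>p > 0\<close>: geometric weights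
  turn the sum into a supremum.\<close>

lemma powr_suminf_le:
  fixes a :: "nat \<Rightarrow> complex" and p :: real
  assumes p: "0 < p" and s: "a sums t"
  shows "ennreal (norm t powr p) \<le> (\<Sum>l. ennreal ((2 ^ (l + 1) * norm (a l)) powr p))"
proof -
  define b where "b = (\<lambda>l. ennreal ((2 ^ (l + 1) * norm (a l)) powr p))"
  define T where "T = suminf b"
  have Tl: "ennreal ((2 ^ (l + 1) * norm (a l)) powr p) \<le> T" for l
  proof -
    have "sum b {l} \<le> T" unfolding T_def by (rule sum_le_suminf) auto
    then show ?thesis by (simp add: b_def)
  qed
  have "ennreal (norm t powr p) \<le> T"
  proof (cases T rule: ennreal_cases)
  case (real S)
  define y where "y = S powr (1 / p)"
  have le: "norm (a l) \<le> y * (1 / 2) ^ (l + 1)" for l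
  proof -
    have "(2 ^ (l + 1) * norm (a l)) powr p \<le> S" using real Tl[of l] by simp
    then have "((2 ^ (l + 1) * norm (a l)) powr p) powr (1 / p) \<le> y"
      unfolding y_def using p by (intro powr_mono2) auto
    then have "2 ^ (l + 1) * norm (a l) \<le> y" using p by (simp add: powr_powr)
    then show ?thesis by (simp add: power_divide field_simps)
  qed
  have g: "(\<lambda>l. y * (1 / 2) ^ (l + 1)) sums y"
    using sums_mult[OF power_half_series, of y] by simp
  have sm: "summable (\<lambda>l. norm (a l))"
    by (rule summable_comparison_test'[OF sums_summable[OF g], of 0]) (use le in simp)
  then have "norm t \<le> (\<Sum>l. norm (a l))"
    using summable_norm[of a] s by (simp add: sums_iff)
  also have "\<dots> \<le> (\<Sum>l. y * (1 / 2) ^ (l + 1))"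
    by (intro suminf_le le sm sums_summable[OF g])
  also have "\<dots> = y" using g by (rule sums_unique[symmetric])
  finally have "norm t powr p \<le> y powr p" using p by (intro powr_mono2) auto
  also have "\<dots> = S" using p real(1) by (simp add: y_def powr_powr)
  finally show ?thesis using real by (simp add: ennreal_leI)
  qed simp
  then show ?thesis by (simp only: T_def b_def)
qed

text \<open>The completeness of \<open>A\<^sup>p\<^sub>\<alpha>\<close>, in the form in which uniform boundedness uses it: series with
  rapidly decreasing coefficients converge, with small tails, also for \<open>p < 1\<close>.\<close>

lemma bergman_series:
  fixes f :: "nat \<Rightarrow> complex ^ 'n \<Rightarrow> complex" and c :: "nat \<Rightarrow> complex" and p \<alpha> \<kappa> :: real
  assumes p: "0 < p" and \<alpha>: "-1 < \<alpha>" and \<kappa>: "0 < \<kappa>" "\<kappa> < 1" "(2 * \<kappa>) powr p \<le> 1 / 2"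
    and hol: "\<And>i. mv_holomorphic_on (f i) unit_ball"
    and f1: "\<And>i. bergman_mass p \<alpha> (f i) \<le> 1"
    and c: "\<And>i. norm (c i) \<le> \<kappa> ^ i"
  shows "mv_holomorphic_on (\<lambda>z. \<Sum>i. c i * f i z) unit_ball"
    and "(\<integral>\<^sup>+z. ennreal (norm ((\<Sum>i. c i * f i z) - (\<Sum>i<k. c i * f i z)) powr p) \<partial>nu_w \<alpha>)
      \<le> ennreal (2 * (2 * \<kappa> ^ k) powr p)"
proof -
  obtain C where C: "0 < C" "\<And>(f :: complex ^ 'n \<Rightarrow> complex) z u. mv_holomorphic_on f unit_ball \<Longrightarrow>
      z \<in> unit_ball \<Longrightarrow> u \<in> cball 0 (1/8) \<Longrightarrow> ennreal (norm (f (ball_chart z u)) powr p) \<le>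
       ennreal (C * defect z powr (- (CARD('n) + 1 + \<alpha>))) * local_mass p \<alpha> f z"
    using submean_nu_w[OF p \<alpha>, where 'n = 'n] by blast
  define \<gamma> where "\<gamma> = CARD('n) + 1 + \<alpha>"
  have \<gamma>: "0 < \<gamma>" using \<alpha> by (simp add: \<gamma>_def)
  have bound: "norm (f i z) \<le> (C * defect z powr (- \<gamma>)) powr (1 / p)" if z: "z \<in> unit_ball" for i z
  proof -
    have "ennreal (norm (f i z) powr p) \<le> ennreal (C * defect z powr (- \<gamma>)) * local_mass p \<alpha> (f i) z"
      using C(2)[OF hol z, of 0] unfolding \<gamma>_def by simp
    also have "\<dots> \<le> ennreal (C * defect z powr (- \<gamma>)) * 1"
      by (intro mult_left_mono order_trans[OF local_mass_le f1]) auto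
    finally have "norm (f i z) powr p \<le> C * defect z powr (- \<gamma>)" using C(1) by simp
    then have "(norm (f i z) powr p) powr (1 / p) \<le> (C * defect z powr (- \<gamma>)) powr (1 / p)"
      using p by (intro powr_mono2) auto
    then show ?thesis using p by (simp add: powr_powr)
  qed
  have bd: "\<exists>r>0. \<exists>M. ball z r \<subseteq> unit_ball \<and> (\<forall>i. \<forall>x\<in>ball z r. norm (f i x) \<le> M)"
    if z: "z \<in> unit_ball" for z
  proof -
    define r where "r = (1 - norm z) / 2"
    have r: "0 < r" using z by (simp add: r_def)
    have x: "norm x \<le> 1 - r" if "x \<in> ball z r" for x
      using that norm_triangle_ineq2[of x z] by (simp add: r_def dist_norm norm_minus_commute field_simps)
    have "norm (f i x) \<le> (C * r powr (- \<gamma>)) powr (1 / p)" if "x \<in> ball z r" for i x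
    proof -
      have nx: "norm x \<le> 1 - r" by (rule x[OF that])
      then have xB: "x \<in> unit_ball" using r by simp
      have "r \<le> 1 - norm x" using nx by simp
      also have "\<dots> \<le> defect x"
        using xB by (simp add: defect_def power2_eq_square mult_left_le)
      finally have "defect x powr (- \<gamma>) \<le> r powr (- \<gamma>)" using r \<gamma> by (intro powr_mono2') auto
      then have "(C * defect x powr (- \<gamma>)) powr (1 / p) \<le> (C * r powr (- \<gamma>)) powr (1 / p)"
        using C(1) p by (intro powr_mono2) (auto intro: mult_left_mono)
      then show ?thesis using bound[OF xB, of i] by simp
    qed
    moreover have "ball z r \<subseteq> unit_ball" using x r by force
    ultimately show ?thesis using r by blast
  qed
  have sc: "summable (\<lambda>i. norm (c i))"
    by (rule summable_comparison_test'[OF summable_geometric[of \<kappa>], of 0]) (use \<kappa> c in auto)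
  show "mv_holomorphic_on (\<lambda>z. \<Sum>i. c i * f i z) unit_ball"
    by (rule mv_holomorphic_series(1)[OF hol sc]) (rule bd)
  have sums: "(\<lambda>i. c i * f i z) sums (\<Sum>i. c i * f i z)" if "z \<in> unit_ball" for z
    by (rule mv_holomorphic_series(2)[OF hol sc _ that]) (rule bd)
  have [measurable]: "f i \<in> borel_measurable ball_borel" for i by (rule mv_holomorphic_borel_measurable[OF hol])
  have "(\<integral>\<^sup>+z. ennreal (norm ((\<Sum>i. c i * f i z) - (\<Sum>i<k. c i * f i z)) powr p) \<partial>nu_w \<alpha>) \<le>
      (\<integral>\<^sup>+z. (\<Sum>l. ennreal ((2 ^ (l + 1) * norm (c (l + k) * f (l + k) z)) powr p)) \<partial>nu_w \<alpha>)"
  proof (rule nn_integral_mono)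
    fix z :: "complex ^ 'n" assume "z \<in> space (nu_w \<alpha>)"
    then have "z \<in> unit_ball" by (simp add: space_nu_w)
    from sums_split_initial_segment[OF sums[OF this], of k]
    show "ennreal (norm ((\<Sum>i. c i * f i z) - (\<Sum>i<k. c i * f i z)) powr p) \<le>
        (\<Sum>l. ennreal ((2 ^ (l + 1) * norm (c (l + k) * f (l + k) z)) powr p))"
      by (rule powr_suminf_le[OF p])
  qed
  also have "\<dots> = (\<Sum>l. \<integral>\<^sup>+z. ennreal ((2 ^ (l + 1) * norm (c (l + k) * f (l + k) z)) powr p) \<partial>nu_w \<alpha>)"
    by (rule nn_integral_suminf) measurable
  also have "\<dots> \<le> (\<Sum>l. ennreal ((2 * \<kappa> ^ k) powr p * (1 / 2) ^ l))"
  proof (intro suminf_le summableI)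
    fix l
    have "(2 ^ (l + 1) * norm (c (l + k))) powr p \<le> (2 * \<kappa> ^ k) powr p * (1 / 2) ^ l"
    proof -
      have "(2 ^ (l + 1) * norm (c (l + k))) powr p \<le> (2 ^ (l + 1) * \<kappa> ^ (l + k)) powr p"
        using p c by (intro powr_mono2 mult_left_mono) auto
      also have "2 ^ (l + 1) * \<kappa> ^ (l + k) = (2 * \<kappa> ^ k) * (2 * \<kappa>) ^ l"
        by (simp add: power_add power_mult_distrib)
      also have "\<dots> powr p = (2 * \<kappa> ^ k) powr p * ((2 * \<kappa>) powr p) ^ l"
      proof -
        have "(y ^ l) powr p = (y powr p) ^ l" if "0 < y" for y :: real
          using that by (simp add: powr_powr mult.commute flip: powr_realpow)
        from this[of "2 * \<kappa>"] show ?thesis using \<kappa> powr_mult[of "2 * \<kappa> ^ k" "(2 * \<kappa>) ^ l" p] by simp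
      qed
      also have "\<dots> \<le> (2 * \<kappa> ^ k) powr p * (1 / 2) ^ l"
        using \<kappa> by (intro mult_left_mono power_mono) auto
      finally show ?thesis .
    qed
    then have le: "ennreal ((2 ^ (l + 1) * norm (c (l + k))) powr p) \<le> ennreal ((2 * \<kappa> ^ k) powr p * (1 / 2) ^ l)"
      by (rule ennreal_leI)
    have "(\<integral>\<^sup>+z. ennreal ((2 ^ (l + 1) * norm (c (l + k) * f (l + k) z)) powr p) \<partial>nu_w \<alpha>) =
       (\<integral>\<^sup>+z. ennreal ((2 ^ (l + 1) * norm (c (l + k))) powr p) * ennreal (norm (f (l + k) z) powr p) \<partial>nu_w \<alpha>)"
      by (intro nn_integral_cong) (simp add: norm_mult powr_mult ennreal_mult mult.assoc)
    also have "\<dots> = ennreal ((2 ^ (l + 1) * norm (c (l + k))) powr p) * bergman_mass p \<alpha> (f (l + k))"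
      by (rule nn_integral_cmult) measurable
    also have "\<dots> \<le> ennreal ((2 * \<kappa> ^ k) powr p * (1 / 2) ^ l) * 1"
      by (intro mult_mono le f1) auto
    finally show "(\<integral>\<^sup>+z. ennreal ((2 ^ (l + 1) * norm (c (l + k) * f (l + k) z)) powr p) \<partial>nu_w \<alpha>) \<le>
        ennreal ((2 * \<kappa> ^ k) powr p * (1 / 2) ^ l)" by simp
  qed
  also have "\<dots> = ennreal (2 * (2 * \<kappa> ^ k) powr p)"
  proof -
    have "(\<lambda>l. (2 * \<kappa> ^ k) powr p * (1 / 2) ^ l) sums ((2 * \<kappa> ^ k) powr p * (1 / (1 - 1 / 2)))"
      by (intro sums_mult geometric_sums) simp
    then show ?thesis by (subst suminf_ennreal_eq) (auto simp: mult.commute)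
  qed
  finally show "(\<integral>\<^sup>+z. ennreal (norm ((\<Sum>i. c i * f i z) - (\<Sum>i<k. c i * f i z)) powr p) \<partial>nu_w \<alpha>)
      \<le> ennreal (2 * (2 * \<kappa> ^ k) powr p)" .
qed

lemma nn_integral_cmult_norm_powr:
  fixes f :: "complex ^ 'n \<Rightarrow> complex"
  assumes "f \<in> borel_measurable ball_borel"
  shows "(\<integral>\<^sup>+z. ennreal (norm (c * f z) powr p) \<partial>nu_w \<alpha>) =
    ennreal (norm c powr p) * bergman_mass p \<alpha> f"
proof -
  note [measurable] = assms
  have "(\<integral>\<^sup>+z. ennreal (norm (c * f z) powr p) \<partial>nu_w \<alpha>) =
      (\<integral>\<^sup>+z. ennreal (norm c powr p) * ennreal (norm (f z) powr p) \<partial>nu_w \<alpha>)"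
    by (intro nn_integral_cong) (simp add: norm_mult powr_mult ennreal_mult)
  also have "\<dots> = ennreal (norm c powr p) * bergman_mass p \<alpha> f"
    by (rule nn_integral_cmult) measurable
  finally show ?thesis .
qed

text \<open>The uniform boundedness principle on \<open>A\<^sup>p\<^sub>\<alpha>\<close> for functionals that behave like \<open>\<parallel>\<cdot>\<parallel>\<^sup>q\<close>.
  The partial sums \<open>X\<^sub>k\<close> of a series are built by adding \<open>\<plusminus>\<kappa>\<^sup>k f\<^sub>k\<close>; one of the two signs makes
  \<open>N\<^sub>j(X\<^sub>k\<^sub>+\<^sub>1)\<close> at least half of \<open>N\<^sub>j(\<kappa>\<^sup>k f\<^sub>k)\<close>, and the tail of the series is too small to
  destroy this. Fixing the size of the terms in advance and choosing only the signs keeps the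
  selection of \<open>f\<^sub>k\<close> independent of the partial sums.\<close>

lemma bergman_uniform_boundedness:
  fixes N :: "nat \<Rightarrow> (complex ^ 'n \<Rightarrow> complex) \<Rightarrow> ennreal" and p q \<alpha> :: real
  assumes p: "0 < p" and q: "0 < q" and \<alpha>: "-1 < \<alpha>"
    and homog: "\<And>j c f. mv_holomorphic_on f unit_ball \<Longrightarrow> N j (\<lambda>z. c * f z) = ennreal (norm c powr q) * N j f"
    and quasi: "\<And>j f g. mv_holomorphic_on f unit_ball \<Longrightarrow> mv_holomorphic_on g unit_ball \<Longrightarrow>
      N j (\<lambda>z. f z + g z) \<le> ennreal (2 powr q) * (N j f + N j g)"
    and each: "\<And>j. \<exists>B. \<forall>f. mv_holomorphic_on f unit_ball \<longrightarrow>
      bergman_mass p \<alpha> f \<le> 1 \<longrightarrow> N j f \<le> ennreal B"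
    and pointwise: "\<And>f. f \<in> bergman_space p \<alpha> \<Longrightarrow> \<exists>Y. \<forall>j. N j f \<le> ennreal Y"
  shows "\<exists>X. \<forall>j f. mv_holomorphic_on f unit_ball \<longrightarrow>
      bergman_mass p \<alpha> f \<le> 1 \<longrightarrow> N j f \<le> ennreal X"
proof (rule ccontr)
  define U where "U = {f :: complex ^ 'n \<Rightarrow> complex. mv_holomorphic_on f unit_ball \<and>
      bergman_mass p \<alpha> f \<le> 1}"
  assume "\<nexists>X. \<forall>j f. mv_holomorphic_on f unit_ball \<longrightarrow>
      bergman_mass p \<alpha> f \<le> 1 \<longrightarrow> N j f \<le> ennreal X"
  then have unb: "\<exists>j. \<exists>f\<in>U. ennreal X < N j f" for X
    unfolding U_def not_le[symmetric] by blast
  define b where "b = (\<lambda>j. enn2real (SUP f\<in>U. N j f))"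
  have fin: "(SUP f\<in>U. N j f) = ennreal (b j)" for j
  proof -
    obtain B where "\<And>f. f \<in> U \<Longrightarrow> N j f \<le> ennreal B" using each[of j] unfolding U_def by blast
    then have "(SUP f\<in>U. N j f) \<le> ennreal B" by (rule SUP_least)
    then have "(SUP f\<in>U. N j f) < top" using le_less_trans ennreal_less_top by blast
    then show ?thesis by (simp add: b_def)
  qed
  have b0: "0 \<le> b j" for j by (simp add: b_def)
  have Nb: "N j f \<le> ennreal (b j)" if "f \<in> U" for j f
    unfolding fin[symmetric] by (rule SUP_upper[OF that])
  have pick: "\<exists>j f. f \<in> U \<and> G \<le> b j \<and> ennreal (b j / 2) \<le> N j f" for G
  proof -
    obtain j f where jf: "f \<in> U" "ennreal (max G 1) < N j f" using unb by blast
    then have "ennreal (max G 1) < ennreal (b j)" using Nb[OF jf(1)] less_le_trans by blast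
    then have G: "G \<le> b j" "0 < b j" by (auto simp: ennreal_less_iff)
    then have "ennreal (b j / 2) < (SUP f\<in>U. N j f)" unfolding fin by (simp add: ennreal_less_iff)
    then obtain f' where "f' \<in> U" "ennreal (b j / 2) < N j f'" unfolding less_SUP_iff by blast
    then show ?thesis using G less_imp_le by blast
  qed
  \<comment> \<open>\<open>\<kappa>\<close> is chosen such that the tails satisfy \<open>(2 (2\<kappa>)\<^sup>p)\<^bsup>q/p\<^esup> = 2\<^bsup>-q-3\<^esup>\<close>.\<close>
  define \<kappa> :: real where "\<kappa> = 2 powr (- (2 + 3 / q + 1 / p))"
  have \<kappa>0: "0 < \<kappa>" by (simp add: \<kappa>_def)
  have "0 < 3 / q" "0 < 1 / p" using p q by auto
  then have "- (2 + 3 / q + 1 / p) < 0" by linarith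
  then have "\<kappa> < 2 powr 0" unfolding \<kappa>_def by (intro powr_less_mono) auto
  then have \<kappa>1: "\<kappa> < 1" by simp
  have two\<kappa>: "2 * \<kappa> = 2 powr (- (1 + 3 / q + 1 / p))"
  proof -
    have "2 powr 1 * \<kappa> = 2 powr (- (1 + 3 / q + 1 / p))"
      unfolding \<kappa>_def powr_add[symmetric] by (rule arg_cong[where f = "\<lambda>e. 2 powr e"]) simp
    then show ?thesis by simp
  qed
  have \<kappa>p: "(2 * \<kappa>) powr p \<le> 1 / 2"
  proof -
    have "(2 * \<kappa>) powr p = 2 powr (- (p + 3 * p / q + 1))"
    proof -
      have "- (1 + 3 / q + 1 / p) * p = - (p + 3 * p / q + 1)" using p by (simp add: algebra_simps)
      then show ?thesis unfolding two\<kappa> powr_powr by (simp only:)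
    qed
    also have "\<dots> \<le> 2 powr (- 1)"
    proof (rule powr_mono)
      have "0 \<le> 3 * p / q" using p q by simp
      then show "- (p + 3 * p / q + 1) \<le> - 1" using p by linarith
    qed simp
    finally show ?thesis by (simp add: powr_minus)
  qed
  define \<tau> where "\<tau> = 2 * (2 * \<kappa>) powr p"
  have \<tau>0: "0 < \<tau>" using \<kappa>0 by (simp add: \<tau>_def)
  have \<tau>q: "\<tau> powr (q / p) = 2 powr (- q) / 8"
  proof -
    have "\<tau> powr (q / p) = 2 powr (q / p) * (2 * \<kappa>) powr q"
      unfolding \<tau>_def using \<kappa>0 p by (simp add: powr_mult powr_powr)
    also have "(2 * \<kappa>) powr q = 2 powr (- (q + 3 + q / p))"
    proof -
      have "- (1 + 3 / q + 1 / p) * q = - (q + 3 + q / p)" using q by (simp add: algebra_simps)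
      then show ?thesis unfolding two\<kappa> powr_powr by (simp only:)
    qed
    also have "2 powr (q / p) * 2 powr (- (q + 3 + q / p)) = 2 powr (- q + - 3)"
      unfolding powr_add[symmetric] by simp
    also have "\<dots> = 2 powr (- q) * 2 powr (- 3)" by (rule powr_add)
    also have "2 powr (- 3) = (1 / 8 :: real)" by (simp add: powr_minus)
    finally show ?thesis by simp
  qed
  obtain j f where f: "\<And>k :: nat. f k \<in> U" and G: "\<And>k. real k / (\<kappa> ^ k) powr q \<le> b (j k)"
    and half: "\<And>k. ennreal (b (j k) / 2) \<le> N (j k) (f k)"
  proof -
    have "\<forall>k :: nat. \<exists>x. snd x \<in> U \<and> real k / (\<kappa> ^ k) powr q \<le> b (fst x) \<and>
        ennreal (b (fst x) / 2) \<le> N (fst x) (snd x)"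
      using pick by (metis fst_conv snd_conv)
    then obtain x where "\<And>k :: nat. snd (x k) \<in> U \<and> real k / (\<kappa> ^ k) powr q \<le> b (fst (x k)) \<and>
        ennreal (b (fst (x k)) / 2) \<le> N (fst (x k)) (snd (x k))"
      unfolding choice_iff by blast
    then show ?thesis by (intro that[of "\<lambda>k. snd (x k)" "\<lambda>k. fst (x k)"]) auto
  qed
  have fhol: "mv_holomorphic_on (f k) unit_ball" for k using f by (simp add: U_def)
  have sign: "\<exists>c. norm c = \<kappa> ^ k \<and>
      ennreal ((\<kappa> ^ k) powr q * b (j k) / 4) \<le> N (j k) (\<lambda>z. x z + c * f k z)"
    if x: "mv_holomorphic_on x unit_ball" for x k
  proof (rule ccontr)
    define c where "c = complex_of_real (\<kappa> ^ k)"
    have nc: "norm c = \<kappa> ^ k" using \<kappa>0 by (simp add: c_def norm_power)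
    assume "\<nexists>c. norm c = \<kappa> ^ k \<and> ennreal ((\<kappa> ^ k) powr q * b (j k) / 4) \<le> N (j k) (\<lambda>z. x z + c * f k z)"
    then have lt: "N (j k) (\<lambda>z. x z + c' * f k z) < ennreal ((\<kappa> ^ k) powr q * b (j k) / 4)"
      if "norm c' = \<kappa> ^ k" for c' using that not_le by blast
    have hol: "mv_holomorphic_on (\<lambda>z. x z + c' * f k z) unit_ball" for c'
      by (intro mv_holomorphic_on_add mv_holomorphic_on_cmult x fhol)
    have "ennreal (2 powr q) * (ennreal ((\<kappa> ^ k) powr q) * N (j k) (f k)) = N (j k) (\<lambda>z. (2 * c) * f k z)"
      unfolding homog[OF fhol] norm_mult nc using \<kappa>0 by (simp add: powr_mult ennreal_mult mult.assoc)
    also have "(\<lambda>z. (2 * c) * f k z) = (\<lambda>z. (x z + c * f k z) + (- 1) * (x z + (- c) * f k z))"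
      by (simp add: fun_eq_iff algebra_simps)
    also have "N (j k) \<dots> \<le> ennreal (2 powr q) * (N (j k) (\<lambda>z. x z + c * f k z) + N (j k) (\<lambda>z. (- 1) * (x z + (- c) * f k z)))"
      by (rule quasi[OF hol mv_holomorphic_on_cmult[OF hol]])
    also have "N (j k) (\<lambda>z. (- 1) * (x z + (- c) * f k z)) = N (j k) (\<lambda>z. x z + (- c) * f k z)"
      unfolding homog[OF hol] by simp
    finally have "ennreal ((\<kappa> ^ k) powr q) * N (j k) (f k) \<le>
        N (j k) (\<lambda>z. x z + c * f k z) + N (j k) (\<lambda>z. x z + (- c) * f k z)"
      by (subst (asm) ennreal_mult_le_mult_iff) auto
    also have "\<dots> < ennreal ((\<kappa> ^ k) powr q * b (j k) / 4) + ennreal ((\<kappa> ^ k) powr q * b (j k) / 4)"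
      using lt[of c] lt[of "- c"] nc by (intro add_strict_mono) auto
    also have "\<dots> = ennreal ((\<kappa> ^ k) powr q) * ennreal (b (j k) / 2)"
      using b0 by (simp flip: ennreal_plus ennreal_mult)
    also have "\<dots> \<le> ennreal ((\<kappa> ^ k) powr q) * N (j k) (f k)"
      by (intro mult_left_mono half) simp
    finally show False by simp
  qed
  define step where "step = (\<lambda>x k. SOME c. norm c = \<kappa> ^ k \<and>
      ennreal ((\<kappa> ^ k) powr q * b (j k) / 4) \<le> N (j k) (\<lambda>z. x z + c * f k z))"
  define X where "X = rec_nat (\<lambda>_. 0) (\<lambda>k x z. x z + step x k * f k z)"
  have X: "X 0 = (\<lambda>_. 0)" "X (Suc k) = (\<lambda>z. X k z + step (X k) k * f k z)" for k
    by (simp_all add: X_def)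
  have Xhol: "mv_holomorphic_on (X k) unit_ball" for k
    by (induction k) (auto simp: X intro!: mv_holomorphic_on_add mv_holomorphic_on_cmult fhol)
  define c where "c = (\<lambda>k. step (X k) k)"
  have nc: "norm (c k) = \<kappa> ^ k" and big: "ennreal ((\<kappa> ^ k) powr q * b (j k) / 4) \<le> N (j k) (X (Suc k))" for k
    using someI_ex[OF sign[OF Xhol[of k], of k]] unfolding c_def step_def X by blast+
  have Xsum: "X k z = (\<Sum>i<k. c i * f i z)" for k z
    by (induction k) (simp_all add: X c_def)
  define F where "F = (\<lambda>z. \<Sum>i. c i * f i z)"
  have f1: "bergman_mass p \<alpha> (f i) \<le> 1" for i using f by (simp add: U_def)
  have nc': "norm (c k) \<le> \<kappa> ^ k" for k by (simp add: nc)
  note series = bergman_series[OF p \<alpha> \<kappa>0 \<kappa>1 \<kappa>p fhol f1 nc']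
  have Fhol: "mv_holomorphic_on F unit_ball" unfolding F_def by (rule series(1))
  have tail: "(\<integral>\<^sup>+z. ennreal (norm (F z - X k z) powr p) \<partial>nu_w \<alpha>) \<le> ennreal (2 * (2 * \<kappa> ^ k) powr p)" for k
    unfolding Xsum F_def by (rule series(2))
  have "F \<in> bergman_space p \<alpha>"
    using Fhol tail[of 0] le_less_trans[OF _ ennreal_less_top]
    by (auto simp: bergman_space_def X)
  then obtain Y where Y: "\<And>j. N j F \<le> ennreal Y" using pointwise by blast
  have "2 powr (- q) / 8 * real k \<le> max Y 0" for k
  proof -
    define B where "B = (\<kappa> ^ k) powr q * b (j k)"
    have B0: "0 \<le> B" using b0 by (simp add: B_def)
    define t where "t = (\<lambda>z. F z - X (Suc k) z)"
    have thol: "mv_holomorphic_on t unit_ball"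
      unfolding t_def by (intro mv_holomorphic_on_diff Fhol Xhol)
    define r where "r = \<kappa> ^ k * \<tau> powr (1 / p)"
    have r0: "0 < r" using \<kappa>0 \<tau>0 by (simp add: r_def)
    define g where "g = (\<lambda>z. complex_of_real (1 / r) * t z)"
    have "g \<in> U"
    proof -
      have "bergman_mass p \<alpha> g = ennreal ((1 / r) powr p) * bergman_mass p \<alpha> t"
        unfolding g_def nn_integral_cmult_norm_powr[OF mv_holomorphic_borel_measurable[OF thol]]
        using r0 by (simp add: norm_divide)
      also have "\<dots> \<le> ennreal ((1 / r) powr p) * ennreal (2 * (2 * \<kappa> ^ Suc k) powr p)"
        unfolding t_def by (intro mult_left_mono tail) simp
      also have "2 * (2 * \<kappa> ^ Suc k) powr p = r powr p"
      proof -
        have "2 * (2 * \<kappa> ^ Suc k) powr p = (\<kappa> ^ k) powr p * (2 * (2 * \<kappa>) powr p)"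
          using \<kappa>0 by (simp add: powr_mult)
        also have "\<dots> = r powr p"
          unfolding r_def using \<kappa>0 \<tau>0 p by (simp add: powr_mult powr_powr \<tau>_def)
        finally show ?thesis .
      qed
      also have "ennreal ((1 / r) powr p) * ennreal (r powr p) = 1"
        using r0 by (simp add: powr_divide flip: ennreal_mult)
      finally have "bergman_mass p \<alpha> g \<le> 1" .
      moreover have "mv_holomorphic_on g unit_ball"
        unfolding g_def by (rule mv_holomorphic_on_cmult[OF thol])
      ultimately show ?thesis unfolding U_def by blast
    qed
    have "X (Suc k) = (\<lambda>z. F z + complex_of_real (- r) * g z)"
      using r0 by (simp add: g_def t_def fun_eq_iff)
    then have "N (j k) (X (Suc k)) \<le> ennreal (2 powr q) * (N (j k) F + N (j k) (\<lambda>z. complex_of_real (- r) * g z))"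
      using \<open>g \<in> U\<close> by (auto simp only: U_def mem_Collect_eq intro!: quasi Fhol mv_holomorphic_on_cmult)
    also have "N (j k) (\<lambda>z. complex_of_real (- r) * g z) = ennreal (r powr q) * N (j k) g"
      using homog[of g "j k" "complex_of_real (- r)"] \<open>g \<in> U\<close> r0 by (simp add: U_def)
    also have "ennreal (2 powr q) * (N (j k) F + ennreal (r powr q) * N (j k) g) \<le>
        ennreal (2 powr q) * (ennreal (max Y 0) + ennreal (r powr q) * ennreal (b (j k)))"
    proof -
      have "N (j k) F \<le> ennreal (max Y 0)" by (rule order_trans[OF Y[of "j k"] ennreal_leI]) simp
      then show ?thesis by (intro mult_left_mono add_mono Nb \<open>g \<in> U\<close>) auto
    qed
    also have "\<dots> = ennreal (2 powr q * (max Y 0 + r powr q * b (j k)))"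
      using b0 by (simp flip: ennreal_mult ennreal_plus)
    also have "r powr q * b (j k) = B * (2 powr (- q) / 8)"
      unfolding r_def B_def \<tau>q[symmetric] using \<kappa>0 \<tau>0 by (simp add: powr_mult powr_powr)
    finally have "ennreal (B / 4) \<le> ennreal (2 powr q * (max Y 0 + B * (2 powr (- q) / 8)))"
      using big[of k] unfolding B_def by (rule order_trans[rotated])
    then have "B / 4 \<le> 2 powr q * (max Y 0 + B * (2 powr (- q) / 8))"
      using B0 by (subst (asm) ennreal_le_iff) auto
    also have "\<dots> = 2 powr q * max Y 0 + B / 8" by (simp add: powr_minus field_simps)
    finally have "B / 8 \<le> 2 powr q * max Y 0" by simp
    then have "2 powr (- q) / 8 * B \<le> max Y 0" by (simp add: powr_minus field_simps)
    moreover have "real k \<le> B" using G[of k] \<kappa>0 by (simp add: B_def divide_le_eq mult.commute)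
    then have "2 powr (- q) / 8 * real k \<le> 2 powr (- q) / 8 * B" by (intro mult_left_mono) auto
    ultimately show ?thesis by linarith
  qed
  then have "real k \<le> max Y 0 / (2 powr (- q) / 8)" for k
    by (simp add: field_simps)
  then show False by (meson not_le reals_Archimedean2)
qed

section \<open>The joint pull-back measure\<close>

abbreviation comp_diff :: "(complex ^ 'n \<Rightarrow> complex ^ 'n) \<Rightarrow> (complex ^ 'n \<Rightarrow> complex ^ 'n) \<Rightarrow>
    (complex ^ 'n \<Rightarrow> complex) \<Rightarrow> complex ^ 'n \<Rightarrow> complex" where
  "comp_diff \<phi> \<psi> f \<equiv> \<lambda>z. f (\<phi> z) - f (\<psi> z)"

lemma sets_joint_pullback:
  fixes \<phi> \<psi> :: "complex ^ 'n \<Rightarrow> complex ^ 'n"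
  shows "sets (joint_pullback \<beta> q \<phi> \<psi>) = sets ball_borel"
  unfolding joint_pullback_def
  using sets.sigma_sets_eq[of "ball_borel :: (complex ^ 'n) measure"] sets.space_closed[of "ball_borel :: (complex ^ 'n) measure"]
  by (simp add: sets_measure_of space_ball_borel)

lemma nn_integral_joint_pullback:
  fixes \<phi> \<psi> :: "complex ^ 'n \<Rightarrow> complex ^ 'n"
  assumes \<phi>: "holomorphic_self_map \<phi>" and \<psi>: "holomorphic_self_map \<psi>"
    and h: "h \<in> borel_measurable ball_borel"
  shows "(\<integral>\<^sup>+w. h w \<partial>joint_pullback \<beta> q \<phi> \<psi>) =
    (\<integral>\<^sup>+z. (h (\<phi> z) + h (\<psi> z)) * ennreal (pseudo_hyp_dist (\<phi> z) (\<psi> z) powr q) \<partial>nu_w \<beta>)"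
proof -
  define \<omega> where "\<omega> = joint_pullback \<beta> q \<phi> \<psi>"
  define \<rho> where "\<rho> = (\<lambda>z. ennreal (pseudo_hyp_dist (\<phi> z) (\<psi> z) powr q))"
  have sets: "sets \<omega> = sets ball_borel" unfolding \<omega>_def by (rule sets_joint_pullback)
  have [measurable]: "\<phi> \<in> measurable ball_borel ball_borel" "\<psi> \<in> measurable ball_borel ball_borel"
    using \<phi> \<psi> by (simp_all add: holomorphic_self_map_measurable)
  have [measurable]: "\<rho> \<in> borel_measurable ball_borel"
    using pseudo_hyp_dist_measurable[OF \<phi> \<psi>] unfolding \<rho>_def by measurable
  have sp: "\<phi> z \<in> unit_ball" "\<psi> z \<in> unit_ball" if "z \<in> unit_ball" for z
    using \<phi> \<psi> that unfolding holomorphic_self_map_def by blast+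
  have space: "space \<omega> = unit_ball" using sets_eq_imp_space_eq[OF sets] by (simp add: space_ball_borel)
  have "h \<in> borel_measurable \<omega>" using h by (simp add: measurable_cong_sets[OF sets refl])
  then have "(\<integral>\<^sup>+w. h w \<partial>\<omega>) = (\<integral>\<^sup>+z. (h (\<phi> z) + h (\<psi> z)) * \<rho> z \<partial>nu_w \<beta>)"
  proof (induction rule: borel_measurable_induct)
    case (cong f g)
    have "(\<integral>\<^sup>+w. f w \<partial>\<omega>) = (\<integral>\<^sup>+w. g w \<partial>\<omega>)" by (intro nn_integral_cong cong)
    moreover have "(\<integral>\<^sup>+z. (f (\<phi> z) + f (\<psi> z)) * \<rho> z \<partial>nu_w \<beta>) = (\<integral>\<^sup>+z. (g (\<phi> z) + g (\<psi> z)) * \<rho> z \<partial>nu_w \<beta>)"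
    proof (rule nn_integral_cong)
      fix z :: "complex ^ 'n" assume "z \<in> space (nu_w \<beta>)"
      then have "z \<in> unit_ball" by (simp add: space_nu_w)
      then have "f (\<phi> z) = g (\<phi> z)" "f (\<psi> z) = g (\<psi> z)" by (auto intro!: cong(3) sp simp only: space)
      then show "(f (\<phi> z) + f (\<psi> z)) * \<rho> z = (g (\<phi> z) + g (\<psi> z)) * \<rho> z" by simp
    qed
    ultimately show ?case using cong by simp
  next
    case (set A)
    then have A[measurable]: "A \<in> sets ball_borel" by (simp add: sets)
    have "(\<integral>\<^sup>+w. indicator A w \<partial>\<omega>) = emeasure \<omega> A" using set by simp
    also have "\<dots> = (\<integral>\<^sup>+z. \<rho> z * indicator (\<phi> -` A) z \<partial>nu_w \<beta>) + (\<integral>\<^sup>+z. \<rho> z * indicator (\<psi> -` A) z \<partial>nu_w \<beta>)"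
      unfolding \<omega>_def \<rho>_def by (rule emeasure_joint_pullback[OF \<phi> \<psi> A])
    also have "\<dots> = (\<integral>\<^sup>+z. indicator A (\<phi> z) * \<rho> z \<partial>nu_w \<beta>) + (\<integral>\<^sup>+z. indicator A (\<psi> z) * \<rho> z \<partial>nu_w \<beta>)"
      by (intro arg_cong2[where f = "(+)"] nn_integral_cong) (auto simp: indicator_def)
    also have "\<dots> = (\<integral>\<^sup>+z. indicator A (\<phi> z) * \<rho> z + indicator A (\<psi> z) * \<rho> z \<partial>nu_w \<beta>)"
      by (rule nn_integral_add[symmetric]) measurable
    finally show ?case by (simp add: distrib_right)
  next
    case (mult f c)
    then have [measurable]: "f \<in> borel_measurable ball_borel" by (simp add: measurable_cong_sets[OF sets refl])
    have "(\<integral>\<^sup>+z. (c * f (\<phi> z) + c * f (\<psi> z)) * \<rho> z \<partial>nu_w \<beta>) = (\<integral>\<^sup>+z. c * ((f (\<phi> z) + f (\<psi> z)) * \<rho> z) \<partial>nu_w \<beta>)"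
      by (intro nn_integral_cong) (simp add: distrib_left distrib_right mult.assoc)
    also have "\<dots> = c * (\<integral>\<^sup>+z. (f (\<phi> z) + f (\<psi> z)) * \<rho> z \<partial>nu_w \<beta>)"
      by (rule nn_integral_cmult) measurable
    finally show ?case using mult by (simp add: nn_integral_cmult)
  next
    case (add f g)
    then have [measurable]: "f \<in> borel_measurable ball_borel" "g \<in> borel_measurable ball_borel"
      by (simp_all add: measurable_cong_sets[OF sets refl])
    have "(\<integral>\<^sup>+z. ((f (\<phi> z) + g (\<phi> z)) + (f (\<psi> z) + g (\<psi> z))) * \<rho> z \<partial>nu_w \<beta>) =
        (\<integral>\<^sup>+z. (f (\<phi> z) + f (\<psi> z)) * \<rho> z + (g (\<phi> z) + g (\<psi> z)) * \<rho> z \<partial>nu_w \<beta>)"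
      by (intro nn_integral_cong) (simp only: distrib_right add_ac)
    also have "\<dots> = (\<integral>\<^sup>+z. (f (\<phi> z) + f (\<psi> z)) * \<rho> z \<partial>nu_w \<beta>) + (\<integral>\<^sup>+z. (g (\<phi> z) + g (\<psi> z)) * \<rho> z \<partial>nu_w \<beta>)"
      by (rule nn_integral_add) measurable
    finally show ?case using add by (simp add: nn_integral_add add.commute)
  next
    case (seq U)
    then have [measurable]: "U i \<in> borel_measurable ball_borel" for i by (simp add: measurable_cong_sets[OF sets refl])
    have inc: "incseq (\<lambda>i. U i x)" for x using seq(3) by (auto simp: incseq_def le_fun_def)
    have "(\<integral>\<^sup>+w. (SUP i. U i) w \<partial>\<omega>) = (\<integral>\<^sup>+w. (SUP i. U i w) \<partial>\<omega>)" by (simp add: SUP_apply image_comp)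
    also have "\<dots> = (SUP i. \<integral>\<^sup>+w. U i w \<partial>\<omega>)"
      using seq(3) by (intro nn_integral_monotone_convergence_SUP seq(1)) 
    also have "\<dots> = (SUP i. \<integral>\<^sup>+z. (U i (\<phi> z) + U i (\<psi> z)) * \<rho> z \<partial>nu_w \<beta>)" using seq by simp
    also have "\<dots> = (\<integral>\<^sup>+z. (SUP i. (U i (\<phi> z) + U i (\<psi> z)) * \<rho> z) \<partial>nu_w \<beta>)"
      using inc by (intro nn_integral_monotone_convergence_SUP[symmetric])
        (auto simp: incseq_def le_fun_def intro!: mult_right_mono add_mono)
    also have "\<dots> = (\<integral>\<^sup>+z. ((SUP i. U i) (\<phi> z) + (SUP i. U i) (\<psi> z)) * \<rho> z \<partial>nu_w \<beta>)"
    proof (rule nn_integral_cong)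
      fix z
      have "(SUP i. (U i (\<phi> z) + U i (\<psi> z)) * \<rho> z) = (SUP i. U i (\<phi> z) + U i (\<psi> z)) * \<rho> z"
        by (rule SUP_mult_right_ennreal[symmetric])
      also have "(SUP i. U i (\<phi> z) + U i (\<psi> z)) = (SUP i. U i (\<phi> z)) + (SUP i. U i (\<psi> z))"
        by (rule ennreal_SUP_add[OF inc inc])
      finally show "(SUP i. (U i (\<phi> z) + U i (\<psi> z)) * \<rho> z) =
          ((SUP i. U i) (\<phi> z) + (SUP i. U i) (\<psi> z)) * \<rho> z" by (simp add: SUP_apply image_comp)
    qed
    finally show ?case .
  qed
  then show ?thesis by (simp add: \<omega>_def \<rho>_def)
qed

lemma finite_measure_joint_pullback:
  fixes \<phi> \<psi> :: "complex ^ 'n \<Rightarrow> complex ^ 'n"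
  assumes \<phi>: "holomorphic_self_map \<phi>" and \<psi>: "holomorphic_self_map \<psi>" and \<beta>: "-1 < \<beta>" and q: "0 < q"
  shows "finite_measure (joint_pullback \<beta> q \<phi> \<psi>)"
proof
  interpret N: finite_measure "nu_w \<beta> :: (complex ^ 'n) measure" by (rule finite_measure_nu_w[OF \<beta>])
  let ?\<omega> = "joint_pullback \<beta> q \<phi> \<psi>"
  have "emeasure ?\<omega> (space ?\<omega>) = (\<integral>\<^sup>+w. 1 \<partial>?\<omega>)" by simp
  also have "\<dots> = (\<integral>\<^sup>+z. (1 + 1) * ennreal (pseudo_hyp_dist (\<phi> z) (\<psi> z) powr q) \<partial>nu_w \<beta>)"
    by (rule nn_integral_joint_pullback[OF \<phi> \<psi>]) simp
  also have "\<dots> \<le> (\<integral>\<^sup>+z. 2 \<partial>(nu_w \<beta> :: (complex ^ 'n) measure))"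
  proof (rule nn_integral_mono)
    fix z :: "complex ^ 'n" assume "z \<in> space (nu_w \<beta>)"
    then have "\<phi> z \<in> unit_ball" "\<psi> z \<in> unit_ball"
      using \<phi> \<psi> unfolding holomorphic_self_map_def space_nu_w by blast+
    then have "pseudo_hyp_dist (\<phi> z) (\<psi> z) powr q \<le> 1"
      using q by (intro powr_le1) (auto intro: less_imp_le pseudo_hyp_dist_less_1[unfolded mem_ball_0])
    then have "ennreal (pseudo_hyp_dist (\<phi> z) (\<psi> z) powr q) \<le> 1" by simp
    then have "(1 + 1) * ennreal (pseudo_hyp_dist (\<phi> z) (\<psi> z) powr q) \<le> (1 + 1) * 1"
      by (rule mult_left_mono) simp
    then show "(1 + 1) * ennreal (pseudo_hyp_dist (\<phi> z) (\<psi> z) powr q) \<le> 2" by simp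
  qed
  also have "\<dots> < \<infinity>" using N.emeasure_finite[of "space (nu_w \<beta>)"]
    by (simp add: ennreal_mult_eq_top_iff less_top[symmetric])
  finally show "emeasure ?\<omega> (space ?\<omega>) \<noteq> \<infinity>" by simp
qed

lemma borel_measurable_local_mass:
  fixes f :: "complex ^ 'n \<Rightarrow> complex"
  assumes \<alpha>: "-1 < \<alpha>" and [measurable]: "f \<in> borel_measurable ball_borel"
  shows "local_mass p \<alpha> f \<in> borel_measurable ball_borel"
proof -
  let ?\<nu> = "nu_w \<alpha> :: (complex ^ 'n) measure"
  let ?b = "ball_borel :: (complex ^ 'n) measure"
  interpret N: finite_measure ?\<nu> by (rule finite_measure_nu_w[OF \<alpha>])
  have [measurable]: "fst \<in> measurable (?b \<Otimes>\<^sub>M ?\<nu>) ball_borel" "snd \<in> measurable (?b \<Otimes>\<^sub>M ?\<nu>) ball_borel"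
    using measurable_fst[of ?b ?\<nu>] measurable_snd[of ?b ?\<nu>] measurable_cong_sets[OF refl sets_nu_w[of \<alpha>]] by blast+
  have [measurable]: "(\<lambda>x. indicator (bergman_ball (fst x)) (snd x) :: ennreal) \<in> borel_measurable (?b \<Otimes>\<^sub>M ?\<nu>)"
    by (rule borel_measurable_indicator_bergman_ball) measurable
  show ?thesis
    unfolding local_mass_def
    by (rule N.borel_measurable_nn_integral) (simp add: split_beta', measurable)
qed

text \<open>Integrating \<open>pointwise_local_mass\<close> leads in both cases to
  \<open>\<integral> (1 - |z|\<^sup>2)\<^bsup>-e\<^esup> (local mass of f at z) d\<omega>\<close>, which \<open>nn_integral_local_mass_le\<close> bounds.\<close>

lemma upper_estimate:
  fixes p q \<alpha> s :: real
  assumes p: "0 < p" and pq: "p \<le> q" and \<alpha>: "-1 < \<alpha>" and s: "0 < s"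
  defines "e \<equiv> (CARD('n) + 1 + \<alpha>) * (q / p)"
  shows "\<exists>C>0. \<forall>(f :: complex ^ 'n \<Rightarrow> complex) P. mv_holomorphic_on f unit_ball \<longrightarrow> 0 \<le> P \<longrightarrow>
    bergman_mass p \<alpha> f \<le> ennreal P \<longrightarrow>
    (\<forall>\<omega>. sets \<omega> = sets ball_borel \<longrightarrow> finite_measure \<omega> \<longrightarrow>
      (\<integral>\<^sup>+w. ennreal (norm (f w) powr q) \<partial>\<omega>) \<le>
        ennreal (C * P powr (q / p)) * carleson_sup s e \<omega>) \<and>
    (\<forall>\<phi> \<psi> \<beta>. holomorphic_self_map \<phi> \<longrightarrow> holomorphic_self_map \<psi> \<longrightarrow> -1 < \<beta> \<longrightarrow>
      bergman_mass q \<beta> (comp_diff \<phi> \<psi> f) \<le>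
        ennreal (C * P powr (q / p)) *
          carleson_sup s e (joint_pullback \<beta> q \<phi> \<psi>))"
proof -
  have q: "0 < q" and e: "0 < e" using p pq \<alpha> by (auto simp: e_def intro!: mult_pos_pos)
  obtain c where c: "0 < c" "\<And>(f :: complex ^ 'n \<Rightarrow> complex) P. mv_holomorphic_on f unit_ball \<Longrightarrow> 0 \<le> P \<Longrightarrow>
    bergman_mass p \<alpha> f \<le> ennreal P \<Longrightarrow>
    (\<forall>z\<in>unit_ball. ennreal (norm (f z) powr q) \<le>
        ennreal (c * P powr (q / p - 1)) * (ennreal (defect z powr (- e)) * local_mass p \<alpha> f z)) \<and>
    (\<forall>z\<in>unit_ball. \<forall>w\<in>unit_ball. ennreal (norm (f z - f w) powr q) \<le>
        ennreal (c * P powr (q / p - 1)) * ((ennreal (defect z powr (- e)) * local_mass p \<alpha> f z +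
          ennreal (defect w powr (- e)) * local_mass p \<alpha> f w) * ennreal (pseudo_hyp_dist z w powr q)))"
    using pointwise_local_mass[OF p pq \<alpha>, where 'n = 'n] unfolding e_def by blast
  define k where "k = 4 powr e * 2 powr (e + s)"
  define C where "C = c * k"
  have C: "0 < C" "0 \<le> k" using c by (auto simp: C_def k_def)
  have "(\<forall>\<omega>. sets \<omega> = sets ball_borel \<longrightarrow> finite_measure \<omega> \<longrightarrow>
      (\<integral>\<^sup>+w. ennreal (norm (f w) powr q) \<partial>\<omega>) \<le>
        ennreal (C * P powr (q / p)) * carleson_sup s e \<omega>) \<and>
    (\<forall>\<phi> \<psi> \<beta>. holomorphic_self_map \<phi> \<longrightarrow> holomorphic_self_map \<psi> \<longrightarrow> -1 < \<beta> \<longrightarrow>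
      bergman_mass q \<beta> (comp_diff \<phi> \<psi> f) \<le>
        ennreal (C * P powr (q / p)) *
          carleson_sup s e (joint_pullback \<beta> q \<phi> \<psi>))"
    if f: "mv_holomorphic_on f unit_ball" and P: "0 \<le> P" "bergman_mass p \<alpha> f \<le> ennreal P"
    for f :: "complex ^ 'n \<Rightarrow> complex" and P
  proof -
    have [measurable]: "f \<in> borel_measurable ball_borel" by (rule mv_holomorphic_borel_measurable[OF f])
    define g where "g = (\<lambda>z. ennreal (defect z powr (- e)) * local_mass p \<alpha> f z)"
    note [measurable] = borel_measurable_local_mass[OF \<alpha> \<open>f \<in> borel_measurable ball_borel\<close>]
    have [measurable]: "g \<in> borel_measurable ball_borel" unfolding g_def by measurable
    have powP: "P powr (q / p - 1) * P = P powr (q / p)"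
      using P(1) pq p powr_mult_base[of P "q / p - 1"] by (cases "P = 0") (auto simp: mult.commute)
    have bound: "ennreal (c * P powr (q / p - 1)) * (\<integral>\<^sup>+z. g z \<partial>\<omega>) \<le>
        ennreal (C * P powr (q / p)) * carleson_sup s e \<omega>"
      if "sets \<omega> = sets ball_borel" "finite_measure \<omega>" for \<omega> :: "(complex ^ 'n) measure"
    proof -
      define S where "S = carleson_sup s e \<omega>"
      have "(\<integral>\<^sup>+z. g z \<partial>\<omega>) \<le> ennreal k * S * bergman_mass p \<alpha> f"
        unfolding g_def S_def k_def by (rule nn_integral_local_mass_le[OF that \<alpha> f e s])
      also have "\<dots> \<le> ennreal k * S * ennreal P" by (rule mult_left_mono[OF P(2)]) simp
      finally have "ennreal (c * P powr (q / p - 1)) * (\<integral>\<^sup>+z. g z \<partial>\<omega>) \<le>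
          ennreal (c * P powr (q / p - 1)) * (ennreal k * S * ennreal P)" by (rule mult_left_mono) simp
      also have "\<dots> = ennreal (c * P powr (q / p - 1)) * ennreal k * ennreal P * S" by (simp only: mult_ac)
      also have "ennreal (c * P powr (q / p - 1)) * ennreal k * ennreal P = ennreal (c * P powr (q / p - 1) * k * P)"
        using c(1) C P(1) by (simp flip: ennreal_mult)
      also have "c * P powr (q / p - 1) * k * P = C * P powr (q / p)"
        unfolding C_def powP[symmetric] by simp
      finally show ?thesis unfolding S_def .
    qed
    show ?thesis
    proof (intro conjI allI impI)
      fix \<omega> :: "(complex ^ 'n) measure"
      assume sets: "sets \<omega> = sets ball_borel" and fin: "finite_measure \<omega>"
      have space: "space \<omega> = unit_ball" using sets_eq_imp_space_eq[OF sets] by (simp add: space_ball_borel)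
      note [measurable_cong] = sets
      have "(\<integral>\<^sup>+w. ennreal (norm (f w) powr q) \<partial>\<omega>) \<le> (\<integral>\<^sup>+w. ennreal (c * P powr (q / p - 1)) * g w \<partial>\<omega>)"
        unfolding g_def using c(2)[OF f P] by (intro nn_integral_mono) (simp add: space)
      also have "\<dots> = ennreal (c * P powr (q / p - 1)) * (\<integral>\<^sup>+w. g w \<partial>\<omega>)"
        by (rule nn_integral_cmult) measurable
      also note bound[OF sets fin]
      finally show "(\<integral>\<^sup>+w. ennreal (norm (f w) powr q) \<partial>\<omega>) \<le>
        ennreal (C * P powr (q / p)) * carleson_sup s e \<omega>" .
    next
      fix \<phi> \<psi> :: "complex ^ 'n \<Rightarrow> complex ^ 'n" and \<beta> :: real
      assume \<phi>: "holomorphic_self_map \<phi>" and \<psi>: "holomorphic_self_map \<psi>" and \<beta>: "-1 < \<beta>"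
      have [measurable]: "\<phi> \<in> measurable ball_borel ball_borel" "\<psi> \<in> measurable ball_borel ball_borel"
        "(\<lambda>z. pseudo_hyp_dist (\<phi> z) (\<psi> z)) \<in> borel_measurable ball_borel"
        using \<phi> \<psi> by (simp_all add: holomorphic_self_map_measurable pseudo_hyp_dist_measurable)
      have sp: "\<phi> z \<in> unit_ball" "\<psi> z \<in> unit_ball" if "z \<in> unit_ball" for z
        using \<phi> \<psi> that unfolding holomorphic_self_map_def by blast+
      have "bergman_mass q \<beta> (comp_diff \<phi> \<psi> f) \<le>
          (\<integral>\<^sup>+z. ennreal (c * P powr (q / p - 1)) *
            ((g (\<phi> z) + g (\<psi> z)) * ennreal (pseudo_hyp_dist (\<phi> z) (\<psi> z) powr q)) \<partial>nu_w \<beta>)"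
      proof (rule nn_integral_mono)
        fix z :: "complex ^ 'n" assume "z \<in> space (nu_w \<beta>)"
        then have "z \<in> unit_ball" by (simp add: space_nu_w)
        then show "ennreal (norm (f (\<phi> z) - f (\<psi> z)) powr q) \<le> ennreal (c * P powr (q / p - 1)) *
            ((g (\<phi> z) + g (\<psi> z)) * ennreal (pseudo_hyp_dist (\<phi> z) (\<psi> z) powr q))"
          using c(2)[OF f P] sp unfolding g_def by blast
      qed
      also have "\<dots> = ennreal (c * P powr (q / p - 1)) *
          (\<integral>\<^sup>+z. (g (\<phi> z) + g (\<psi> z)) * ennreal (pseudo_hyp_dist (\<phi> z) (\<psi> z) powr q) \<partial>nu_w \<beta>)"
        by (rule nn_integral_cmult) measurable
      also have "(\<integral>\<^sup>+z. (g (\<phi> z) + g (\<psi> z)) * ennreal (pseudo_hyp_dist (\<phi> z) (\<psi> z) powr q) \<partial>nu_w \<beta>) =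
          (\<integral>\<^sup>+w. g w \<partial>joint_pullback \<beta> q \<phi> \<psi>)"
        by (rule nn_integral_joint_pullback[OF \<phi> \<psi>, symmetric]) measurable
      also note bound[OF sets_joint_pullback finite_measure_joint_pullback[OF \<phi> \<psi> \<beta> q]]
      finally show "bergman_mass q \<beta> (comp_diff \<phi> \<psi> f) \<le>
        ennreal (C * P powr (q / p)) *
          carleson_sup s e (joint_pullback \<beta> q \<phi> \<psi>)" .
    qed
  qed
  then show ?thesis using C(1) by (intro exI[of _ C]) blast
qed

lemma powr_sum_le:
  fixes d :: "'i::finite \<Rightarrow> real"
  assumes d: "\<And>i. 0 \<le> d i" and q: "0 < q"
  shows "(\<Sum>i\<in>UNIV. d i) powr q \<le> real CARD('i) powr q * (\<Sum>i\<in>UNIV. d i powr q)"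
proof -
  define M where "M = Max (range d)"
  have M: "d i \<le> M" for i by (simp add: M_def)
  have "M \<in> range d" unfolding M_def by (intro Max_in) auto
  then obtain i where i: "M = d i" by blast
  have "(\<Sum>i\<in>UNIV. d i) \<le> real CARD('i) * M"
    using sum_bounded_above[of UNIV d M] M by simp
  then have "(\<Sum>i\<in>UNIV. d i) powr q \<le> (real CARD('i) * M) powr q"
    using q d by (intro powr_mono2 sum_nonneg) auto
  also have "\<dots> = real CARD('i) powr q * d i powr q" using d by (simp add: i powr_mult)
  also have "d i powr q \<le> (\<Sum>i\<in>UNIV. d i powr q)" by (intro member_le_sum) auto
  finally show ?thesis by (simp add: mult_left_mono)
qed

text \<open>By \<open>pseudo_hyp_dist_le_test_family\<close> the density \<open>\<rho>\<^sup>q\<close> of \<open>\<omega>\<close> is dominated, wherever \<open>\<phi>\<close> or \<open>\<psi>\<close>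
  takes values in \<open>D(a)\<close>, by the \<open>q\<close>-th powers of the images of the test functions under the
  operator.\<close>

lemma lower_estimate:
  fixes p q \<alpha> :: real
  assumes p: "0 < p" and q: "0 < q" and \<alpha>: "-1 < \<alpha>"
  shows "\<exists>C>0. \<forall>(\<phi> :: complex ^ 'n \<Rightarrow> complex ^ 'n) \<psi> \<beta> X. holomorphic_self_map \<phi> \<longrightarrow> holomorphic_self_map \<psi> \<longrightarrow> 0 \<le> X \<longrightarrow>
    (\<forall>f. mv_holomorphic_on f unit_ball \<longrightarrow> bergman_mass p \<alpha> f \<le> 1 \<longrightarrow>
      bergman_mass q \<beta> (comp_diff \<phi> \<psi> f) \<le> ennreal X) \<longrightarrow>
    (\<forall>a\<in>unit_ball. emeasure (joint_pullback \<beta> q \<phi> \<psi>) (bergman_ball a) \<le>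
      ennreal (C * X * defect a powr ((CARD('n) + 1 + \<alpha>) * (q / p))))"
proof -
  define \<gamma> where "\<gamma> = CARD('n) + 1 + \<alpha>"
  obtain m :: nat where "\<gamma> / p < m" using reals_Archimedean2 by blast
  then have m: "CARD('n) + 1 + \<alpha> < m * p" using p by (simp add: \<gamma>_def field_simps)
  from test_fun_mass_le[OF p \<alpha> m] obtain c where c: "0 < c" "\<forall>(a :: complex ^ 'n)\<in>unit_ball. \<forall>G.
    (\<forall>z\<in>unit_ball. norm (G z) \<le> norm (test_fun a m z)) \<longrightarrow>
    (\<integral>\<^sup>+z. ennreal (norm (G z :: complex) powr p) \<partial>nu_w \<alpha>) \<le> ennreal (c * defect a powr \<gamma>)"
    unfolding \<gamma>_def by (elim exE conjE)
  define n where "n = real CARD('n option)"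
  define k where "k = (2 ^ (m + 1)) powr q * n powr q"
  define C where "C = 2 * k * n * c powr (q / p)"
  have n: "0 < n" by (simp add: n_def)
  have k: "0 < k" using n by (simp add: k_def)
  have C: "0 < C" using n k c(1) by (simp add: C_def)
  have "emeasure (joint_pullback \<beta> q \<phi> \<psi>) (bergman_ball a) \<le> ennreal (C * X * defect a powr (\<gamma> * (q / p)))"
    if \<phi>: "holomorphic_self_map \<phi>" and \<psi>: "holomorphic_self_map \<psi>" and X: "0 \<le> X"
      and bd: "\<And>f. mv_holomorphic_on f unit_ball \<Longrightarrow> bergman_mass p \<alpha> f \<le> 1 \<Longrightarrow>
      bergman_mass q \<beta> (comp_diff \<phi> \<psi> f) \<le> ennreal X"
      and a: "a \<in> unit_ball" for \<phi> \<psi> :: "complex ^ 'n \<Rightarrow> complex ^ 'n" and \<beta> X a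
  proof -
    have da: "0 < defect a" by (rule defect_pos[OF a])
    define K where "K = c * defect a powr \<gamma>"
    have K: "0 < K" using c(1) da by (simp add: K_def)
    have sp: "\<phi> z \<in> unit_ball" "\<psi> z \<in> unit_ball" if "z \<in> unit_ball" for z
      using \<phi> \<psi> that unfolding holomorphic_self_map_def by blast+
    define T where "T = (\<lambda>i z. test_family a m i (\<phi> z) - test_family a m i (\<psi> z))"
    have Thol: "mv_holomorphic_on (T i) unit_ball" for i
      unfolding T_def
      by (intro mv_holomorphic_on_diff mv_holomorphic_comp_self_map[OF _ \<phi>]
          mv_holomorphic_comp_self_map[OF _ \<psi>] mv_holomorphic_test_family[OF a])
    have [measurable]: "T i \<in> borel_measurable ball_borel" for i by (rule mv_holomorphic_borel_measurable[OF Thol])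
    have each: "bergman_mass q \<beta> (T i) \<le> ennreal (K powr (q / p) * X)" for i
    proof -
      define r where "r = K powr (- (1 / p))"
      have r: "0 < r" using K by (simp add: r_def)
      have hol: "mv_holomorphic_on (test_family a m i) unit_ball" by (rule mv_holomorphic_test_family[OF a])
      define f where "f = (\<lambda>z. complex_of_real r * test_family a m i z)"
      have f: "mv_holomorphic_on f unit_ball" unfolding f_def by (rule mv_holomorphic_on_cmult[OF hol])
      have rp: "r powr p = 1 / K" unfolding r_def powr_powr using p K by (simp add: powr_minus_divide)
      have "bergman_mass p \<alpha> f =
          ennreal (1 / K) * bergman_mass p \<alpha> (test_family a m i)"
        unfolding f_def nn_integral_cmult_norm_powr[OF mv_holomorphic_borel_measurable[OF hol]]
        using r rp by simp
      also have "\<dots> \<le> ennreal (1 / K) * ennreal K"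
        unfolding K_def using norm_test_family_le[OF a]
        by (intro mult_left_mono c(2)[rule_format, OF a]) auto
      also have "\<dots> = 1" using K by (simp flip: ennreal_mult)
      finally have "bergman_mass q \<beta> (comp_diff \<phi> \<psi> f) \<le> ennreal X"
        by (rule bd[OF f])
      moreover have "f (\<phi> z) - f (\<psi> z) = complex_of_real r * T i z" for z
        by (simp add: f_def T_def algebra_simps)
      ultimately have "ennreal (r powr q) * bergman_mass q \<beta> (T i) \<le> ennreal X"
        using r nn_integral_cmult_norm_powr[OF mv_holomorphic_borel_measurable[OF Thol[of i]],
            where c = "complex_of_real r" and p = q and \<alpha> = \<beta>] by simp
      then have "ennreal (K powr (q / p)) * (ennreal (r powr q) * bergman_mass q \<beta> (T i))
          \<le> ennreal (K powr (q / p)) * ennreal X" by (rule mult_left_mono) simp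
      moreover have "ennreal (K powr (q / p)) * ennreal (r powr q) = 1"
        using K by (simp add: r_def powr_powr flip: ennreal_mult powr_add)
      ultimately show ?thesis using X by (simp add: ennreal_mult mult.assoc[symmetric])
    qed
    have \<rho>: "pseudo_hyp_dist z w powr q \<le> k * (\<Sum>i\<in>UNIV. norm (test_family a m i z - test_family a m i w) powr q)"
      if "z \<in> bergman_ball a" "w \<in> unit_ball" for z w
    proof -
      have "pseudo_hyp_dist z w powr q \<le>
          (2 ^ (m + 1) * (\<Sum>i\<in>UNIV. norm (test_family a m i z - test_family a m i w))) powr q"
        using q by (intro powr_mono2 pseudo_hyp_dist_le_test_family[OF a that]) auto
      also have "\<dots> = (2 ^ (m + 1)) powr q * (\<Sum>i\<in>UNIV. norm (test_family a m i z - test_family a m i w)) powr q"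
        by (rule powr_mult)
      also have "\<dots> \<le> (2 ^ (m + 1)) powr q * (n powr q * (\<Sum>i\<in>UNIV. norm (test_family a m i z - test_family a m i w) powr q))"
        unfolding n_def by (intro mult_left_mono powr_sum_le q) auto
      finally show ?thesis by (simp add: k_def)
    qed
    have Ds: "bergman_ball a \<in> sets ball_borel" by (rule bergman_ball_sets[OF a])
    have "emeasure (joint_pullback \<beta> q \<phi> \<psi>) (bergman_ball a) = (\<integral>\<^sup>+w. indicator (bergman_ball a) w \<partial>joint_pullback \<beta> q \<phi> \<psi>)"
      using Ds by (simp add: sets_joint_pullback)
    also have "\<dots> = (\<integral>\<^sup>+z. (indicator (bergman_ball a) (\<phi> z) + indicator (bergman_ball a) (\<psi> z)) *
        ennreal (pseudo_hyp_dist (\<phi> z) (\<psi> z) powr q) \<partial>nu_w \<beta>)"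
      using Ds by (intro nn_integral_joint_pullback[OF \<phi> \<psi>]) simp
    also have "\<dots> \<le> (\<integral>\<^sup>+z. ennreal (2 * k) * (\<Sum>i\<in>UNIV. ennreal (norm (T i z) powr q)) \<partial>nu_w \<beta>)"
    proof (rule nn_integral_mono)
      fix z :: "complex ^ 'n" assume "z \<in> space (nu_w \<beta>)"
      then have z: "z \<in> unit_ball" by (simp add: space_nu_w)
      define Q where "Q = ennreal (pseudo_hyp_dist (\<phi> z) (\<psi> z) powr q)"
      define R where "R = ennreal k * (\<Sum>i\<in>UNIV. ennreal (norm (T i z) powr q))"
      have R: "R = ennreal (k * (\<Sum>i\<in>UNIV. norm (T i z) powr q))"
        unfolding R_def using k by (simp add: ennreal_mult sum_nonneg)
      have "indicator (bergman_ball a) (\<phi> z) * Q \<le> R"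
        using \<rho>[OF _ sp(2)[OF z], of "\<phi> z"] unfolding R Q_def T_def
        by (cases "\<phi> z \<in> bergman_ball a") (auto intro: ennreal_leI)
      moreover have "indicator (bergman_ball a) (\<psi> z) * Q \<le> R"
        using \<rho>[OF _ sp(1)[OF z], of "\<psi> z"] pseudo_hyp_dist_commute[OF sp[OF z]] unfolding R Q_def T_def
        by (cases "\<psi> z \<in> bergman_ball a") (auto intro: ennreal_leI simp: norm_minus_commute)
      ultimately have "(indicator (bergman_ball a) (\<phi> z) + indicator (bergman_ball a) (\<psi> z)) * Q \<le> R + R"
        unfolding distrib_right by (rule add_mono)
      also have "R + R = ennreal (2 * k) * (\<Sum>i\<in>UNIV. ennreal (norm (T i z) powr q))"
        unfolding R_def using k by (simp add: ennreal_mult mult_2[symmetric] mult.assoc)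
      finally show "(indicator (bergman_ball a) (\<phi> z) + indicator (bergman_ball a) (\<psi> z)) *
        ennreal (pseudo_hyp_dist (\<phi> z) (\<psi> z) powr q) \<le> ennreal (2 * k) * (\<Sum>i\<in>UNIV. ennreal (norm (T i z) powr q))"
        unfolding Q_def .
    qed
    also have "\<dots> = ennreal (2 * k) * (\<integral>\<^sup>+z. (\<Sum>i\<in>UNIV. ennreal (norm (T i z) powr q)) \<partial>nu_w \<beta>)"
      by (rule nn_integral_cmult) measurable
    also have "(\<integral>\<^sup>+z. (\<Sum>i\<in>UNIV. ennreal (norm (T i z) powr q)) \<partial>nu_w \<beta>) =
        (\<Sum>i\<in>UNIV. \<integral>\<^sup>+z. ennreal (norm (T i z) powr q) \<partial>nu_w \<beta>)"
      by (rule nn_integral_sum) measurable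
    also have "ennreal (2 * k) * \<dots> \<le> ennreal (2 * k) * (\<Sum>i\<in>(UNIV :: 'n option set). ennreal (K powr (q / p) * X))"
      by (intro mult_left_mono sum_mono each) auto
    also have "(\<Sum>i\<in>(UNIV :: 'n option set). ennreal (K powr (q / p) * X)) = ennreal (n * (K powr (q / p) * X))"
      using X by (subst sum_ennreal) (auto simp: n_def)
    also have "ennreal (2 * k) * \<dots> = ennreal (2 * k * (n * (K powr (q / p) * X)))"
      using k n X by (intro ennreal_mult[symmetric]) auto
    also have "2 * k * (n * (K powr (q / p) * X)) = C * X * defect a powr (\<gamma> * (q / p))"
      unfolding K_def C_def using c(1) by (simp add: powr_mult powr_powr)
    finally show ?thesis .
  qed
  then show ?thesis using C unfolding \<gamma>_def by (intro exI[of _ C]) blast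
qed

section \<open>Boundedness and the Carleson condition\<close>

lemma epowr_mono: "0 < a \<Longrightarrow> x \<le> y \<Longrightarrow> epowr x a \<le> epowr y a"
  by (cases x rule: ennreal_cases; cases y rule: ennreal_cases)
    (auto simp: epowr_def top_unique intro!: ennreal_leI powr_mono2)

lemma epowr_ennreal: "0 \<le> x \<Longrightarrow> epowr (ennreal x) a = ennreal (x powr a)"
  by (simp add: epowr_def)

lemma epowr_epowr: "0 < a \<Longrightarrow> 0 < b \<Longrightarrow> epowr (epowr x a) b = epowr x (a * b)"
  by (cases x rule: ennreal_cases) (auto simp: epowr_def powr_powr)

lemma epowr_1 [simp]: "epowr x 1 = x"
  by (cases x rule: ennreal_cases) (auto simp: epowr_def)

lemma epowr_bergman_norm:
  assumes "0 < p" "0 < q"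
  shows "epowr (bergman_norm p \<alpha> f) q = epowr (bergman_mass p \<alpha> f) (q / p)"
  unfolding bergman_norm_def using assms by (simp add: epowr_epowr)

lemma bergman_norm_le_1_iff:
  assumes p: "0 < p"
  shows "bergman_norm p \<alpha> f \<le> 1 \<longleftrightarrow> bergman_mass p \<alpha> f \<le> 1"
proof -
  define I where "I = bergman_mass p \<alpha> f"
  have 1: "epowr 1 a = 1" for a using epowr_ennreal[of 1 a] by simp
  have "I \<le> 1 \<Longrightarrow> epowr I (1 / p) \<le> 1" using epowr_mono[of "1 / p" I 1] p 1 by simp
  moreover have "epowr I (1 / p) \<le> 1 \<Longrightarrow> I \<le> 1"
    using epowr_mono[of p "epowr I (1 / p)" 1] p 1 by (simp add: epowr_epowr)
  ultimately show ?thesis unfolding bergman_norm_def I_def by blast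
qed

text \<open>The operator is truncated to the sets where \<open>|\<phi>|\<close> and \<open>|\<psi>|\<close> are at most \<open>1 - 1/(j + 1)\<close>. Each
  truncation is bounded, since point evaluations are bounded uniformly on compact sets; by
  uniform boundedness the bounds do not depend on \<open>j\<close>, and monotone convergence removes the
  truncation.\<close>

lemma bounded_of_maps_into:
  fixes \<phi> \<psi> :: "complex ^ 'n \<Rightarrow> complex ^ 'n" and p q \<alpha> \<beta> :: real
  assumes p: "0 < p" and pq: "p \<le> q" and \<alpha>: "-1 < \<alpha>" and \<beta>: "-1 < \<beta>"
    and \<phi>: "holomorphic_self_map \<phi>" and \<psi>: "holomorphic_self_map \<psi>"
    and maps: "\<And>f. f \<in> bergman_space p \<alpha> \<Longrightarrow> bergman_mass q \<beta> (comp_diff \<phi> \<psi> f) < \<infinity>"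
  shows "\<exists>X\<ge>0. \<forall>f. mv_holomorphic_on f unit_ball \<longrightarrow> bergman_mass p \<alpha> f \<le> 1 \<longrightarrow>
      bergman_mass q \<beta> (comp_diff \<phi> \<psi> f) \<le> ennreal X"
proof -
  let ?\<nu> = "nu_w \<beta> :: (complex ^ 'n) measure"
  have q: "0 < q" using p pq by simp
  interpret B: finite_measure ?\<nu> by (rule finite_measure_nu_w[OF \<beta>])
  have sp: "\<phi> z \<in> unit_ball" "\<psi> z \<in> unit_ball" if "z \<in> unit_ball" for z
    using \<phi> \<psi> that unfolding holomorphic_self_map_def by blast+
  have [measurable]: "\<phi> \<in> borel_measurable ball_borel" "\<psi> \<in> borel_measurable ball_borel"
    using measurable_compose[OF holomorphic_self_map_measurable[OF \<phi>] id_ball_borel]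
      measurable_compose[OF holomorphic_self_map_measurable[OF \<psi>] id_ball_borel] by simp_all
  have T: "mv_holomorphic_on (comp_diff \<phi> \<psi> f) unit_ball" if "mv_holomorphic_on f unit_ball" for f
    by (intro mv_holomorphic_on_diff mv_holomorphic_comp_self_map[OF that \<phi>] mv_holomorphic_comp_self_map[OF that \<psi>])
  define A where "A = (\<lambda>j z. norm (\<phi> z) \<le> 1 - 1 / real (Suc j) \<and> norm (\<psi> z) \<le> 1 - 1 / real (Suc j))"
  define N where "N = (\<lambda>j (f :: complex ^ 'n \<Rightarrow> complex). \<integral>\<^sup>+z. (if A j z then ennreal (norm (f (\<phi> z) - f (\<psi> z)) powr q) else 0) \<partial>?\<nu>)"
  have A[measurable]: "Measurable.pred ball_borel (A j)" for j unfolding A_def by measurable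
  have T'[measurable]: "(comp_diff \<phi> \<psi> f) \<in> borel_measurable ball_borel" if "mv_holomorphic_on f unit_ball" for f
    by (rule mv_holomorphic_borel_measurable[OF T[OF that]])
  have Nle: "N j f \<le> bergman_mass q \<beta> (comp_diff \<phi> \<psi> f)" for j f
    unfolding N_def by (intro nn_integral_mono) auto
  have "\<exists>X. \<forall>j f. mv_holomorphic_on f unit_ball \<longrightarrow>
      bergman_mass p \<alpha> f \<le> 1 \<longrightarrow> N j f \<le> ennreal X"
  proof (rule bergman_uniform_boundedness[OF p q \<alpha>])
    fix j c and f :: "complex ^ 'n \<Rightarrow> complex" assume f: "mv_holomorphic_on f unit_ball"
    note [measurable] = T'[OF f]
    have "N j (\<lambda>z. c * f z) = (\<integral>\<^sup>+z. ennreal (norm c powr q) * (if A j z then ennreal (norm (f (\<phi> z) - f (\<psi> z)) powr q) else 0) \<partial>?\<nu>)"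
      unfolding N_def
      by (intro nn_integral_cong) (auto simp: right_diff_distrib[symmetric] norm_mult powr_mult ennreal_mult)
    also have "\<dots> = ennreal (norm c powr q) * N j f"
      unfolding N_def by (rule nn_integral_cmult) measurable
    finally show "N j (\<lambda>z. c * f z) = ennreal (norm c powr q) * N j f" .
  next
    fix j and f g :: "complex ^ 'n \<Rightarrow> complex"
    assume f: "mv_holomorphic_on f unit_ball" and g: "mv_holomorphic_on g unit_ball"
    note [measurable] = T'[OF f] T'[OF g]
    have "N j (\<lambda>z. f z + g z) \<le> (\<integral>\<^sup>+z. ennreal (2 powr q) * ((if A j z then ennreal (norm (f (\<phi> z) - f (\<psi> z)) powr q) else 0) +
        (if A j z then ennreal (norm (g (\<phi> z) - g (\<psi> z)) powr q) else 0)) \<partial>?\<nu>)"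
      unfolding N_def
    proof (rule nn_integral_mono)
      fix z
      have "norm (f (\<phi> z) + g (\<phi> z) - (f (\<psi> z) + g (\<psi> z))) powr q \<le>
          (norm (f (\<phi> z) - f (\<psi> z)) + norm (g (\<phi> z) - g (\<psi> z))) powr q"
        using norm_triangle_ineq[of "f (\<phi> z) - f (\<psi> z)" "g (\<phi> z) - g (\<psi> z)"] q
        by (intro powr_mono2) (auto simp: algebra_simps)
      also have "\<dots> \<le> 2 powr q * (norm (f (\<phi> z) - f (\<psi> z)) powr q + norm (g (\<phi> z) - g (\<psi> z)) powr q)"
        by (rule powr_add_le) (use q in auto)
      finally have "ennreal (norm (f (\<phi> z) + g (\<phi> z) - (f (\<psi> z) + g (\<psi> z))) powr q) \<le>
          ennreal (2 powr q * (norm (f (\<phi> z) - f (\<psi> z)) powr q + norm (g (\<phi> z) - g (\<psi> z)) powr q))"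
        by (rule ennreal_leI)
      then show "(if A j z then ennreal (norm (f (\<phi> z) + g (\<phi> z) - (f (\<psi> z) + g (\<psi> z))) powr q) else 0) \<le>
        ennreal (2 powr q) * ((if A j z then ennreal (norm (f (\<phi> z) - f (\<psi> z)) powr q) else 0) +
        (if A j z then ennreal (norm (g (\<phi> z) - g (\<psi> z)) powr q) else 0))"
        by (simp add: ennreal_mult)
    qed
    also have "\<dots> = ennreal (2 powr q) * (N j f + N j g)"
      unfolding N_def by (subst nn_integral_cmult, measurable, subst nn_integral_add, measurable)
    finally show "N j (\<lambda>z. f z + g z) \<le> ennreal (2 powr q) * (N j f + N j g)" .
  next
    fix j
    define e where "e = (CARD('n) + 1 + \<alpha>) * (q / p)"
    have e: "0 < e" using p q \<alpha> by (auto simp: e_def intro!: mult_pos_pos)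
    from pointwise_local_mass[OF p pq \<alpha>, where 'n = 'n]
    obtain c where c: "0 < c" "\<forall>(f :: complex ^ 'n \<Rightarrow> complex) P. mv_holomorphic_on f unit_ball \<longrightarrow> 0 \<le> P \<longrightarrow>
      bergman_mass p \<alpha> f \<le> ennreal P \<longrightarrow>
      (\<forall>z\<in>unit_ball. ennreal (norm (f z) powr q) \<le>
        ennreal (c * P powr (q / p - 1)) * (ennreal (defect z powr (- e)) * local_mass p \<alpha> f z)) \<and>
      (\<forall>z\<in>unit_ball. \<forall>w\<in>unit_ball. ennreal (norm (f z - f w) powr q) \<le>
        ennreal (c * P powr (q / p - 1)) * ((ennreal (defect z powr (- e)) * local_mass p \<alpha> f z +
          ennreal (defect w powr (- e)) * local_mass p \<alpha> f w) * ennreal (pseudo_hyp_dist z w powr q)))"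
      unfolding e_def by (elim exE conjE)
    define d where "d = 1 / real (Suc j)"
    have d: "0 < d" by (simp add: d_def)
    define b where "b = c * d powr (- e)"
    have b: "0 < b" using c d by (simp add: b_def)
    show "\<exists>B. \<forall>f. mv_holomorphic_on f unit_ball \<longrightarrow>
      bergman_mass p \<alpha> f \<le> 1 \<longrightarrow> N j f \<le> ennreal B"
    proof (intro exI allI impI)
      fix f :: "complex ^ 'n \<Rightarrow> complex"
      assume f: "mv_holomorphic_on f unit_ball" and f1: "bergman_mass p \<alpha> f \<le> 1"
      have bound: "norm (f x) powr q \<le> b" if x: "norm x \<le> 1 - d" for x
      proof -
        have xB: "x \<in> unit_ball" using x d by simp
        have "d \<le> 1 - norm x" using x by simp
        also have "\<dots> \<le> defect x" using xB by (simp add: defect_def power2_eq_square mult_left_le)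
        finally have "defect x powr (- e) \<le> d powr (- e)" using d e by (intro powr_mono2') auto
        then have le: "ennreal (defect x powr (- e)) \<le> ennreal (d powr (- e))" by (rule ennreal_leI)
        have "ennreal (norm (f x) powr q) \<le> ennreal (c * 1 powr (q / p - 1)) * (ennreal (defect x powr (- e)) * local_mass p \<alpha> f x)"
          using bspec[OF conjunct1[OF c(2)[rule_format, of f 1]] xB] f f1 by simp
        also have "\<dots> \<le> ennreal (c * 1 powr (q / p - 1)) * (ennreal (d powr (- e)) * 1)"
          by (intro mult_left_mono mult_mono le order_trans[OF local_mass_le f1]) auto
        also have "\<dots> = ennreal b" using c(1) by (simp add: b_def ennreal_mult)
        finally show ?thesis using b by simp
      qed
      have "N j f \<le> (\<integral>\<^sup>+z. ennreal (2 powr q * (b + b)) \<partial>?\<nu>)"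
        unfolding N_def
      proof (rule nn_integral_mono)
        fix z
        show "(if A j z then ennreal (norm (f (\<phi> z) - f (\<psi> z)) powr q) else 0) \<le> ennreal (2 powr q * (b + b))"
        proof (cases "A j z")
          case True
          have "norm (f (\<phi> z) - f (\<psi> z)) powr q \<le> (norm (f (\<phi> z)) + norm (f (\<psi> z))) powr q"
            using q by (intro powr_mono2 norm_triangle_ineq4) auto
          also have "\<dots> \<le> 2 powr q * (norm (f (\<phi> z)) powr q + norm (f (\<psi> z)) powr q)"
            by (rule powr_add_le) (use q in auto)
          also have "\<dots> \<le> 2 powr q * (b + b)"
            using True by (intro mult_left_mono add_mono bound) (auto simp: A_def d_def)
          finally show ?thesis using True by (simp add: ennreal_leI)
        qed simp
      qed
      also have "\<dots> = ennreal (2 powr q * (b + b)) * emeasure ?\<nu> (space ?\<nu>)" by simp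
      also have "\<dots> = ennreal (2 powr q * (b + b) * measure ?\<nu> (space ?\<nu>))"
        using b by (simp add: B.emeasure_eq_measure ennreal_mult)
      finally show "N j f \<le> ennreal (2 powr q * (b + b) * measure ?\<nu> (space ?\<nu>))" .
    qed
  next
    fix f :: "complex ^ 'n \<Rightarrow> complex" assume "f \<in> bergman_space p \<alpha>"
    define Y where "Y = enn2real (bergman_mass q \<beta> (comp_diff \<phi> \<psi> f))"
    have "bergman_mass q \<beta> (comp_diff \<phi> \<psi> f) = ennreal Y"
      using maps[OF \<open>f \<in> bergman_space p \<alpha>\<close>] by (simp add: Y_def)
    then have "N j f \<le> ennreal Y" for j using Nle[of j f] by (simp only:)
    then show "\<exists>Y. \<forall>j. N j f \<le> ennreal Y" by blast
  qed
  then obtain X where X: "\<forall>j f. mv_holomorphic_on f unit_ball \<longrightarrow>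
      bergman_mass p \<alpha> f \<le> 1 \<longrightarrow> N j f \<le> ennreal X" by (elim exE)
  show ?thesis
  proof (intro exI[of _ "max X 0"] conjI allI impI)
    fix f :: "complex ^ 'n \<Rightarrow> complex"
    assume f: "mv_holomorphic_on f unit_ball" and f1: "bergman_mass p \<alpha> f \<le> 1"
    note [measurable] = T'[OF f]
    have mono: "A i z \<Longrightarrow> A j z" if "i \<le> j" for i j z
    proof -
      have "1 / real (Suc j) \<le> 1 / real (Suc i)" using that by (simp add: frac_le)
      then show "A i z \<Longrightarrow> A j z" unfolding A_def by linarith
    qed
    have "bergman_mass q \<beta> (comp_diff \<phi> \<psi> f) \<le>
        (\<integral>\<^sup>+z. (SUP j. (if A j z then ennreal (norm (f (\<phi> z) - f (\<psi> z)) powr q) else 0)) \<partial>?\<nu>)"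
    proof (rule nn_integral_mono)
      fix z assume "z \<in> space ?\<nu>"
      then have z: "z \<in> unit_ball" by (simp add: space_nu_w)
      define t where "t = max (norm (\<phi> z)) (norm (\<psi> z))"
      have "0 < 1 - t" using sp[OF z] by (simp add: t_def)
      then obtain j where "inverse (real (Suc j)) < 1 - t" using reals_Archimedean by blast
      then have j: "A j z" unfolding A_def t_def by (auto simp: inverse_eq_divide)
      show "ennreal (norm (f (\<phi> z) - f (\<psi> z)) powr q) \<le>
          (SUP j. (if A j z then ennreal (norm (f (\<phi> z) - f (\<psi> z)) powr q) else 0))"
        by (rule SUP_upper2[of j]) (use j in auto)
    qed
    also have "\<dots> = (SUP j. N j f)"
      unfolding N_def using mono
      by (intro nn_integral_monotone_convergence_SUP) (auto simp: incseq_def le_fun_def)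
    also have "\<dots> \<le> ennreal X" by (intro SUP_least X[rule_format] f f1)
    also have "\<dots> \<le> ennreal (max X 0)" by (rule ennreal_leI) simp
    finally show "bergman_mass q \<beta> (comp_diff \<phi> \<psi> f) \<le> ennreal (max X 0)" .
  qed simp
qed

text \<open>The test function \<open>h\<^sup>m\<close> is bounded below on \<open>D(a)\<close>, and the \<open>q\<close>-th power of its norm is of order
  \<open>(1 - |a|\<^sup>2)\<^sup>e\<close> at most.\<close>

lemma bergman_carleson_imp_ball_le:
  fixes \<omega> :: "(complex ^ 'n) measure" and p q \<alpha> lam :: real
  assumes p: "0 < p" and q: "0 < q" and \<alpha>: "-1 < \<alpha>" and lam: "lam = q / p"
    and C: "bergman_carleson lam \<alpha> \<omega>"
  shows "\<exists>M\<ge>0. \<forall>a\<in>unit_ball. emeasure \<omega> (bergman_ball a) \<le> ennreal (M * defect a powr ((CARD('n) + 1 + \<alpha>) * (q / p)))"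
proof -
  define \<gamma> where "\<gamma> = CARD('n) + 1 + \<alpha>"
  have sets: "sets \<omega> = sets ball_borel" using C by (simp add: bergman_carleson_def)
  note [measurable_cong] = sets
  obtain K where K: "0 < K" "\<forall>f\<in>bergman_space p \<alpha>.
      (\<integral>\<^sup>+z. ennreal (norm (f z) powr q) \<partial>\<omega>) \<le> ennreal K * epowr (bergman_norm p \<alpha> f) q"
    using C[unfolded bergman_carleson_def, THEN conjunct2, rule_format, OF p q lam[symmetric]] by (elim exE conjE)
  obtain m :: nat where "\<gamma> / p < m" using reals_Archimedean2 by blast
  then have m: "CARD('n) + 1 + \<alpha> < m * p" using p by (simp add: \<gamma>_def field_simps)
  from test_fun_mass_le[OF p \<alpha> m] obtain c where c: "0 < c" "\<forall>(a :: complex ^ 'n)\<in>unit_ball. \<forall>G.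
    (\<forall>z\<in>unit_ball. norm (G z) \<le> norm (test_fun a m z)) \<longrightarrow>
    (\<integral>\<^sup>+z. ennreal (norm (G z :: complex) powr p) \<partial>nu_w \<alpha>) \<le> ennreal (c * defect a powr \<gamma>)"
    unfolding \<gamma>_def by (elim exE conjE)
  define b where "b = ((1 / 2) ^ m) powr q"
  have b: "0 < b" by (simp add: b_def)
  define M where "M = K * c powr (q / p) / b"
  have "emeasure \<omega> (bergman_ball a) \<le> ennreal (M * defect a powr (\<gamma> * (q / p)))" if a: "a \<in> unit_ball" for a
  proof -
    define f where "f = test_fun a m"
    define I where "I = bergman_mass p \<alpha> f"
    have hol: "mv_holomorphic_on f unit_ball" unfolding f_def by (rule mv_holomorphic_test_fun[OF a])
    have I: "I \<le> ennreal (c * defect a powr \<gamma>)"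
      unfolding I_def f_def using c(2) a by blast
    have "f \<in> bergman_space p \<alpha>"
      unfolding bergman_space_def using hol I le_less_trans[OF I ennreal_less_top] by (simp add: I_def)
    have Ds: "bergman_ball a \<in> sets \<omega>" unfolding sets by (rule bergman_ball_sets[OF a])
    have "ennreal b * emeasure \<omega> (bergman_ball a) = (\<integral>\<^sup>+z. ennreal b * indicator (bergman_ball a) z \<partial>\<omega>)"
      by (rule nn_integral_cmult_indicator[OF Ds, symmetric])
    also have "\<dots> \<le> (\<integral>\<^sup>+z. ennreal (norm (f z) powr q) \<partial>\<omega>)"
    proof (rule nn_integral_mono)
      fix z
      show "ennreal b * indicator (bergman_ball a) z \<le> ennreal (norm (f z) powr q)"
      proof (cases "z \<in> bergman_ball a")
        case True
        have "1 / 2 \<le> defect a / norm (1 - herm_inner z a)"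
          using bergman_ball_compare(1)[OF a True] one_minus_herm_inner_nz[OF bergman_ball_sub[OF True] a]
          by (simp add: field_simps)
        then have "(1 / 2) ^ m \<le> norm (f z)"
          unfolding f_def norm_test_fun[OF a] by (intro power_mono) auto
        then have "b \<le> norm (f z) powr q" unfolding b_def using q by (intro powr_mono2) auto
        then show ?thesis using True by (simp add: ennreal_leI)
      qed simp
    qed
    also have "\<dots> \<le> ennreal K * epowr (bergman_norm p \<alpha> f) q" by (rule K(2)[rule_format]) fact
    also have "epowr (bergman_norm p \<alpha> f) q = epowr I (q / p)"
      unfolding I_def by (rule epowr_bergman_norm[OF p q])
    also have "ennreal K * \<dots> \<le> ennreal K * epowr (ennreal (c * defect a powr \<gamma>)) (q / p)"
      using p q by (intro mult_left_mono epowr_mono I) auto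
    also have "\<dots> = ennreal (K * (c powr (q / p) * defect a powr (\<gamma> * (q / p))))"
      using c(1) K(1) by (subst epowr_ennreal) (auto simp: powr_mult powr_powr simp flip: ennreal_mult)
    also have "K * (c powr (q / p) * defect a powr (\<gamma> * (q / p))) = b * (M * defect a powr (\<gamma> * (q / p)))"
      using b by (simp add: M_def)
    also have "ennreal \<dots> = ennreal b * ennreal (M * defect a powr (\<gamma> * (q / p)))"
      using b K(1) by (intro ennreal_mult) (auto simp: M_def)
    finally show ?thesis using b by (subst (asm) ennreal_mult_le_mult_iff) auto
  qed
  moreover have "0 \<le> M" using K b by (simp add: M_def)
  ultimately show ?thesis unfolding \<gamma>_def by blast
qed

lemma SUP_carleson_kernel_joint_pullback:
  fixes \<phi> \<psi> :: "complex ^ 'n \<Rightarrow> complex ^ 'n"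
  assumes \<phi>: "holomorphic_self_map \<phi>" and \<psi>: "holomorphic_self_map \<psi>"
  shows "carleson_sup s e (joint_pullback \<beta> q \<phi> \<psi>) =
    (SUP a \<in> unit_ball. \<integral>\<^sup>+z. ennreal (
                   ((1 - (norm a)\<^sup>2) powr s / norm (1 - herm_inner a (\<phi> z)) powr (e + s)
                    + (1 - (norm a)\<^sup>2) powr s / norm (1 - herm_inner a (\<psi> z)) powr (e + s))
                   * pseudo_hyp_dist (\<phi> z) (\<psi> z) powr q) \<partial>nu_w \<beta>)"
proof (intro SUP_cong refl)
  fix a :: "complex ^ 'n"
  have k0: "0 \<le> carleson_kernel s e a w" for w by (simp add: carleson_kernel_def)
  have "(\<integral>\<^sup>+w. ennreal (carleson_kernel s e a w) \<partial>joint_pullback \<beta> q \<phi> \<psi>) =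
      (\<integral>\<^sup>+z. (ennreal (carleson_kernel s e a (\<phi> z)) + ennreal (carleson_kernel s e a (\<psi> z))) *
        ennreal (pseudo_hyp_dist (\<phi> z) (\<psi> z) powr q) \<partial>nu_w \<beta>)"
    by (rule nn_integral_joint_pullback[OF \<phi> \<psi>]) measurable
  also have "\<dots> = (\<integral>\<^sup>+z. ennreal ((carleson_kernel s e a (\<phi> z) + carleson_kernel s e a (\<psi> z)) *
        pseudo_hyp_dist (\<phi> z) (\<psi> z) powr q) \<partial>nu_w \<beta>)"
    by (intro nn_integral_cong) (simp add: ennreal_mult k0)
  finally show "(\<integral>\<^sup>+w. ennreal (carleson_kernel s e a w) \<partial>joint_pullback \<beta> q \<phi> \<psi>) =
    (\<integral>\<^sup>+z. ennreal (((1 - (norm a)\<^sup>2) powr s / norm (1 - herm_inner a (\<phi> z)) powr (e + s)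
                    + (1 - (norm a)\<^sup>2) powr s / norm (1 - herm_inner a (\<psi> z)) powr (e + s))
                   * pseudo_hyp_dist (\<phi> z) (\<psi> z) powr q) \<partial>nu_w \<beta>)"
    by (simp add: carleson_kernel_def defect_def)
qed

lemma bergman_carleson_if_carleson_sup_finite:
  fixes \<omega> :: "(complex ^ 'n) measure" and \<alpha> lam s :: real
  assumes \<alpha>: "-1 < \<alpha>" and lam: "1 \<le> lam" and s: "0 < s"
    and \<omega>: "sets \<omega> = sets ball_borel" "finite_measure \<omega>"
    and finite: "carleson_sup s ((CARD('n) + 1 + \<alpha>) * lam) \<omega> < \<infinity>"
  shows "bergman_carleson lam \<alpha> \<omega>"
  unfolding bergman_carleson_def
proof (intro conjI allI impI)
  define e where "e = (CARD('n) + 1 + \<alpha>) * lam"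
  show "sets \<omega> = sets ball_borel" by (rule \<omega>)
  fix p q :: real assume p: "0 < p" and q: "0 < q" and r: "q / p = lam"
  have pq: "p \<le> q" using p r lam by (simp add: field_simps)
  obtain S where S: "0 \<le> S" "carleson_sup s e \<omega> = ennreal S"
    using finite unfolding e_def[symmetric] by (cases "carleson_sup s e \<omega>" rule: ennreal_cases) auto
  from upper_estimate[OF p pq \<alpha> s, where 'n = 'n]
  obtain C where C: "0 < C" "\<forall>(f :: complex ^ 'n \<Rightarrow> complex) P. mv_holomorphic_on f unit_ball \<longrightarrow> 0 \<le> P \<longrightarrow>
      bergman_mass p \<alpha> f \<le> ennreal P \<longrightarrow>
      (\<forall>\<omega>. sets \<omega> = sets ball_borel \<longrightarrow> finite_measure \<omega> \<longrightarrow>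
        (\<integral>\<^sup>+w. ennreal (norm (f w) powr q) \<partial>\<omega>) \<le> ennreal (C * P powr lam) * carleson_sup s e \<omega>) \<and>
      (\<forall>\<phi> \<psi> \<beta>. holomorphic_self_map \<phi> \<longrightarrow> holomorphic_self_map \<psi> \<longrightarrow> -1 < \<beta> \<longrightarrow>
        bergman_mass q \<beta> (comp_diff \<phi> \<psi> f) \<le>
          ennreal (C * P powr lam) * carleson_sup s e (joint_pullback \<beta> q \<phi> \<psi>))"
    unfolding r e_def by (elim exE conjE)
  show "\<exists>C>0. \<forall>f \<in> bergman_space p \<alpha>.
      (\<integral>\<^sup>+z. ennreal (norm (f z) powr q) \<partial>\<omega>) \<le> ennreal C * epowr (bergman_norm p \<alpha> f) q"
  proof (intro exI[of _ "C * (S + 1)"] conjI ballI)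
    show "0 < C * (S + 1)" using C S by simp
    fix f :: "complex ^ 'n \<Rightarrow> complex" assume "f \<in> bergman_space p \<alpha>"
    then have f: "mv_holomorphic_on f unit_ball" and fi: "bergman_mass p \<alpha> f < \<infinity>"
      by (auto simp: bergman_space_def)
    then obtain P where P: "0 \<le> P" "bergman_mass p \<alpha> f = ennreal P"
      by (cases "bergman_mass p \<alpha> f" rule: ennreal_cases) auto
    have "(\<integral>\<^sup>+w. ennreal (norm (f w) powr q) \<partial>\<omega>) \<le> ennreal (C * P powr lam) * ennreal S"
      unfolding S(2)[symmetric] by (rule C(2)[rule_format, THEN conjunct1, rule_format]) (use f P \<omega> in auto)
    also have "\<dots> = ennreal (C * S * P powr lam)"
      using C(1) S by (simp add: mult_ac flip: ennreal_mult)
    also have "\<dots> \<le> ennreal (C * (S + 1) * P powr lam)"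
      using C(1) by (intro ennreal_leI mult_right_mono mult_left_mono) auto
    also have "\<dots> = ennreal (C * (S + 1)) * epowr (bergman_norm p \<alpha> f) q"
      unfolding epowr_bergman_norm[OF p q] P(2) r using P(1) C(1) S by (simp add: epowr_ennreal ennreal_mult)
    finally show "(\<integral>\<^sup>+z. ennreal (norm (f z) powr q) \<partial>\<omega>) \<le> ennreal (C * (S + 1)) * epowr (bergman_norm p \<alpha> f) q" .
  qed
qed

theorem theorem1p1:
  fixes p q \<alpha> \<beta> lam :: real
  assumes "0 < p" and "p \<le> q" and "-1 < \<alpha>" and "-1 < \<beta>" and "lam = q / p"
  shows
    "(\<forall>\<phi> \<psi> :: complex ^ 'n \<Rightarrow> complex ^ 'n.
        holomorphic_self_map \<phi> \<longrightarrow> holomorphic_self_map \<psi> \<longrightarrow>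
        ((\<forall>f \<in> bergman_space p \<alpha>. (\<lambda>z. comp_op \<phi> f z - comp_op \<psi> f z) \<in> bergman_space q \<beta>)
           \<longleftrightarrow> bergman_carleson lam \<alpha> (joint_pullback \<beta> q \<phi> \<psi>))) \<and>
     (\<forall>s>0. \<exists>C>0. \<forall>\<phi> \<psi> :: complex ^ 'n \<Rightarrow> complex ^ 'n.
        holomorphic_self_map \<phi> \<longrightarrow> holomorphic_self_map \<psi> \<longrightarrow>
        (let N = epowr (bergman_op_norm p \<alpha> q \<beta> (\<lambda>f z. comp_op \<phi> f z - comp_op \<psi> f z)) q;
             S = (SUP a \<in> unit_ball. \<integral>\<^sup>+z. ennreal (
                   ((1 - (norm a)\<^sup>2) powr s
                      / norm (1 - herm_inner a (\<phi> z)) powr ((real CARD('n) + 1 + \<alpha>) * lam + s)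
                    + (1 - (norm a)\<^sup>2) powr s
                      / norm (1 - herm_inner a (\<psi> z)) powr ((real CARD('n) + 1 + \<alpha>) * lam + s))
                   * pseudo_hyp_dist (\<phi> z) (\<psi> z) powr q) \<partial>nu_w \<beta>)
         in ennreal (1 / C) * S \<le> N \<and> N \<le> ennreal C * S))"
proof -
  note p = \<open>0 < p\<close> and pq = \<open>p \<le> q\<close> and \<alpha> = \<open>-1 < \<alpha>\<close> and \<beta> = \<open>-1 < \<beta>\<close> and lam = \<open>lam = q / p\<close>
  have q: "0 < q" and lam1: "1 \<le> lam" using p pq lam by simp_all
  define e where "e = (CARD('n) + 1 + \<alpha>) * (q / p)"
  have e_lam: "(CARD('n) + 1 + \<alpha>) * lam = e" "(real CARD('n) + 1 + \<alpha>) * lam = e"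
    by (simp_all add: e_def lam)
  have "CARD('n) + 1 + \<alpha> \<le> e"
    using mult_left_mono[of 1 "q / p" "CARD('n) + 1 + \<alpha>"] lam1 \<alpha> unfolding e_def lam by simp
  then have e: "real CARD('n) < e" using \<alpha> by linarith
  let ?\<omega> = "\<lambda>\<phi> \<psi>. joint_pullback \<beta> q \<phi> \<psi> :: (complex ^ 'n) measure"
  have fin: "finite_measure (?\<omega> \<phi> \<psi>)" if "holomorphic_self_map \<phi>" "holomorphic_self_map \<psi>" for \<phi> \<psi>
    by (rule finite_measure_joint_pullback[OF that \<beta> q])
  have comp: "(\<lambda>z. comp_op \<phi> f z - comp_op \<psi> f z) = comp_diff \<phi> \<psi> f"
    for \<phi> \<psi> :: "complex ^ 'n \<Rightarrow> complex ^ 'n" and f by (simp add: comp_op_def)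

  \<comment> \<open>The three estimates, with their constants as parameters: \<open>U\<close> bounds the operator by the
    kernel supremum, \<open>L\<close> the mass of pseudo-hyperbolic balls by the operator, and \<open>K\<close> the kernel
    supremum by the mass of pseudo-hyperbolic balls.\<close>
  define U where "U = (\<lambda>s C. \<forall>(f :: complex ^ 'n \<Rightarrow> complex) P. mv_holomorphic_on f unit_ball \<longrightarrow> 0 \<le> P \<longrightarrow>
      bergman_mass p \<alpha> f \<le> ennreal P \<longrightarrow>
      (\<forall>\<omega>. sets \<omega> = sets ball_borel \<longrightarrow> finite_measure \<omega> \<longrightarrow>
        (\<integral>\<^sup>+w. ennreal (norm (f w) powr q) \<partial>\<omega>) \<le> ennreal (C * P powr (q / p)) * carleson_sup s e \<omega>) \<and>
      (\<forall>\<phi> \<psi> \<beta>. holomorphic_self_map \<phi> \<longrightarrow> holomorphic_self_map \<psi> \<longrightarrow> -1 < \<beta> \<longrightarrow>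
        bergman_mass q \<beta> (comp_diff \<phi> \<psi> f) \<le>
          ennreal (C * P powr (q / p)) * carleson_sup s e (joint_pullback \<beta> q \<phi> \<psi>)))"
  define L where "L = (\<lambda>C. \<forall>(\<phi> :: complex ^ 'n \<Rightarrow> complex ^ 'n) \<psi> \<beta> X.
      holomorphic_self_map \<phi> \<longrightarrow> holomorphic_self_map \<psi> \<longrightarrow> 0 \<le> X \<longrightarrow>
      (\<forall>f. mv_holomorphic_on f unit_ball \<longrightarrow> bergman_mass p \<alpha> f \<le> 1 \<longrightarrow>
        bergman_mass q \<beta> (comp_diff \<phi> \<psi> f) \<le> ennreal X) \<longrightarrow>
      (\<forall>a\<in>unit_ball. emeasure (joint_pullback \<beta> q \<phi> \<psi>) (bergman_ball a) \<le> ennreal (C * X * defect a powr e)))"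
  define K where "K = (\<lambda>s C. \<forall>(\<omega> :: (complex ^ 'n) measure) M. sets \<omega> = sets ball_borel \<longrightarrow> finite_measure \<omega> \<longrightarrow> 0 \<le> M \<longrightarrow>
      (\<forall>a\<in>unit_ball. emeasure \<omega> (bergman_ball a) \<le> ennreal (M * defect a powr e)) \<longrightarrow>
      carleson_sup s e \<omega> \<le> ennreal (C * M))"
  have U: "\<exists>C>0. U s C" if "0 < s" for s
    unfolding U_def e_def by (rule upper_estimate[OF p pq \<alpha> that])
  have K: "\<exists>C>0. K s C" if "0 < s" for s
    unfolding K_def by (rule carleson_sup_le_of_ball_le[OF e that])
  have "\<exists>C>0. L C" unfolding L_def e_def by (rule lower_estimate[OF p q \<alpha>])
  then obtain C2 where C2: "0 < C2" "L C2" by blast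
  have finite: "carleson_sup 1 e (?\<omega> \<phi> \<psi>) < \<infinity>"
    if "holomorphic_self_map \<phi>" "holomorphic_self_map \<psi>" "0 \<le> M"
      "\<forall>a\<in>unit_ball. emeasure (?\<omega> \<phi> \<psi>) (bergman_ball a) \<le> ennreal (M * defect a powr e)" for \<phi> \<psi> M
  proof -
    obtain C where "K 1 C" using K[OF zero_less_one] by blast
    then have "carleson_sup 1 e (?\<omega> \<phi> \<psi>) \<le> ennreal (C * M)"
      unfolding K_def using sets_joint_pullback fin[OF that(1,2)] that(3,4) by blast
    then show ?thesis using le_less_trans[OF _ ennreal_less_top] by simp
  qed

  have equiv: "(\<forall>f \<in> bergman_space p \<alpha>. (\<lambda>z. comp_op \<phi> f z - comp_op \<psi> f z) \<in> bergman_space q \<beta>)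
           \<longleftrightarrow> bergman_carleson lam \<alpha> (joint_pullback \<beta> q \<phi> \<psi>)"
    if \<phi>: "holomorphic_self_map \<phi>" and \<psi>: "holomorphic_self_map \<psi>" for \<phi> \<psi> :: "complex ^ 'n \<Rightarrow> complex ^ 'n"
  proof
    assume "\<forall>f \<in> bergman_space p \<alpha>. (\<lambda>z. comp_op \<phi> f z - comp_op \<psi> f z) \<in> bergman_space q \<beta>"
    then have "\<And>f. f \<in> bergman_space p \<alpha> \<Longrightarrow> bergman_mass q \<beta> (comp_diff \<phi> \<psi> f) < \<infinity>"
      unfolding comp bergman_space_def[of q \<beta>] by blast
    from bounded_of_maps_into[OF p pq \<alpha> \<beta> \<phi> \<psi> this] obtain X where X: "0 \<le> X"
      "\<forall>f. mv_holomorphic_on f unit_ball \<longrightarrow> bergman_mass p \<alpha> f \<le> 1 \<longrightarrow>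
      bergman_mass q \<beta> (comp_diff \<phi> \<psi> f) \<le> ennreal X" by blast
    have "\<forall>a\<in>unit_ball. emeasure (?\<omega> \<phi> \<psi>) (bergman_ball a) \<le> ennreal (C2 * X * defect a powr e)"
      by (intro ballI C2(2)[unfolded L_def, rule_format]) (use \<phi> \<psi> X in auto)
    then have "carleson_sup 1 e (?\<omega> \<phi> \<psi>) < \<infinity>" using C2(1) X(1) by (intro finite[OF \<phi> \<psi>]) auto
    then show "bergman_carleson lam \<alpha> (joint_pullback \<beta> q \<phi> \<psi>)"
      by (intro bergman_carleson_if_carleson_sup_finite[OF \<alpha> lam1 zero_less_one sets_joint_pullback fin[OF \<phi> \<psi>]])
        (simp only: e_lam)
  next
    assume "bergman_carleson lam \<alpha> (joint_pullback \<beta> q \<phi> \<psi>)"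
    from bergman_carleson_imp_ball_le[OF p q \<alpha> lam this] obtain M where M: "0 \<le> M"
      "\<forall>a\<in>unit_ball. emeasure (?\<omega> \<phi> \<psi>) (bergman_ball a) \<le> ennreal (M * defect a powr e)"
      unfolding e_def by blast
    obtain S where S: "carleson_sup 1 e (?\<omega> \<phi> \<psi>) = ennreal S"
      using finite[OF \<phi> \<psi> M] by (cases "carleson_sup 1 e (?\<omega> \<phi> \<psi>)" rule: ennreal_cases) auto
    obtain C where C: "0 < C" "U 1 C" using U[OF zero_less_one] by blast
    show "\<forall>f \<in> bergman_space p \<alpha>. (\<lambda>z. comp_op \<phi> f z - comp_op \<psi> f z) \<in> bergman_space q \<beta>"
    proof
      fix f :: "complex ^ 'n \<Rightarrow> complex" assume "f \<in> bergman_space p \<alpha>"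
      then have f: "mv_holomorphic_on f unit_ball" and fi: "bergman_mass p \<alpha> f < \<infinity>"
        by (auto simp: bergman_space_def)
      then obtain P where P: "0 \<le> P" "bergman_mass p \<alpha> f = ennreal P"
        by (cases "bergman_mass p \<alpha> f" rule: ennreal_cases) auto
      have "mv_holomorphic_on (comp_diff \<phi> \<psi> f) unit_ball"
        by (intro mv_holomorphic_on_diff mv_holomorphic_comp_self_map[OF f \<phi>] mv_holomorphic_comp_self_map[OF f \<psi>])
      moreover have "bergman_mass q \<beta> (comp_diff \<phi> \<psi> f) \<le> ennreal (C * P powr (q / p)) * ennreal S"
        unfolding S[symmetric]
        by (rule C(2)[unfolded U_def, rule_format, THEN conjunct2, rule_format]) (use f P \<phi> \<psi> \<beta> in auto)
      then have "bergman_mass q \<beta> (comp_diff \<phi> \<psi> f) < \<infinity>"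
        by (rule le_less_trans) (simp add: ennreal_mult_less_top)
      ultimately show "(\<lambda>z. comp_op \<phi> f z - comp_op \<psi> f z) \<in> bergman_space q \<beta>"
        unfolding comp bergman_space_def by simp
    qed
  qed

  have two_sided: "\<exists>C>0. \<forall>\<phi> \<psi> :: complex ^ 'n \<Rightarrow> complex ^ 'n.
        holomorphic_self_map \<phi> \<longrightarrow> holomorphic_self_map \<psi> \<longrightarrow>
        ennreal (1 / C) * carleson_sup s e (?\<omega> \<phi> \<psi>) \<le> epowr (bergman_op_norm p \<alpha> q \<beta> (comp_diff \<phi> \<psi>)) q \<and>
        epowr (bergman_op_norm p \<alpha> q \<beta> (comp_diff \<phi> \<psi>)) q \<le> ennreal C * carleson_sup s e (?\<omega> \<phi> \<psi>)" if s: "0 < s" for s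
  proof -
    obtain C1 where C1: "0 < C1" "U s C1" using U[OF s] by blast
    obtain C3 where C3: "0 < C3" "K s C3" using K[OF s] by blast
    define C where "C = max C1 (C3 * C2)"
    have C: "0 < C" "C1 \<le> C" "C3 * C2 \<le> C" using C1 by (auto simp: C_def)
    show ?thesis
    proof (intro exI[of _ C] conjI allI impI)
      fix \<phi> \<psi> :: "complex ^ 'n \<Rightarrow> complex ^ 'n"
      assume \<phi>: "holomorphic_self_map \<phi>" and \<psi>: "holomorphic_self_map \<psi>"
      define N0 where "N0 = bergman_op_norm p \<alpha> q \<beta> (comp_diff \<phi> \<psi>)"
      define N where "N = epowr N0 q"
      define S where "S = carleson_sup s e (?\<omega> \<phi> \<psi>)"
      have "N0 \<le> epowr (ennreal C * S) (1 / q)"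
        unfolding N0_def bergman_op_norm_def
      proof (rule SUP_least)
        fix f :: "complex ^ 'n \<Rightarrow> complex" assume "f \<in> {f \<in> bergman_space p \<alpha>. bergman_norm p \<alpha> f \<le> 1}"
        then have f: "mv_holomorphic_on f unit_ball" and f1: "bergman_mass p \<alpha> f \<le> 1"
          using bergman_norm_le_1_iff[OF p, of \<alpha> f] by (auto simp: bergman_space_def)
        have "bergman_mass q \<beta> (comp_diff \<phi> \<psi> f) \<le> ennreal (C1 * 1 powr (q / p)) * S"
          unfolding S_def
          by (rule C1(2)[unfolded U_def, rule_format, THEN conjunct2, rule_format]) (use f f1 \<phi> \<psi> \<beta> in auto)
        also have "\<dots> \<le> ennreal C * S" using C by (intro mult_right_mono) (auto intro: ennreal_leI)
        finally show "bergman_norm q \<beta> (comp_diff \<phi> \<psi> f) \<le> epowr (ennreal C * S) (1 / q)"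
          unfolding bergman_norm_def using q by (intro epowr_mono) auto
      qed
      then have "N \<le> epowr (epowr (ennreal C * S) (1 / q)) q"
        unfolding N_def using q by (intro epowr_mono)
      then show "epowr (bergman_op_norm p \<alpha> q \<beta> (comp_diff \<phi> \<psi>)) q \<le> ennreal C * carleson_sup s e (?\<omega> \<phi> \<psi>)"
        using q by (simp add: epowr_epowr N_def N0_def S_def)
      have "ennreal (1 / C) * S \<le> N"
      proof (cases N rule: ennreal_cases)
        case (real X)
        have "bergman_mass q \<beta> (comp_diff \<phi> \<psi> f) \<le> ennreal X"
          if f: "mv_holomorphic_on f unit_ball" and f1: "bergman_mass p \<alpha> f \<le> 1" for f :: "complex ^ 'n \<Rightarrow> complex"
        proof -
          have "f \<in> bergman_space p \<alpha>"
            using f le_less_trans[OF f1, of \<infinity>] by (simp add: bergman_space_def)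
          then have "bergman_norm q \<beta> (comp_diff \<phi> \<psi> f) \<le> N0"
            unfolding N0_def bergman_op_norm_def
            by (intro SUP_upper) (use bergman_norm_le_1_iff[OF p, of \<alpha> f] f1 in simp)
          then have "epowr (bergman_norm q \<beta> (comp_diff \<phi> \<psi> f)) q \<le> N"
            unfolding N_def by (rule epowr_mono[OF q])
          then show ?thesis unfolding epowr_bergman_norm[OF q q] real using q by simp
        qed
        then have "\<forall>a\<in>unit_ball. emeasure (?\<omega> \<phi> \<psi>) (bergman_ball a) \<le> ennreal (C2 * X * defect a powr e)"
          using real(1) by (intro ballI C2(2)[unfolded L_def, rule_format] \<phi> \<psi>) auto
        then have "S \<le> ennreal (C3 * (C2 * X))"
          unfolding S_def using real(1) C2(1)
          by (intro C3(2)[unfolded K_def, rule_format] sets_joint_pullback fin[OF \<phi> \<psi>]) auto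
        also have "\<dots> \<le> ennreal (C * X)"
          using C(3) real(1) by (intro ennreal_leI) (metis mult.assoc mult_right_mono)
        finally have "ennreal (1 / C) * S \<le> ennreal (1 / C) * ennreal (C * X)" by (rule mult_left_mono) simp
        also have "\<dots> = ennreal X" using C(1) real(1) by (simp flip: ennreal_mult)
        finally show ?thesis using real by simp
      qed simp
      then show "ennreal (1 / C) * carleson_sup s e (?\<omega> \<phi> \<psi>) \<le> epowr (bergman_op_norm p \<alpha> q \<beta> (comp_diff \<phi> \<psi>)) q"
        by (simp add: N_def N0_def S_def)
    qed (rule C(1))
  qed

  show ?thesis
  proof (intro conjI allI impI, goal_cases)
    case (1 \<phi> \<psi>)
    then show ?case by (rule equiv)
  next
    case (2 s)
    from two_sided[OF 2] obtain C where C: "0 < C" "\<forall>\<phi> \<psi> :: complex ^ 'n \<Rightarrow> complex ^ 'n.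
        holomorphic_self_map \<phi> \<longrightarrow> holomorphic_self_map \<psi> \<longrightarrow>
        ennreal (1 / C) * carleson_sup s e (?\<omega> \<phi> \<psi>) \<le> epowr (bergman_op_norm p \<alpha> q \<beta> (comp_diff \<phi> \<psi>)) q \<and>
        epowr (bergman_op_norm p \<alpha> q \<beta> (comp_diff \<phi> \<psi>)) q \<le> ennreal C * carleson_sup s e (?\<omega> \<phi> \<psi>)"
      by (elim exE conjE)
    show ?case
    proof (intro exI[of _ C] conjI allI impI, goal_cases)
      case 1
      show ?case by (rule C(1))
    next
      case (2 \<phi> \<psi>)
      show ?case
        using C(2)[rule_format, OF 2]
        unfolding e_lam comp Let_def SUP_carleson_kernel_joint_pullback[OF 2] .
    qed
  qed
qed

end
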